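(* There is an algorithm that, given an $n$-vertex, $m$-edge undirected unweighted graph $G=(V,E)$ and a set $S\subseteq V$ of $|S|=\sigma$ source vertices, solves the subset replacement paths problem on $(G,S)$ in $O(\sigma m)+\widetilde{O}(\sigma^2 n)$ time.
   Context: Subset replacement paths problem: given an undirected unweighted graph $G=(V,E)$ and $S\subseteq V$, output $\mathrm{dist}_{G\setminus\{e\}}(s,t)$ for every pair $s,t\in S$ and every edge $e\in E$ (it suffices to report these for edges $e$ on a shortest $s\leadsto t$ path, since otherwise the distance is unchanged). $\widetilde{O}$ hides polylogarithmic factors in $n$. The computational model is the word-RAM. *)

theory Defs
  imports Complex_Main "HOL-Library.Extended_Nat"
begin

section \<open>Undirected unweighted graphs\<close>

definition ugraph :: "'a set \<Rightarrow> 'a set set \<Rightarrow> bool" where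
  "ugraph V E \<longleftrightarrow> finite V \<and> (\<forall>e\<in>E. \<exists>u\<in>V. \<exists>v\<in>V. u \<noteq> v \<and> e = {u, v})"

text \<open>Walks are given by their vertex lists; the length of a walk is its number of edges.\<close>

definition is_walk :: "'a set set \<Rightarrow> 'a \<Rightarrow> 'a \<Rightarrow> 'a list \<Rightarrow> bool" where
  "is_walk E u v p \<longleftrightarrow> p \<noteq> [] \<and> hd p = u \<and> last p = v \<and>
     (\<forall>i. Suc i < length p \<longrightarrow> {p ! i, p ! Suc i} \<in> E)"

definition gdist :: "'a set set \<Rightarrow> 'a \<Rightarrow> 'a \<Rightarrow> enat" where
  "gdist E u v = Inf {enat (length p - 1) | p. is_walk E u v p}"


section \<open>The subset replacement paths problem\<close>

text \<open>
  The answer for a pair \<open>(s, t)\<close> is a pair \<open>(p, ds)\<close>: a shortest path \<open>p\<close> from \<open>s\<close> to \<open>t\<close>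
  (the empty list if \<open>t\<close> is not reachable from \<open>s\<close>), and the list \<open>ds\<close> of the replacement
  distances for the successive edges of \<open>p\<close>.  For an edge that is not on \<open>p\<close> the value reported
  is the length of \<open>p\<close>.
\<close>

definition path_edges :: "'a list \<Rightarrow> 'a set list" where
  "path_edges p = map (\<lambda>i. {p ! i, p ! Suc i}) [0..<length p - 1]"

definition reported_dist :: "'a list \<Rightarrow> enat list \<Rightarrow> 'a set \<Rightarrow> enat" where
  "reported_dist p ds e =
     (case map_of (zip (path_edges p) ds) e of
        Some d \<Rightarrow> d
      | None \<Rightarrow> if p = [] then \<infinity> else enat (length p - 1))"

definition correct_record :: "'a set set \<Rightarrow> 'a \<Rightarrow> 'a \<Rightarrow> 'a list \<times> enat list \<Rightarrow> bool" where
  "correct_record E s t = (\<lambda>(p, ds).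
     (if gdist E s t = \<infinity> then p = []
      else is_walk E s t p \<and> enat (length p - 1) = gdist E s t) \<and>
     length ds = length p - 1 \<and>
     (\<forall>e\<in>E. reported_dist p ds e = gdist (E - {e}) s t))"


section \<open>The word RAM\<close>

text \<open>
  All registers and memory cells hold words of \<open>w\<close> bits, represented as natural numbers below
  \<open>2 ^ w\<close>; memory is addressed by words.  The word size is a parameter of the semantics and not
  a type, because one fixed program has to work for all sufficiently large word sizes.  Every
  instruction takes one time unit.  A program mentions only finitely many registers.
\<close>

datatype binop = Add | Sub | Mul | Div | Mod | And | Or | Xor | Shl | Shr

datatype instr =
    Const nat nat             \<comment> \<open>\<open>r := c\<close>\<close>
  | Op binop nat nat nat      \<comment> \<open>\<open>r := r\<^sub>1 op r\<^sub>2\<close>\<close>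
  | Load nat nat              \<comment> \<open>\<open>r := mem[a]\<close>, the address being the content of register \<open>a\<close>\<close>
  | Store nat nat             \<comment> \<open>\<open>mem[a] := r\<close>, the address being the content of register \<open>a\<close>\<close>
  | Jump nat
  | JumpZero nat nat          \<comment> \<open>jump to \<open>l\<close> if \<open>r = 0\<close>\<close>
  | JumpLess nat nat nat      \<comment> \<open>jump to \<open>l\<close> if \<open>r\<^sub>1 < r\<^sub>2\<close>\<close>

type_synonym program = "instr list"

record config =
  pc :: nat
  reg :: "nat \<Rightarrow> nat"
  mem :: "nat \<Rightarrow> nat"

fun binop_val :: "nat \<Rightarrow> binop \<Rightarrow> nat \<Rightarrow> nat \<Rightarrow> nat" where
  "binop_val w Add x y = (x + y) mod 2 ^ w"
| "binop_val w Sub x y = (x + 2 ^ w - y) mod 2 ^ w"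
| "binop_val w Mul x y = (x * y) mod 2 ^ w"
| "binop_val w Div x y = x div y"
| "binop_val w Mod x y = x mod y"
| "binop_val w And x y = semiring_bit_operations_class.and x y"
| "binop_val w Or x y = semiring_bit_operations_class.or x y"
| "binop_val w Xor x y = semiring_bit_operations_class.xor x y"
| "binop_val w Shl x y = push_bit y x mod 2 ^ w"
| "binop_val w Shr x y = drop_bit y x"

fun exec :: "nat \<Rightarrow> instr \<Rightarrow> config \<Rightarrow> config" where
  "exec w (Const r c) \<sigma> = \<sigma>\<lparr>pc := Suc (pc \<sigma>), reg := (reg \<sigma>)(r := c mod 2 ^ w)\<rparr>"
| "exec w (Op f r r1 r2) \<sigma> =
     \<sigma>\<lparr>pc := Suc (pc \<sigma>), reg := (reg \<sigma>)(r := binop_val w f (reg \<sigma> r1) (reg \<sigma> r2))\<rparr>"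
| "exec w (Load r a) \<sigma> = \<sigma>\<lparr>pc := Suc (pc \<sigma>), reg := (reg \<sigma>)(r := mem \<sigma> (reg \<sigma> a))\<rparr>"
| "exec w (Store a r) \<sigma> = \<sigma>\<lparr>pc := Suc (pc \<sigma>), mem := (mem \<sigma>)(reg \<sigma> a := reg \<sigma> r)\<rparr>"
| "exec w (Jump l) \<sigma> = \<sigma>\<lparr>pc := l\<rparr>"
| "exec w (JumpZero r l) \<sigma> = \<sigma>\<lparr>pc := if reg \<sigma> r = 0 then l else Suc (pc \<sigma>)\<rparr>"
| "exec w (JumpLess r1 r2 l) \<sigma> = \<sigma>\<lparr>pc := if reg \<sigma> r1 < reg \<sigma> r2 then l else Suc (pc \<sigma>)\<rparr>"

definition halted :: "program \<Rightarrow> config \<Rightarrow> bool" where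
  "halted P \<sigma> \<longleftrightarrow> length P \<le> pc \<sigma>"

definition step :: "nat \<Rightarrow> program \<Rightarrow> config \<Rightarrow> config" where
  "step w P \<sigma> = (if halted P \<sigma> then \<sigma> else exec w (P ! pc \<sigma>) \<sigma>)"

text \<open>The input is stored from address \<open>0\<close> on; everything else is initially \<open>0\<close>.\<close>

definition init_config :: "nat list \<Rightarrow> config" where
  "init_config xs = \<lparr>pc = 0, reg = (\<lambda>_. 0), mem = (\<lambda>a. if a < length xs then xs ! a else 0)\<rparr>"

text \<open>On halting, register \<open>0\<close> holds the address at which the output starts.\<close>

definition computes_within :: "nat \<Rightarrow> program \<Rightarrow> nat list \<Rightarrow> nat list \<Rightarrow> nat \<Rightarrow> bool" where
  "computes_within w P xs ys T \<longleftrightarrow>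
     (let \<sigma> = (step w P ^^ T) (init_config xs) in
        halted P \<sigma> \<and> reg \<sigma> 0 + length ys \<le> 2 ^ w \<and>
        (\<forall>i<length ys. mem \<sigma> (reg \<sigma> 0 + i) = ys ! i))"


section \<open>Encoding of inputs and outputs\<close>

text \<open>
  The vertices are \<open>0, \<dots>, n - 1\<close>.  The graph is given by an unsorted list of its edges, each
  listed once and in one of its two orientations.
\<close>

definition encode_input :: "nat \<Rightarrow> (nat \<times> nat) list \<Rightarrow> nat list \<Rightarrow> nat list" where
  "encode_input n es ss =
     [n, length es, length ss] @ concat (map (\<lambda>(u, v). [u, v]) es) @ ss"

definition lists_edges :: "(nat \<times> nat) list \<Rightarrow> nat set set \<Rightarrow> bool" where
  "lists_edges es E \<longleftrightarrow>
     distinct (map (\<lambda>(u, v). {u, v}) es) \<and> set (map (\<lambda>(u, v). {u, v}) es) = E"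

text \<open>Finite distances are less than \<open>n\<close>, so that \<open>n\<close> can represent \<open>\<infinity>\<close>.\<close>

definition encode_dist :: "nat \<Rightarrow> enat \<Rightarrow> nat" where
  "encode_dist n d = (case d of enat k \<Rightarrow> k | \<infinity> \<Rightarrow> n)"

definition encode_record :: "nat \<Rightarrow> nat list \<times> enat list \<Rightarrow> nat list" where
  "encode_record n = (\<lambda>(p, ds). length p # p @ map (encode_dist n) ds)"

text \<open>The records of all ordered pairs of sources, in row-major order of the input list \<open>ss\<close>.\<close>

definition is_subset_rp_output ::
    "nat \<Rightarrow> nat set set \<Rightarrow> nat list \<Rightarrow> nat list \<Rightarrow> bool" where
  "is_subset_rp_output n E ss ys \<longleftrightarrow>
     (\<exists>R. (\<forall>s\<in>set ss. \<forall>t\<in>set ss. correct_record E s t (R s t)) \<and>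
          ys = concat (map (\<lambda>(s, t). encode_record n (R s t)) (List.product ss ss)))"

text \<open>
  \<open>P\<close> solves the problem within time \<open>B n m \<sigma>\<close>, on every word RAM with word size
  \<open>w \<ge> k * log 2 (n + 2)\<close>.  For \<open>k \<ge> 2\<close> all numbers in the input and their addresses are words.
\<close>

definition solves_subset_rp :: "program \<Rightarrow> nat \<Rightarrow> (nat \<Rightarrow> nat \<Rightarrow> nat \<Rightarrow> real) \<Rightarrow> bool" where
  "solves_subset_rp P k B \<longleftrightarrow>
     (\<forall>n E S es ss w.
        ugraph {..<n} E \<longrightarrow> S \<subseteq> {..<n} \<longrightarrow>
        lists_edges es E \<longrightarrow> distinct ss \<longrightarrow> set ss = S \<longrightarrow>
        (n + 2) ^ k \<le> (2::nat) ^ w \<longrightarrow>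
        (\<exists>T ys. real T \<le> B n (card E) (card S) \<and>
                is_subset_rp_output n E ss ys \<and>
                computes_within w P (encode_input n es ss) ys T))"

end

(* Let T_s be a breadth-first search tree of G from s, and let the edge e = {u, v} lie on the tree path
   from s to t, with v below u.  A shortest s-t path avoiding e leaves the complement of the subtree
   of v by some edge {x, y}; its length is at least d(s,x) + 1 + d(y,t), and this value is attained,
   because the tree path from s to x avoids e and no shortest path from y to t uses e.  Hence the
   replacement distance for e is the minimum of d(s,x) + 1 + d(y,t) over all non-tree edges {x, y} with
   y inside and x outside the subtree of v.

   For fixed y the value d(s,x) - d(s,y) is -1, 0 or 1.  In each layer the vertices of a subtree are
   contiguous in queue order, so for each of the three values it suffices to remember the
   first and the last such neighbour x of y in queue order: if any is outside the subtree, one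
   of these two is.  They are recorded during the search, in time O(m) per source, and leave O(n)
   candidates for each pair (s, t).  A candidate serves the edges of an interval of the s-t path, and
   the minima over intervals are computed offline with dyadic blocks in time O(n log n). *)

theory Submission
  imports Defs
begin

section \<open>An array language whose runs carry a clock\<close>

section \<open>A while language with arrays on the word RAM\<close>

text \<open>The term d(y,t) is read off the search rooted at \<open>t\<close>: the target is a
  source too, so two stored labels give the value of a candidate. Its interval arises thus. Let
  \<open>J x\<close> be the depth of the deepest path vertex that is \<open>x\<close> or an ancestor
  of \<open>x\<close>; the candidate {x, y} serves the \<open>i\<close>-th path edge exactly if
  \<open>J x \<le> i\<close> and \<open>i < J y\<close>. Contiguity of subtrees within a layer rests
  on parents appearing in queue order.

  The bound has to hold on the machine itself. The algorithm is therefore written in a small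
  language with a clock and compiled; one tick pays for at most as many machine steps as the
  compiled code has instructions. With fewer than 16 arrays all addresses lie below
  \<open>16 * R * R \<le> R ^ 3\<close>, whence the word size exponent 12.\<close>

datatype var =
    vN | vM | vSG | vK | vEN | vU | vW | vSA | vS | vSB | vT | vQH | vQT | vX | vY | vP | vO | vTB
  | vLEN | vI | vCN | vDX | vCJ | vCE | vZ | vL | vR | vVAL | vPOS | vLV

datatype arr =
    aIN | aHEAD | aNXT | aDST | aD | aPAR | aQU | aFS | aLS | aQN | aJ | aTAB | aOUT

datatype exp =
    Var var | Num nat | Plus exp exp | Minus exp exp | Half exp | Odd exp | Get arr exp exp

datatype bexp = Less exp exp | Eq exp exp

datatype com =
    Skip | Assign var exp ("_ ::= _" [1000, 61] 61) | Put arr exp exp exp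
  | Seq com com (infixr ";;" 60) | Cond bexp com com | While bexp com

type_synonym vars = "var \<Rightarrow> nat"
type_synonym arrs = "arr \<Rightarrow> nat \<Rightarrow> nat \<Rightarrow> nat"

fun ev :: "vars \<Rightarrow> arrs \<Rightarrow> exp \<Rightarrow> nat" where
  "ev v A (Var x) = v x"
| "ev v A (Num c) = c"
| "ev v A (Plus a b) = ev v A a + ev v A b"
| "ev v A (Minus a b) = ev v A a - ev v A b"
| "ev v A (Half a) = ev v A a div 2"
| "ev v A (Odd a) = ev v A a mod 2"
| "ev v A (Get a i j) = A a (ev v A i) (ev v A j)"

text \<open>Where this holds, evaluation over unbounded naturals agrees with arithmetic modulo
  \<open>2 ^ w\<close>: sums stay below \<open>R\<close> and differences are not truncated. For
  \<open>Get\<close>, safe indices suffice, because the simulation relation keeps all array entries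
  below \<open>R\<close>.\<close>

fun safe :: "nat \<Rightarrow> vars \<Rightarrow> arrs \<Rightarrow> exp \<Rightarrow> bool" where
  "safe R v A (Var x) = True"
| "safe R v A (Num c) = (c < R)"
| "safe R v A (Plus a b) = (safe R v A a \<and> safe R v A b \<and> ev v A a + ev v A b < R)"
| "safe R v A (Minus a b) = (safe R v A a \<and> safe R v A b \<and> ev v A b \<le> ev v A a)"
| "safe R v A (Half a) = safe R v A a"
| "safe R v A (Odd a) = safe R v A a"
| "safe R v A (Get a i j) = (safe R v A i \<and> safe R v A j)"

fun bev :: "vars \<Rightarrow> arrs \<Rightarrow> bexp \<Rightarrow> bool" where
  "bev v A (Less a b) = (ev v A a < ev v A b)"
| "bev v A (Eq a b) = (ev v A a = ev v A b)"

fun bsafe :: "nat \<Rightarrow> vars \<Rightarrow> arrs \<Rightarrow> bexp \<Rightarrow> bool" where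
  "bsafe R v A (Less a b) = (safe R v A a \<and> safe R v A b)"
| "bsafe R v A (Eq a b) = (safe R v A a \<and> safe R v A b)"

definition upd :: "arrs \<Rightarrow> arr \<Rightarrow> nat \<Rightarrow> nat \<Rightarrow> nat \<Rightarrow> arrs" where
  "upd A a i j x = A(a := (A a)(i := (A a i)(j := x)))"

text \<open>The last component of a state is a clock that counts assignments and tests.\<close>

inductive big :: "nat \<Rightarrow> com \<Rightarrow> vars \<Rightarrow> arrs \<Rightarrow> nat \<Rightarrow> vars \<Rightarrow> arrs \<Rightarrow> nat \<Rightarrow> bool" for R where
  Skip: "big R Skip v A k v A k"
| Assign: "safe R v A e \<Longrightarrow> big R (x ::= e) v A k (v(x := ev v A e)) A (Suc k)"
| Put: "safe R v A i \<Longrightarrow> safe R v A j \<Longrightarrow> safe R v A e \<Longrightarrow>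
    big R (Put a i j e) v A k v (upd A a (ev v A i) (ev v A j) (ev v A e)) (Suc k)"
| Seq: "big R c v A k v1 A1 k1 \<Longrightarrow> big R d v1 A1 k1 v2 A2 k2 \<Longrightarrow> big R (c ;; d) v A k v2 A2 k2"
| CondT: "bsafe R v A b \<Longrightarrow> bev v A b \<Longrightarrow> big R c v A (Suc k) v1 A1 k1 \<Longrightarrow> big R (Cond b c d) v A k v1 A1 k1"
| CondF: "bsafe R v A b \<Longrightarrow> \<not> bev v A b \<Longrightarrow> big R d v A (Suc k) v1 A1 k1 \<Longrightarrow> big R (Cond b c d) v A k v1 A1 k1"
| WhileT: "bsafe R v A b \<Longrightarrow> bev v A b \<Longrightarrow> big R c v A (Suc k) v1 A1 k1 \<Longrightarrow>
    big R (While b c) v1 A1 k1 v2 A2 k2 \<Longrightarrow> big R (While b c) v A k v2 A2 k2"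
| WhileF: "bsafe R v A b \<Longrightarrow> \<not> bev v A b \<Longrightarrow> big R (While b c) v A k v A (Suc k)"

text \<open>Total correctness with the clock as an argument of the postcondition, so that
  termination, result and running time are proved together.\<close>

definition wp :: "nat \<Rightarrow> com \<Rightarrow> (vars \<Rightarrow> arrs \<Rightarrow> nat \<Rightarrow> bool) \<Rightarrow> vars \<Rightarrow> arrs \<Rightarrow> nat \<Rightarrow> bool" where
  "wp R c Q v A k \<longleftrightarrow> (\<exists>v' A' k'. big R c v A k v' A' k' \<and> Q v' A' k')"

lemma wp_mono: "wp R c Q v A k \<Longrightarrow> (\<And>v A k. Q v A k \<Longrightarrow> Q' v A k) \<Longrightarrow> wp R c Q' v A k"
  unfolding wp_def by blast

section \<open>Compilation to machine code and its simulation theorem\<close>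

subsection \<open>Compilation to the word RAM\<close>

text \<open>Numbering starts at 2 because register 0 must deliver the output address and register 1
  holds \<open>R\<close>.\<close>

fun vreg :: "var \<Rightarrow> nat" where
  "vreg vN = 2" | "vreg vM = 3" | "vreg vSG = 4" | "vreg vK = 5" | "vreg vEN = 6" | "vreg vU = 7"
| "vreg vW = 8" | "vreg vSA = 9" | "vreg vS = 10" | "vreg vSB = 11" | "vreg vT = 12"
| "vreg vQH = 13" | "vreg vQT = 14" | "vreg vX = 15" | "vreg vY = 16" | "vreg vP = 17"
| "vreg vO = 18" | "vreg vTB = 19" | "vreg vLEN = 20" | "vreg vI = 21" | "vreg vCN = 22"
| "vreg vDX = 23" | "vreg vCJ = 24" | "vreg vCE = 25" | "vreg vZ = 26" | "vreg vL = 27"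
| "vreg vR = 28" | "vreg vVAL = 29" | "vreg vPOS = 30" | "vreg vLV = 31"

fun aid :: "arr \<Rightarrow> nat" where
  "aid aIN = 0" | "aid aHEAD = 1" | "aid aNXT = 2" | "aid aDST = 3" | "aid aD = 4" | "aid aPAR = 5"
| "aid aQU = 6" | "aid aFS = 7" | "aid aLS = 8" | "aid aQN = 9" | "aid aJ = 10" | "aid aTAB = 11"
| "aid aOUT = 12"

lemma vreg_inj: "vreg x = vreg y \<longleftrightarrow> x = y"
  by (cases x; cases y) simp_all

lemma vreg_bounds: "2 \<le> vreg x" "vreg x < 32"
  by (cases x; simp)+

lemma aid_inj: "aid x = aid y \<longleftrightarrow> x = y"
  by (cases x; cases y) simp_all

lemma aid_less: "aid a < 16"
  by (cases a) simp_all

text \<open>Register 1 holds the side length \<open>R\<close> of all arrays; registers from 32 on are temporaries.\<close>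

definition addr_code :: "nat \<Rightarrow> arr \<Rightarrow> instr list" where
  "addr_code t a = [Const (t+2) (aid a), Op Mul (t+2) (t+2) 1, Op Add t t (t+2), Op Mul t t 1, Op Add t t (t+1)]"

text \<open>The registers from \<open>t\<close> on form an evaluation stack: the value ends up in
  \<open>t\<close> and nothing below \<open>t\<close> changes. There is no move instruction;
  \<open>Or\<close> of a register with itself copies it.\<close>

fun cexp :: "nat \<Rightarrow> exp \<Rightarrow> instr list" where
  "cexp t (Var x) = [Op Or t (vreg x) (vreg x)]"
| "cexp t (Num c) = [Const t c]"
| "cexp t (Plus a b) = cexp t a @ cexp (t+1) b @ [Op Add t t (t+1)]"
| "cexp t (Minus a b) = cexp t a @ cexp (t+1) b @ [Op Sub t t (t+1)]"
| "cexp t (Half a) = cexp t a @ [Const (t+1) 2, Op Div t t (t+1)]"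
| "cexp t (Odd a) = cexp t a @ [Const (t+1) 2, Op Mod t t (t+1)]"
| "cexp t (Get a i j) = cexp t i @ cexp (t+1) j @ addr_code t a @ [Load t t]"

fun ctest :: "bexp \<Rightarrow> instr list" where
  "ctest (Less a b) = cexp 32 a @ cexp 33 b"
| "ctest (Eq a b) = cexp 32 a @ cexp 33 b @ [Op Sub 32 32 33]"

fun cjump :: "bexp \<Rightarrow> nat \<Rightarrow> instr" where
  "cjump (Less a b) l = JumpLess 32 33 l"
| "cjump (Eq a b) l = JumpZero 32 l"

text \<open>The start address is a parameter because jumps are absolute. The conditional jump is
  taken when the test succeeds, so \<open>Cond\<close> places its else branch first, and
  \<open>While\<close> needs a second jump to leave the loop.\<close>

fun ccom :: "nat \<Rightarrow> com \<Rightarrow> instr list" where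
  "ccom p Skip = []"
| "ccom p (x ::= e) = cexp 32 e @ [Op Or (vreg x) 32 32]"
| "ccom p (Put a i j e) = cexp 32 i @ cexp 33 j @ addr_code 32 a @ cexp 33 e @ [Store 32 33]"
| "ccom p (c ;; d) = (let cc = ccom p c in cc @ ccom (p + length cc) d)"
| "ccom p (Cond b c d) =
     (let n = length (ctest b); cd = ccom (p + n + 1) d; q = p + n + 1 + length cd + 1; cc = ccom q c
      in ctest b @ [cjump b q] @ cd @ [Jump (q + length cc)] @ cc)"
| "ccom p (While b c) =
     (let n = length (ctest b); q = p + n + 2; cc = ccom q c
      in ctest b @ [cjump b q, Jump (q + length cc + 1)] @ cc @ [Jump p])"

fun straight :: "instr \<Rightarrow> bool" where
  "straight (Jump _) = False"
| "straight (JumpZero _ _) = False"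
| "straight (JumpLess _ _ _) = False"
| "straight _ = True"

definition code_at :: "program \<Rightarrow> nat \<Rightarrow> instr list \<Rightarrow> bool" where
  "code_at P p is \<longleftrightarrow> p + length is \<le> length P \<and> (\<forall>i<length is. P ! (p + i) = is ! i)"

lemma code_at_append: "code_at P p (xs @ ys) \<longleftrightarrow> code_at P p xs \<and> code_at P (p + length xs) ys"
proof
  assume L: "code_at P p (xs @ ys)"
  have "P ! (p + length xs + i) = ys ! i" if "i < length ys" for i
    using L that unfolding code_at_def by (auto dest: spec[of _ "length xs + i"] simp: add.assoc)
  moreover have "P ! (p + i) = xs ! i" if "i < length xs" for i
    using L that unfolding code_at_def by (auto dest: spec[of _ i] simp: nth_append)
  ultimately show "code_at P p xs \<and> code_at P (p + length xs) ys"
    using L unfolding code_at_def by simp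
next
  assume R: "code_at P p xs \<and> code_at P (p + length xs) ys"
  have "P ! (p + i) = (xs @ ys) ! i" if "i < length (xs @ ys)" for i
  proof (cases "i < length xs")
    case True
    then show ?thesis using R by (simp add: code_at_def nth_append)
  next
    case False
    moreover from this have "P ! (p + length xs + (i - length xs)) = ys ! (i - length xs)"
      using R that unfolding code_at_def by (simp del: add_diff_assoc)
    ultimately show ?thesis by (simp add: nth_append)
  qed
  then show "code_at P p (xs @ ys)"
    using R unfolding code_at_def by simp
qed

lemma code_at_Cons: "code_at P p (x # xs) \<longleftrightarrow> p < length P \<and> P ! p = x \<and> code_at P (Suc p) xs"
  using code_at_append[of P p "[x]" xs] by (auto simp: code_at_def)

lemma code_at_Nil: "code_at P p [] \<longleftrightarrow> p \<le> length P"
  by (simp add: code_at_def)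

lemma pc_exec_straight: "straight i \<Longrightarrow> pc (exec w i \<sigma>) = Suc (pc \<sigma>)"
  by (cases i) auto

lemma run_straight:
  assumes "code_at P (pc \<sigma>) is" "list_all straight is"
  shows "(step w P ^^ length is) \<sigma> = fold (exec w) is \<sigma>" "pc (fold (exec w) is \<sigma>) = pc \<sigma> + length is"
proof -
  have "(step w P ^^ length is) \<sigma> = fold (exec w) is \<sigma> \<and> pc (fold (exec w) is \<sigma>) = pc \<sigma> + length is"
    using assms
  proof (induction "is" arbitrary: \<sigma>)
    case Nil
    then show ?case by simp
  next
    case (Cons i "is")
    have 1: "step w P \<sigma> = exec w i \<sigma>"
      using Cons.prems by (simp add: code_at_Cons step_def halted_def)
    have pc: "pc (exec w i \<sigma>) = Suc (pc \<sigma>)"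
      using Cons.prems by (simp add: pc_exec_straight)
    have "code_at P (pc (exec w i \<sigma>)) is"
      using Cons.prems pc by (simp add: code_at_Cons)
    from Cons.IH[OF this] show ?case
      using Cons.prems 1 pc by (simp add: funpow_swap1 del: funpow.simps(2)) (simp add: funpow_swap1)
  qed
  then show "(step w P ^^ length is) \<sigma> = fold (exec w) is \<sigma>"
    "pc (fold (exec w) is \<sigma>) = pc \<sigma> + length is" by auto
qed

lemma straight_addr_code: "list_all straight (addr_code t a)"
  by (simp add: addr_code_def)

lemma straight_cexp: "list_all straight (cexp t e)"
  by (induction e arbitrary: t) (auto simp: straight_addr_code)

lemma straight_ctest: "list_all straight (ctest b)"
  by (cases b) (auto simp: straight_cexp)

text \<open>The identifier and the two indices are digits in base \<open>R\<close>. Since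
  \<open>aid aIN = 0\<close>, row 0 of \<open>aIN\<close> starts at address 0, exactly where the
  machine puts the input.\<close>

definition addr :: "nat \<Rightarrow> arr \<Rightarrow> nat \<Rightarrow> nat \<Rightarrow> nat" where
  "addr R a i j = (aid a * R + i) * R + j"

lemma addr_inj:
  assumes "i < R" "j < R" "i' < R" "j' < R"
  shows "addr R a i j = addr R a' i' j' \<longleftrightarrow> a = a' \<and> i = i' \<and> j = j'"
proof
  assume eq: "addr R a i j = addr R a' i' j'"
  have j: "addr R b k l mod R = l" and d: "addr R b k l div R = aid b * R + k" if "l < R" for b k l
    using that by (simp_all add: addr_def)
  have "j = j'" "aid a * R + i = aid a' * R + i'"
    using eq j d assms by metis+
  from this(2) have "(aid a * R + i) mod R = (aid a' * R + i') mod R"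
    "(aid a * R + i) div R = (aid a' * R + i') div R" by simp_all
  then have "i = i'" "aid a = aid a'"
    using assms by simp_all
  with \<open>j = j'\<close> show "a = a' \<and> i = i' \<and> j = j'"
    by (simp add: aid_inj)
qed auto

text \<open>All identifiers are below 16, so \<open>16 * R * R\<close> bounds every address, while
  \<open>R\<close> bounds indices and stored values.\<close>

locale ram =
  fixes w R :: nat
  assumes R16: "16 \<le> R" and W: "16 * R * R \<le> 2 ^ w"
begin

lemma R_le: "R \<le> 2 ^ w" "x < R \<Longrightarrow> x < 2 ^ w" "x < R \<Longrightarrow> y < R \<Longrightarrow> x + y < 2 ^ w" "x < 16 \<Longrightarrow> x < 2 ^ w"
proof -
  have "1 * R * 1 \<le> 16 * R * R" "16 * R * 1 \<le> 16 * R * R"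
    using R16 by (intro mult_le_mono; simp)+
  then show "R \<le> 2 ^ w" "x < R \<Longrightarrow> x < 2 ^ w" "x < R \<Longrightarrow> y < R \<Longrightarrow> x + y < 2 ^ w" "x < 16 \<Longrightarrow> x < 2 ^ w"
    using W R16 by linarith+
qed

lemma addr_less:
  assumes "i < R" "j < R"
  shows "aid a * R + i < 2 ^ w" "(aid a * R + i) * R < 2 ^ w" "addr R a i j < 2 ^ w" "aid a * R < 2 ^ w"
proof -
  have "aid a * R \<le> 15 * R" using aid_less[of a] by simp
  then have 1: "aid a * R + i < 16 * R" using assms by linarith
  have "(aid a * R + i + 1) * R \<le> 16 * R * R"
    using 1 by (intro mult_le_mono1) simp
  then show 3: "addr R a i j < 2 ^ w" "(aid a * R + i) * R < 2 ^ w" using assms W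
    by (simp_all add: addr_def algebra_simps)
  have "aid a * R + i \<le> (aid a * R + i) * R" using R16 by simp
  then show "aid a * R + i < 2 ^ w" using 3(2) by (rule le_less_trans)
  then show "aid a * R < 2 ^ w" by linarith
qed

text \<open>Restricting both indices to values below \<open>R\<close> is what makes
  \<open>addr\<close> injective; safe programs address no other cells.\<close>

definition rel :: "config \<Rightarrow> vars \<Rightarrow> arrs \<Rightarrow> bool" where
  "rel \<sigma> v A \<longleftrightarrow> reg \<sigma> 1 = R \<and> (\<forall>x. reg \<sigma> (vreg x) = v x \<and> v x < R) \<and>
     (\<forall>a. \<forall>i<R. \<forall>j<R. mem \<sigma> (addr R a i j) = A a i j \<and> A a i j < R)"

definition keeps :: "nat \<Rightarrow> config \<Rightarrow> config \<Rightarrow> bool" where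
  "keeps t \<sigma> \<sigma>' \<longleftrightarrow> mem \<sigma>' = mem \<sigma> \<and> (\<forall>r<t. reg \<sigma>' r = reg \<sigma> r)"

lemma keeps_rel: "keeps t \<sigma> \<sigma>' \<Longrightarrow> 32 \<le> t \<Longrightarrow> rel \<sigma> v A \<Longrightarrow> rel \<sigma>' v A"
  unfolding keeps_def rel_def using vreg_bounds(2) by (metis le_trans less_le_trans numeral_le_iff one_le_numeral semiring_norm(69) one_less_numeral_iff semiring_norm(76))

lemma keeps_trans: "keeps t \<sigma> \<sigma>' \<Longrightarrow> keeps t' \<sigma>' \<sigma>'' \<Longrightarrow> t \<le> t' \<Longrightarrow> keeps t \<sigma> \<sigma>''"
  unfolding keeps_def by auto

lemma ev_less: "rel \<sigma> v A \<Longrightarrow> safe R v A e \<Longrightarrow> ev v A e < R"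
  using R16 by (induction e) (auto simp: rel_def)

lemma addr_code_correct:
  assumes "reg \<sigma> 1 = R" "reg \<sigma> t = i" "reg \<sigma> (t+1) = j" "i < R" "j < R" "32 \<le> t"
  shows "reg (fold (exec w) (addr_code t a) \<sigma>) t = addr R a i j"
    "keeps t \<sigma> (fold (exec w) (addr_code t a) \<sigma>)"
proof -
  have *: "aid a < 2 ^ w" using R_le(4)[OF aid_less] .
  show "reg (fold (exec w) (addr_code t a) \<sigma>) t = addr R a i j"
    using assms addr_less[OF assms(4,5), of a] *
    by (simp add: addr_code_def addr_def add.commute mult.commute)
  show "keeps t \<sigma> (fold (exec w) (addr_code t a) \<sigma>)"
    by (simp add: addr_code_def keeps_def)
qed

lemma cexp_correct:
  assumes "rel \<sigma> v A" "safe R v A e" "32 \<le> t"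
  shows "reg (fold (exec w) (cexp t e) \<sigma>) t = ev v A e \<and> keeps t \<sigma> (fold (exec w) (cexp t e) \<sigma>)"
  using assms
proof (induction e arbitrary: t \<sigma>)
  case (Var x)
  then show ?case by (simp add: rel_def keeps_def)
next
  case (Num c)
  then show ?case using R_le by (simp add: keeps_def)
next
  case (Plus a b)
  let ?s1 = "fold (exec w) (cexp t a) \<sigma>"
  let ?s2 = "fold (exec w) (cexp (t+1) b) ?s1"
  have 1: "reg ?s1 t = ev v A a" "keeps t \<sigma> ?s1" using Plus by auto
  have r: "rel ?s1 v A" using keeps_rel 1 Plus.prems by blast
  have 2: "reg ?s2 (t+1) = ev v A b" "keeps (t+1) ?s1 ?s2" using Plus r by auto
  have "reg ?s2 t = ev v A a" using 2 1 by (simp add: keeps_def)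
  moreover have "ev v A a + ev v A b < 2 ^ w" using Plus.prems R_le by simp
  moreover have "keeps t \<sigma> ?s2" using keeps_trans[OF 1(2) 2(2)] by simp
  ultimately show ?case using 2 by (simp add: keeps_def)
next
  case (Minus a b)
  let ?s1 = "fold (exec w) (cexp t a) \<sigma>"
  let ?s2 = "fold (exec w) (cexp (t+1) b) ?s1"
  have 1: "reg ?s1 t = ev v A a" "keeps t \<sigma> ?s1" using Minus by auto
  have r: "rel ?s1 v A" using keeps_rel 1 Minus.prems by blast
  have 2: "reg ?s2 (t+1) = ev v A b" "keeps (t+1) ?s1 ?s2" using Minus r by auto
  have "reg ?s2 t = ev v A a" using 2 1 by (simp add: keeps_def)
  moreover have "(ev v A a + 2 ^ w - ev v A b) mod 2 ^ w = ev v A a - ev v A b"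
  proof -
    have "ev v A a - ev v A b < 2 ^ w" using Minus.prems R_le(2)[OF ev_less[of \<sigma> v A a]] by simp
    moreover have "ev v A a + 2 ^ w - ev v A b = (ev v A a - ev v A b) + 2 ^ w" using Minus.prems by simp
    ultimately show ?thesis by (simp only: mod_add_self2 mod_less)
  qed
  moreover have "keeps t \<sigma> ?s2" using keeps_trans[OF 1(2) 2(2)] by simp
  moreover have "fold (exec w) (cexp t (Minus a b)) \<sigma> = exec w (Op Sub t t (t+1)) ?s2" by simp
  ultimately show ?case using 2(1) unfolding keeps_def exec.simps binop_val.simps ev.simps
    by (simp only:) simp
next
  case (Half a)
  have *: "2 < (2::nat) ^ w" using R_le(4)[of 2] by simp
  show ?case using Half * by (simp add: keeps_def)
next
  case (Odd a)
  have *: "2 < (2::nat) ^ w" using R_le(4)[of 2] by simp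
  show ?case using Odd * by (simp add: keeps_def)
next
  case (Get a i j)
  let ?s1 = "fold (exec w) (cexp t i) \<sigma>"
  let ?s2 = "fold (exec w) (cexp (t+1) j) ?s1"
  let ?s3 = "fold (exec w) (addr_code t a) ?s2"
  have 1: "reg ?s1 t = ev v A i" "keeps t \<sigma> ?s1" using Get by auto
  have r: "rel ?s1 v A" using keeps_rel 1 Get.prems by blast
  have 2: "reg ?s2 (t+1) = ev v A j" "keeps (t+1) ?s1 ?s2" using Get r by auto
  have r2: "rel ?s2 v A" using keeps_rel[OF 2(2)] r Get.prems by simp
  have t: "reg ?s2 t = ev v A i" using 2 1 by (simp add: keeps_def)
  have ij: "ev v A i < R" "ev v A j < R" using Get.prems ev_less by auto
  have k2: "keeps t \<sigma> ?s2" using keeps_trans[OF 1(2) 2(2)] by simp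
  have R1: "reg ?s2 1 = R" using r2 by (simp add: rel_def)
  have 3: "reg ?s3 t = addr R a (ev v A i) (ev v A j)" "keeps t ?s2 ?s3"
    using addr_code_correct[OF R1 t 2(1) ij Get.prems(3)] by auto
  have k3: "keeps t \<sigma> ?s3" using keeps_trans[OF k2 3(2)] by simp
  have "mem ?s3 (reg ?s3 t) = A a (ev v A i) (ev v A j)"
    using 3 ij k3 Get.prems(1) by (simp add: keeps_def rel_def)
  then show ?case using k3 by (simp add: keeps_def)
qed

lemma rel_upd:
  assumes "rel \<sigma> v A" "i < R" "j < R" "x < R"
  shows "rel (\<sigma>\<lparr>pc := p, mem := (mem \<sigma>)(addr R a i j := x)\<rparr>) v (upd A a i j x)"
  using assms addr_inj unfolding rel_def by (auto simp: upd_def)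

lemma rel_pc: "rel (\<sigma>\<lparr>pc := p\<rparr>) v A \<longleftrightarrow> rel \<sigma> v A"
  by (simp add: rel_def)

lemma rel_assign:
  assumes "rel \<sigma> v A" "y < R"
  shows "rel (\<sigma>\<lparr>pc := p, reg := (reg \<sigma>)(vreg x := y)\<rparr>) (v(x := y)) A"
  using assms vreg_bounds(1)[of x] unfolding rel_def by (auto simp: vreg_inj)

lemma ctest_correct:
  assumes "rel \<sigma> v A" "bsafe R v A b"
  defines "\<sigma>' \<equiv> fold (exec w) (ctest b) \<sigma>"
  shows "rel \<sigma>' v A" "exec w (cjump b l) \<sigma>' = \<sigma>'\<lparr>pc := if bev v A b then l else Suc (pc \<sigma>')\<rparr>"
proof -
  have two: "reg (fold (exec w) (cexp 33 y) (fold (exec w) (cexp 32 x) \<sigma>)) 32 = ev v A x \<and>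
      reg (fold (exec w) (cexp 33 y) (fold (exec w) (cexp 32 x) \<sigma>)) 33 = ev v A y \<and>
      keeps 32 \<sigma> (fold (exec w) (cexp 33 y) (fold (exec w) (cexp 32 x) \<sigma>))"
    if "safe R v A x" "safe R v A y" for x y
  proof -
    let ?s1 = "fold (exec w) (cexp 32 x) \<sigma>"
    let ?s2 = "fold (exec w) (cexp 33 y) ?s1"
    have 1: "reg ?s1 32 = ev v A x" "keeps 32 \<sigma> ?s1" using cexp_correct[OF assms(1) that(1), of 32] by auto
    have r: "rel ?s1 v A" using keeps_rel[OF 1(2)] assms(1) by simp
    have 2: "reg ?s2 33 = ev v A y" "keeps 33 ?s1 ?s2" using cexp_correct[OF r that(2), of 33] by auto
    show ?thesis using 1 2 keeps_trans[OF 1(2) 2(2)] by (simp add: keeps_def)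
  qed
  show "rel \<sigma>' v A"
  proof (cases b)
    case (Less x y)
    then show ?thesis using two[of x y] assms keeps_rel[of 32] by auto
  next
    case (Eq x y)
    let ?s = "fold (exec w) (cexp 33 y) (fold (exec w) (cexp 32 x) \<sigma>)"
    have "keeps 32 \<sigma> \<sigma>'" using two[of x y] assms Eq by (simp add: keeps_def)
    then show ?thesis using keeps_rel[of 32] assms(1) by auto
  qed
  show "exec w (cjump b l) \<sigma>' = \<sigma>'\<lparr>pc := if bev v A b then l else Suc (pc \<sigma>')\<rparr>"
  proof (cases b)
    case (Less x y)
    then show ?thesis using two[of x y] assms by simp
  next
    case (Eq x y)
    have xy: "ev v A x < 2 ^ w" "ev v A y < 2 ^ w" using assms Eq ev_less R_le(2) by auto
    \<comment> \<open>Both values are words, so the dividend lies strictly between 0 and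
      \<open>2 * 2 ^ w\<close>; the only multiple of \<open>2 ^ w\<close> it can be is
      \<open>2 ^ w\<close> itself.\<close>
    have "(ev v A x + 2 ^ w - ev v A y) mod 2 ^ w = 0 \<longleftrightarrow> ev v A x = ev v A y"
    proof
      assume 0: "(ev v A x + 2 ^ w - ev v A y) mod 2 ^ w = 0"
      then obtain q where q: "ev v A x + 2 ^ w - ev v A y = 2 ^ w * q" by auto
      have "0 < 2 ^ w * q" "2 ^ w * q < 2 ^ w * 2" using q xy by linarith+
      then have "q = 1" by (cases q) auto
      then show "ev v A x = ev v A y" using q xy by simp
    qed simp
    then show ?thesis using two[of x y] assms Eq by simp
  qed
qed

lemma code_step: "code_at P (pc \<sigma>) (i # is) \<Longrightarrow> step w P \<sigma> = exec w i \<sigma>"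
  by (simp add: code_at_Cons step_def halted_def)

definition runs :: "program \<Rightarrow> nat \<Rightarrow> config \<Rightarrow> config \<Rightarrow> bool" where
  "runs P N \<sigma> \<sigma>' \<longleftrightarrow> (step w P ^^ N) \<sigma> = \<sigma>'"

lemma runs_trans: "runs P N \<sigma> \<sigma>' \<Longrightarrow> runs P N' \<sigma>' \<sigma>'' \<Longrightarrow> runs P (N + N') \<sigma> \<sigma>''"
  unfolding runs_def by (metis add.commute funpow_add o_apply)

lemma runs_step: "code_at P (pc \<sigma>) (i # is) \<Longrightarrow> exec w i \<sigma> = \<sigma>' \<Longrightarrow> runs P 1 \<sigma> \<sigma>'"
  unfolding runs_def using code_step by simp

lemma runs_straight: "code_at P (pc \<sigma>) is \<Longrightarrow> list_all straight is \<Longrightarrow> runs P (length is) \<sigma> (fold (exec w) is \<sigma>)"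
  unfolding runs_def by (rule run_straight)

text \<open>Each tick is charged for one assignment, or for one test with its jumps, and these
  instructions are part of the code, whose length is at most \<open>K\<close>. The form
  \<open>N + K * k \<le> K * k'\<close> avoids subtraction and telescopes over sequences and loop
  iterations, with the same \<open>K\<close> for all subcommands.\<close>

lemma ccom_correct:
  assumes "big R c v A k v' A' k'" "code_at P p (ccom p c)" "length (ccom p c) \<le> K"
    "rel \<sigma> v A" "pc \<sigma> = p"
  shows "\<exists>N \<sigma>'. runs P N \<sigma> \<sigma>' \<and> rel \<sigma>' v' A' \<and> pc \<sigma>' = p + length (ccom p c) \<and> N + K * k \<le> K * k' \<and> k \<le> k'"
  using assms
proof (induction arbitrary: p \<sigma> rule: big.induct)
  case (Skip v A k)
  then show ?case by (intro exI[of _ 0] exI[of _ \<sigma>]) (simp add: runs_def)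
next
  case (Assign v A e x k)
  let ?is = "cexp 32 e @ [Op Or (vreg x) 32 32]"
  have st: "list_all straight ?is" by (simp add: straight_cexp)
  have c: "code_at P (pc \<sigma>) ?is" using Assign by simp
  let ?s = "fold (exec w) (cexp 32 e) \<sigma>"
  have 1: "reg ?s 32 = ev v A e" "keeps 32 \<sigma> ?s" using cexp_correct[OF Assign.prems(3) Assign.hyps, of 32] by auto
  have "rel ?s v A" using keeps_rel[OF 1(2)] Assign.prems by simp
  from rel_assign[OF this ev_less[OF this Assign.hyps], where p = "Suc (pc ?s)" and x = x]
  have "rel (fold (exec w) ?is \<sigma>) (v(x := ev v A e)) A" using 1 by simp
  moreover have "pc (fold (exec w) ?is \<sigma>) = p + length ?is"
    using run_straight(2)[OF c st, of w] Assign.prems(4) by simp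
  moreover have "length ?is \<le> K" using Assign.prems(2) by simp
  moreover have "ccom p (x ::= e) = ?is" by simp
  ultimately show ?case using runs_straight[OF c st]
    by (intro exI[of _ "length ?is"] exI[of _ "fold (exec w) ?is \<sigma>"]) (auto simp: fun_upd_def simp del: ccom.simps)
next
  case (Put v A i j e a k)
  let ?is = "cexp 32 i @ cexp 33 j @ addr_code 32 a @ cexp 33 e @ [Store 32 33]"
  have st: "list_all straight ?is" by (simp add: straight_cexp straight_addr_code)
  have c: "code_at P (pc \<sigma>) ?is" using Put by simp
  let ?s1 = "fold (exec w) (cexp 32 i) \<sigma>"
  let ?s2 = "fold (exec w) (cexp 33 j) ?s1"
  let ?s3 = "fold (exec w) (addr_code 32 a) ?s2"
  let ?s4 = "fold (exec w) (cexp 33 e) ?s3"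
  have 1: "reg ?s1 32 = ev v A i" "keeps 32 \<sigma> ?s1"
    using cexp_correct[OF Put.prems(3) Put.hyps(1), of 32] by auto
  have r1: "rel ?s1 v A" using keeps_rel[OF 1(2)] Put.prems by simp
  have 2: "reg ?s2 33 = ev v A j" "keeps 33 ?s1 ?s2" using cexp_correct[OF r1 Put.hyps(2), of 33] by auto
  have r2: "rel ?s2 v A" using keeps_rel[OF 2(2)] r1 by simp
  have t: "reg ?s2 32 = ev v A i" using 2 1 by (simp add: keeps_def)
  have ij: "ev v A i < R" "ev v A j < R" using Put.hyps r1 ev_less by auto
  have R1: "reg ?s2 1 = R" using r2 by (simp add: rel_def)
  have 3: "reg ?s3 32 = addr R a (ev v A i) (ev v A j)" "keeps 32 ?s2 ?s3"
    using addr_code_correct[OF R1 t _ ij, of a] 2(1) by auto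
  have r3: "rel ?s3 v A" using keeps_rel[OF 3(2)] r2 by simp
  have 4: "reg ?s4 33 = ev v A e" "keeps 33 ?s3 ?s4" using cexp_correct[OF r3 Put.hyps(3), of 33] by auto
  have r4: "rel ?s4 v A" using keeps_rel[OF 4(2)] r3 by simp
  have t4: "reg ?s4 32 = addr R a (ev v A i) (ev v A j)" using 3 4 by (simp add: keeps_def)
  from rel_upd[OF r4 ij ev_less[OF r3 Put.hyps(3)], where p = "Suc (pc ?s4)" and a = a]
  have "rel (fold (exec w) ?is \<sigma>) v (upd A a (ev v A i) (ev v A j) (ev v A e))" using 4(1) t4 by simp
  moreover have "pc (fold (exec w) ?is \<sigma>) = p + length ?is"
    using run_straight(2)[OF c st, of w] Put.prems(4) by simp
  moreover have "length ?is \<le> K" using Put.prems(2) by simp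
  moreover have "ccom p (Put a i j e) = ?is" by simp
  ultimately show ?case using runs_straight[OF c st]
    by (intro exI[of _ "length ?is"] exI[of _ "fold (exec w) ?is \<sigma>"]) (auto simp: fun_upd_def simp del: ccom.simps)
next
  case (Seq c v A k v1 A1 k1 d v2 A2 k2)
  let ?n = "length (ccom p c)"
  have c: "code_at P p (ccom p c)" "code_at P (p + ?n) (ccom (p + ?n) d)"
    "?n \<le> K" "length (ccom (p + ?n) d) \<le> K"
    using Seq.prems by (auto simp: Let_def code_at_append)
  obtain N1 s1 where 1: "runs P N1 \<sigma> s1" "rel s1 v1 A1" "pc s1 = p + ?n" "N1 + K * k \<le> K * k1" "k \<le> k1"
    using Seq.IH(1)[OF c(1,3) Seq.prems(3,4)] by blast
  obtain N2 s2 where 2: "runs P N2 s1 s2" "rel s2 v2 A2" "pc s2 = p + ?n + length (ccom (p + ?n) d)"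
    "N2 + K * k1 \<le> K * k2" "k1 \<le> k2"
    using Seq.IH(2)[OF c(2,4) 1(2,3)] by blast
  show ?case
    using runs_trans[OF 1(1) 2(1)] 1 2
    by (intro exI[of _ "N1 + N2"] exI[of _ s2]) (simp add: Let_def)
next
  case (CondT v A b c k v1 A1 k1 d)
  let ?n = "length (ctest b)"
  let ?cd = "ccom (p + ?n + 1) d"
  let ?q = "p + ?n + 1 + length ?cd + 1"
  let ?cc = "ccom ?q c"
  have c: "code_at P (pc \<sigma>) (ctest b)" "code_at P (p + ?n) [cjump b ?q]" "code_at P ?q ?cc"
    "length ?cc \<le> K" "?n + 1 + length ?cc \<le> K"
    using CondT.prems by (auto simp: Let_def code_at_append code_at_Cons code_at_Nil add.assoc)
  let ?s1 = "fold (exec w) (ctest b) \<sigma>"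
  have 1: "runs P ?n \<sigma> ?s1" "pc ?s1 = p + ?n"
    using runs_straight[OF c(1) straight_ctest] run_straight(2)[OF c(1) straight_ctest] CondT.prems by auto
  have 2: "rel ?s1 v A" "exec w (cjump b ?q) ?s1 = ?s1\<lparr>pc := ?q\<rparr>"
    using ctest_correct[OF CondT.prems(3) CondT.hyps(1)] CondT.hyps by auto
  have 3: "runs P 1 ?s1 (?s1\<lparr>pc := ?q\<rparr>)"
    using runs_step c(2) 1(2) 2(2) by metis
  obtain N s where 4: "runs P N (?s1\<lparr>pc := ?q\<rparr>) s" "rel s v1 A1" "pc s = ?q + length ?cc"
     "N + K * Suc k \<le> K * k1" "Suc k \<le> k1"
    using CondT.IH[OF c(3,4), of "?s1\<lparr>pc := ?q\<rparr>"] 2(1) by (auto simp: rel_pc)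
  show ?case
    using runs_trans[OF runs_trans[OF 1(1) 3] 4(1)] 4 c(5)
    by (intro exI[of _ "?n + 1 + N"] exI[of _ s]) (simp add: Let_def)
next
  case (CondF v A b d k v1 A1 k1 c)
  let ?n = "length (ctest b)"
  let ?cd = "ccom (p + ?n + 1) d"
  let ?q = "p + ?n + 1 + length ?cd + 1"
  let ?cc = "ccom ?q c"
  have c: "code_at P (pc \<sigma>) (ctest b)" "code_at P (p + ?n) [cjump b ?q]" "code_at P (p + ?n + 1) ?cd"
    "code_at P (p + ?n + 1 + length ?cd) [Jump (?q + length ?cc)]"
    "length ?cd \<le> K" "?n + 1 + length ?cd + 1 \<le> K"
    using CondF.prems by (auto simp: Let_def code_at_append code_at_Cons code_at_Nil add.assoc)
  let ?s1 = "fold (exec w) (ctest b) \<sigma>"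
  have 1: "runs P ?n \<sigma> ?s1" "pc ?s1 = p + ?n"
    using runs_straight[OF c(1) straight_ctest] run_straight(2)[OF c(1) straight_ctest] CondF.prems by auto
  have 2: "rel ?s1 v A" "exec w (cjump b ?q) ?s1 = ?s1\<lparr>pc := p + ?n + 1\<rparr>"
    using ctest_correct[OF CondF.prems(3) CondF.hyps(1)] CondF.hyps 1 by auto
  have 3: "runs P 1 ?s1 (?s1\<lparr>pc := p + ?n + 1\<rparr>)"
    using runs_step c(2) 1(2) 2(2) by metis
  obtain N s where 4: "runs P N (?s1\<lparr>pc := p + ?n + 1\<rparr>) s" "rel s v1 A1" "pc s = p + ?n + 1 + length ?cd"
     "N + K * Suc k \<le> K * k1" "Suc k \<le> k1"
    using CondF.IH[OF c(3,5), of "?s1\<lparr>pc := p + ?n + 1\<rparr>"] 2(1) by (auto simp: rel_pc)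
  have 5: "runs P 1 s (s\<lparr>pc := ?q + length ?cc\<rparr>)"
    using runs_step[of P s "Jump (?q + length ?cc)" "[]"] c(4) 4(3) by simp
  show ?case
    using runs_trans[OF runs_trans[OF runs_trans[OF 1(1) 3] 4(1)] 5] 4 c(6)
    by (intro exI[of _ "?n + 1 + N + 1"] exI[of _ "s\<lparr>pc := ?q + length ?cc\<rparr>"]) (simp add: Let_def rel_pc)
next
  case (WhileT v A b c k v1 A1 k1 v2 A2 k2)
  let ?n = "length (ctest b)"
  let ?q = "p + ?n + 2"
  let ?cc = "ccom ?q c"
  have c: "code_at P (pc \<sigma>) (ctest b)" "code_at P (p + ?n) [cjump b ?q]" "code_at P ?q ?cc"
    "code_at P (?q + length ?cc) [Jump p]" "length ?cc \<le> K" "?n + 1 + length ?cc + 1 \<le> K"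
    using WhileT.prems by (auto simp: Let_def code_at_append code_at_Cons code_at_Nil add.assoc)
  let ?s1 = "fold (exec w) (ctest b) \<sigma>"
  have 1: "runs P ?n \<sigma> ?s1" "pc ?s1 = p + ?n"
    using runs_straight[OF c(1) straight_ctest] run_straight(2)[OF c(1) straight_ctest] WhileT.prems by auto
  have 2: "rel ?s1 v A" "exec w (cjump b ?q) ?s1 = ?s1\<lparr>pc := ?q\<rparr>"
    using ctest_correct[OF WhileT.prems(3) WhileT.hyps(1)] WhileT.hyps by auto
  have 3: "runs P 1 ?s1 (?s1\<lparr>pc := ?q\<rparr>)"
    using runs_step c(2) 1(2) 2(2) by metis
  obtain N s where 4: "runs P N (?s1\<lparr>pc := ?q\<rparr>) s" "rel s v1 A1" "pc s = ?q + length ?cc"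
     "N + K * Suc k \<le> K * k1" "Suc k \<le> k1"
    using WhileT.IH(1)[OF c(3,5), of "?s1\<lparr>pc := ?q\<rparr>"] 2(1) by (auto simp: rel_pc)
  have 5: "runs P 1 s (s\<lparr>pc := p\<rparr>)"
    using runs_step[of P s "Jump p" "[]"] c(4) 4(3) by simp
  obtain N' s' where 6: "runs P N' (s\<lparr>pc := p\<rparr>) s'" "rel s' v2 A2" "pc s' = p + length (ccom p (While b c))"
     "N' + K * k1 \<le> K * k2" "k1 \<le> k2"
    using WhileT.IH(2)[OF WhileT.prems(1,2), of "s\<lparr>pc := p\<rparr>"] 4(2) by (auto simp: rel_pc)
  show ?case
    using runs_trans[OF runs_trans[OF runs_trans[OF runs_trans[OF 1(1) 3] 4(1)] 5] 6(1)] 4 6 c(6)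
    by (intro exI[of _ "?n + 1 + N + 1 + N'"] exI[of _ s']) simp
next
  case (WhileF v A b c k)
  let ?n = "length (ctest b)"
  let ?q = "p + ?n + 2"
  let ?cc = "ccom ?q c"
  have c: "code_at P (pc \<sigma>) (ctest b)" "code_at P (p + ?n) [cjump b ?q]" 
    "code_at P (p + ?n + 1) [Jump (?q + length ?cc + 1)]" "?n + 2 \<le> K"
    using WhileF.prems by (auto simp: Let_def code_at_append code_at_Cons code_at_Nil add.assoc)
  let ?s1 = "fold (exec w) (ctest b) \<sigma>"
  have 1: "runs P ?n \<sigma> ?s1" "pc ?s1 = p + ?n"
    using runs_straight[OF c(1) straight_ctest] run_straight(2)[OF c(1) straight_ctest] WhileF.prems by auto
  have 2: "rel ?s1 v A" "exec w (cjump b ?q) ?s1 = ?s1\<lparr>pc := p + ?n + 1\<rparr>"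
    using ctest_correct[OF WhileF.prems(3) WhileF.hyps(1)] WhileF.hyps 1 by auto
  have 3: "runs P 1 ?s1 (?s1\<lparr>pc := p + ?n + 1\<rparr>)"
    using runs_step c(2) 1(2) 2(2) by metis
  let ?s2 = "?s1\<lparr>pc := p + ?n + 1\<rparr>"
  have 5: "runs P 1 ?s2 (?s2\<lparr>pc := ?q + length ?cc + 1\<rparr>)"
    using runs_step[of P ?s2 "Jump (?q + length ?cc + 1)" "[]"] c(3) by simp
  show ?case
    using runs_trans[OF runs_trans[OF 1(1) 3] 5] 2(1) c(4)
    by (intro exI[of _ "?n + 1 + 1"] exI[of _ "?s2\<lparr>pc := ?q + length ?cc + 1\<rparr>"]) (simp add: Let_def rel_pc)
qed

end

section \<open>Distances as exponents of relational powers\<close>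

section \<open>Distances and walks\<close>

definition adj :: "'a set set \<Rightarrow> ('a \<times> 'a) set" where
  "adj E = {(a, b). {a, b} \<in> E}"

text \<open>Relational powers concatenate by \<open>relpow_trans\<close> and can be cut at any index
  by shifting the witnessing function, so vertex lists matter only at the interface.\<close>

lemma is_walk_iff_relpow: "(\<exists>p. is_walk E u v p \<and> length p - 1 = k) \<longleftrightarrow> (u, v) \<in> adj E ^^ k"
proof
  assume "\<exists>p. is_walk E u v p \<and> length p - 1 = k"
  then obtain p where p: "is_walk E u v p" "length p - 1 = k" by auto
  then have l: "length p = Suc k" by (cases p) (auto simp: is_walk_def)
  have "p ! 0 = u" "p ! k = v"
    using p l unfolding is_walk_def by (auto simp: hd_conv_nth last_conv_nth)
  moreover have "\<forall>i<k. (p ! i, p ! Suc i) \<in> adj E"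
    using p l by (auto simp: is_walk_def adj_def)
  ultimately show "(u, v) \<in> adj E ^^ k"
    unfolding relpow_fun_conv by blast
next
  assume "(u, v) \<in> adj E ^^ k"
  then obtain f where f: "f 0 = u" "f k = v" "\<forall>i<k. (f i, f (Suc i)) \<in> adj E"
    unfolding relpow_fun_conv by blast
  let ?p = "map f [0..<Suc k]"
  have "is_walk E u v ?p"
    using f by (auto simp: is_walk_def adj_def hd_map last_map nth_append simp del: upt_Suc)
  then show "\<exists>p. is_walk E u v p \<and> length p - 1 = k"
    by (intro exI[of _ ?p]) simp
qed

lemma gdist_eq_Inf: "gdist E u v = Inf {enat k | k. (u, v) \<in> adj E ^^ k}"
  unfolding gdist_def is_walk_iff_relpow[symmetric] by (intro arg_cong[where f = Inf]) blast

lemma gdist_le: "(u, v) \<in> adj E ^^ k \<Longrightarrow> gdist E u v \<le> enat k"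
  unfolding gdist_eq_Inf by (intro Inf_lower) blast

lemma gdist_walk:
  assumes "gdist E u v = enat k"
  shows "(u, v) \<in> adj E ^^ k"
proof -
  let ?S = "{enat k | k. (u, v) \<in> adj E ^^ k}"
  have "?S \<noteq> {}"
  proof
    assume "?S = {}"
    then have "gdist E u v = \<infinity>" unfolding gdist_eq_Inf by (simp add: Inf_enat_def)
    then show False using assms by simp
  qed
  then have "Inf ?S \<in> ?S" by (metis (no_types, lifting) Inf_enat_def LeastI equals0I)
  then show ?thesis using assms unfolding gdist_eq_Inf by auto
qed

lemma gdist_min: "gdist E u v = enat k \<Longrightarrow> (u, v) \<in> adj E ^^ j \<Longrightarrow> k \<le> j"
  using gdist_le[of u v j E] by simp

lemma gdist_eqI: "(u, v) \<in> adj E ^^ k \<Longrightarrow> (\<And>j. (u, v) \<in> adj E ^^ j \<Longrightarrow> k \<le> j) \<Longrightarrow> gdist E u v = enat k"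
  using gdist_le[of u v k E] gdist_walk[of E u v] by (cases "gdist E u v") (force intro: antisym)+

lemma gdist_infI: "(\<And>j. (u, v) \<notin> adj E ^^ j) \<Longrightarrow> gdist E u v = \<infinity>"
  using gdist_walk[of E u v] by (cases "gdist E u v") auto

lemma adj_sym: "(a, b) \<in> adj E \<longleftrightarrow> (b, a) \<in> adj E"
  by (simp add: adj_def insert_commute)

lemma adj_pow_sym: "(a, b) \<in> adj E ^^ k \<Longrightarrow> (b, a) \<in> adj E ^^ k"
proof (induction k arbitrary: b)
  case (Suc k)
  then obtain c where "(a, c) \<in> adj E ^^ k" "(c, b) \<in> adj E" by auto
  then show ?case using Suc.IH[of c] by (metis adj_sym relpow_Suc_I2)
qed simp

lemma adj_pow_mono: "(a, b) \<in> adj E ^^ k \<Longrightarrow> E \<subseteq> E' \<Longrightarrow> (a, b) \<in> adj E' ^^ k"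
  unfolding relpow_fun_conv adj_def by blast

lemma ugraph_less: "ugraph {..<n} E \<Longrightarrow> {a, b} \<in> E \<Longrightarrow> a < n \<and> b < n \<and> a \<noteq> b"
  unfolding ugraph_def by (metis doubleton_eq_iff lessThan_iff)

lemma walk_less:
  assumes "ugraph {..<n} E" "u < n" "(u, v) \<in> adj E ^^ k"
  shows "v < n"
  using assms(2,3) by (cases k) (auto simp: adj_def dest: ugraph_less[OF assms(1)])

text \<open>A shortest walk repeats no vertex, as the part between two visits could be cut out; its
  \<open>k + 1\<close> vertices are thus distinct members of \<open>{..<n}\<close>. Applied to
  \<open>E\<close> minus one edge, this makes \<open>n\<close> a safe code for infinity.\<close>

lemma gdist_less:
  assumes ug: "ugraph {..<n} E" and "E' \<subseteq> E" and u: "u < n" and d: "gdist E' u v = enat k"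
  shows "k < n"
proof -
  have ug': "ugraph {..<n} E'" using assms unfolding ugraph_def by blast
  obtain f where f: "f 0 = u" "f k = v" "\<forall>i<k. (f i, f (Suc i)) \<in> adj E'"
    using gdist_walk[OF d] unfolding relpow_fun_conv by blast
  have pre: "(u, f i) \<in> adj E' ^^ i" if "i \<le> k" for i
    unfolding relpow_fun_conv using f that by (intro exI[of _ f]) auto
  have suf: "(f i, v) \<in> adj E' ^^ (k - i)" if "i \<le> k" for i
    unfolding relpow_fun_conv using f that by (intro exI[of _ "\<lambda>j. f (i + j)"]) auto
  have "inj_on f {..k}"
  proof (rule linorder_inj_onI')
    fix i j assume ij: "i \<in> {..k}" "j \<in> {..k}" "i < j"
    show "f i \<noteq> f j"
    proof
      assume "f i = f j"
      then have "(u, v) \<in> adj E' ^^ (i + (k - j))"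
        using relpow_trans[OF pre[of i], of v "k - j"] suf[of j] ij by simp
      then have "k \<le> i + (k - j)" using gdist_min[OF d] by blast
      then show False using ij by simp
    qed
  qed
  moreover have "f ` {..k} \<subseteq> {..<n}" using walk_less[OF ug' u pre] by auto
  ultimately have "card {..k} \<le> card {..<n}" by (intro card_inj_on_le) auto
  then show ?thesis by simp
qed

section \<open>Subtrees of a search tree and the edges entering them\<close>

section \<open>Breadth-first search with boundary neighbours\<close>

text \<open>The arrays of a search from \<open>s\<close> are stored with 0 for "undefined": \<open>D\<close> is the distance plus 1, \<open>P\<close> the
  parent plus 1 (the root being its own parent), and \<open>q\<close> the queue of length \<open>cnt\<close>.  For a vertex \<open>y\<close>
  and \<open>c < 3\<close>, \<open>F (3 * y + c)\<close> and \<open>L (3 * y + c)\<close> are 1 plus the first and last neighbour \<open>x\<close> of \<open>y\<close> in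
  queue order with \<open>D x + 1 = D y + c\<close>, apart from the parent of \<open>y\<close>.\<close>

locale bfs_tree =
  fixes n :: nat and E :: "nat set set" and s cnt :: nat and q D P :: "nat \<Rightarrow> nat"
  assumes ug: "ugraph {..<n} E"
    and cnt: "0 < cnt" and q0: "q 0 = s" and inj: "inj_on q {..<cnt}" and qn: "\<And>i. i < cnt \<Longrightarrow> q i < n"
    and Ds: "D s = 1" and Dpos: "\<And>v. D v \<noteq> 0 \<longleftrightarrow> v \<in> q ` {..<cnt}" and Ps: "P s = s + 1"
    and tree: "\<And>i. 0 < i \<Longrightarrow> i < cnt \<Longrightarrow> \<exists>j<i. P (q i) = q j + 1 \<and> {q j, q i} \<in> E \<and> D (q i) = D (q j) + 1"
    and mono: "\<And>i i'. i \<le> i' \<Longrightarrow> i' < cnt \<Longrightarrow> D (q i) \<le> D (q i')"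
    and pmono: "\<And>i i' j j'. 0 < i \<Longrightarrow> i \<le> i' \<Longrightarrow> i' < cnt \<Longrightarrow> j < cnt \<Longrightarrow> j' < cnt \<Longrightarrow>
      P (q i) = q j + 1 \<Longrightarrow> P (q i') = q j' + 1 \<Longrightarrow> j \<le> j'"

text \<open>\<open>slotc\<close> and \<open>slots\<close> are completeness and soundness of the
  recorded neighbours. The offset \<open>D (q i) + 1 - D y\<close> does not truncate by
  \<open>clos\<close>, and it is at most 2 because labels of adjacent reached vertices differ by at
  most one.\<close>

locale bfs = bfs_tree +
  fixes F L :: "nat \<Rightarrow> nat"
  assumes clos: "\<And>i y. i < cnt \<Longrightarrow> {q i, y} \<in> E \<Longrightarrow> D y \<noteq> 0 \<and> D y \<le> D (q i) + 1"
    and slotc: "\<And>i y. i < cnt \<Longrightarrow> {q i, y} \<in> E \<Longrightarrow> P y \<noteq> q i + 1 \<Longrightarrow>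
      \<exists>i1 i2. i1 \<le> i \<and> i \<le> i2 \<and> i2 < cnt \<and> F (3 * y + (D (q i) + 1 - D y)) = q i1 + 1 \<and>
        L (3 * y + (D (q i) + 1 - D y)) = q i2 + 1"
    and slots: "\<And>y c x. D y \<noteq> 0 \<Longrightarrow> c < 3 \<Longrightarrow> F (3 * y + c) = x + 1 \<or> L (3 * y + c) = x + 1 \<Longrightarrow>
      D x \<noteq> 0 \<and> {x, y} \<in> E \<and> P y \<noteq> x + 1 \<and> D x + 1 = D y + c"
begin

definition pa :: "nat \<Rightarrow> nat" where "pa v = P v - 1"

text \<open>Membership of \<open>x\<close> in the subtree of \<open>v\<close>. The labels determine
  how many parent steps lead from \<open>x\<close> to the depth of \<open>v\<close>, so a power of
  \<open>pa\<close> replaces the transitive closure.\<close>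

definition sub :: "nat \<Rightarrow> nat \<Rightarrow> bool" where
  "sub v x \<longleftrightarrow> D x \<noteq> 0 \<and> D v \<le> D x \<and> (pa ^^ (D x - D v)) x = v"

lemma pa_tree: "0 < i \<Longrightarrow> i < cnt \<Longrightarrow> \<exists>j<i. pa (q i) = q j \<and> {q j, q i} \<in> E \<and> D (q i) = D (q j) + 1"
  using tree[of i] unfolding pa_def by fastforce

lemma Dq: "i < cnt \<Longrightarrow> 0 < D (q i)"
  using Dpos[of "q i"] by auto

lemma D1: "D x = 1 \<longleftrightarrow> x = s"
proof
  assume 1: "D x = 1"
  then obtain i where i: "x = q i" "i < cnt" using Dpos[of x] by auto
  show "x = s"
  proof (cases "i = 0")
    case False
    then obtain j where "j < i" "D (q i) = D (q j) + 1" using tree[of i] i by auto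
    then have False using Dq[of j] i 1 by simp
    then show ?thesis ..
  qed (use i q0 in simp)
qed (simp add: Ds)

lemma pa_step:
  assumes "D x \<noteq> 0" "x \<noteq> s"
  shows "D (pa x) \<noteq> 0 \<and> D x = D (pa x) + 1 \<and> {pa x, x} \<in> E \<and> P x = pa x + 1"
proof -
  obtain i where i: "x = q i" "i < cnt" using assms Dpos[of x] by auto
  have "0 < i" using assms i q0 by (cases i) auto
  then obtain j where "j < i" "P (q i) = q j + 1" "{q j, q i} \<in> E" "D (q i) = D (q j) + 1"
    using tree[of i] i by auto
  then show ?thesis using Dq[of j] i by (auto simp: pa_def)
qed

lemma tree_induct [consumes 1, case_names root step]:
  assumes "D x \<noteq> 0" "Q s"
    and "\<And>x. D x \<noteq> 0 \<Longrightarrow> x \<noteq> s \<Longrightarrow> Q (pa x) \<Longrightarrow> Q x"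
  shows "Q x"
  using assms(1)
proof (induction "D x" arbitrary: x)
  case (Suc k)
  show ?case
  proof (cases "x = s")
    case False
    then show ?thesis using pa_step[of x] Suc assms(3)[of x] by fastforce
  qed (use assms(2) in simp)
qed simp

lemma pa_pow:
  assumes "D x \<noteq> 0" "k < D x"
  shows "D ((pa ^^ k) x) = D x - k \<and> ((pa ^^ k) x, x) \<in> adj E ^^ k"
  using assms(2)
proof (induction k)
  case (Suc k)
  let ?y = "(pa ^^ k) x"
  have IH: "D ?y = D x - k" "(?y, x) \<in> adj E ^^ k" using Suc by auto
  then have "D ?y > 1" using Suc.prems by simp
  then have "?y \<noteq> s" "D ?y \<noteq> 0" using Ds by auto
  from pa_step[OF this(2,1)] have "D (pa ?y) = D x - Suc k" "(pa ?y, ?y) \<in> adj E"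
    using IH(1) by (auto simp: adj_def)
  then show ?case using IH(2) relpow_Suc_I2 by force
qed simp

lemma sub_walk: "sub v x \<Longrightarrow> D v \<noteq> 0 \<Longrightarrow> (v, x) \<in> adj E ^^ (D x - D v)"
  using pa_pow[of x "D x - D v"] unfolding sub_def by auto

lemma root_walk: "D x \<noteq> 0 \<Longrightarrow> (s, x) \<in> adj E ^^ (D x - 1)"
  using pa_pow[of x "D x - 1"] D1[of "(pa ^^ (D x - 1)) x"] by auto

text \<open>By \<open>clos\<close> reachability passes along every edge and the label grows by at
  most one. This is the lower bound on distances; the tree path gives the upper one.\<close>

lemma walk_D:
  assumes "(s, x) \<in> adj E ^^ k"
  shows "D x \<noteq> 0 \<and> D x \<le> k + 1"
  using assms
proof (induction k arbitrary: x)
  case 0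
  then show ?case using Ds by simp
next
  case (Suc k)
  then obtain y where y: "(s, y) \<in> adj E ^^ k" "{y, x} \<in> E" by (auto simp: adj_def)
  from Suc.IH[OF y(1)] obtain i where i: "y = q i" "i < cnt" "D y \<le> k + 1" using Dpos[of y] by auto
  then show ?case using clos[of i x] y by auto
qed

lemma gdist_D: "gdist E s x = (if D x = 0 then \<infinity> else enat (D x - 1))"
proof (cases "D x = 0")
  case True
  then show ?thesis using walk_D[of x] gdist_infI[of s x E] by auto
next
  case False
  moreover have "gdist E s x = enat (D x - 1)"
  proof (rule gdist_eqI)
    show "(s, x) \<in> adj E ^^ (D x - 1)" using root_walk False .
    show "D x - 1 \<le> j" if "(s, x) \<in> adj E ^^ j" for j using walk_D[OF that] by linarith
  qed
  ultimately show ?thesis by simp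
qed

lemma sub_refl: "D v \<noteq> 0 \<Longrightarrow> sub v v"
  by (simp add: sub_def)

lemma sub_pa: "D x \<noteq> 0 \<Longrightarrow> x \<noteq> s \<Longrightarrow> x \<noteq> v \<Longrightarrow> sub v x \<longleftrightarrow> sub v (pa x)"
proof -
  assume x: "D x \<noteq> 0" "x \<noteq> s" "x \<noteq> v"
  note p = pa_step[OF x(1,2)]
  show ?thesis
  proof (cases "D v \<le> D (pa x)")
    case True
    then have "D x - D v = Suc (D (pa x) - D v)" using p by simp
    then show ?thesis using True p by (simp add: sub_def funpow_swap1)
  next
    case False
    then show ?thesis using p x by (auto simp: sub_def)
  qed
qed

lemma sub_root: "sub v s \<Longrightarrow> D v \<noteq> 0 \<Longrightarrow> v = s"
  using Ds D1[of v] unfolding sub_def by (cases "D v") auto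

text \<open>By \<open>pmono\<close> the parent map preserves queue order, hence so does each of its
  iterates within a layer. The condition on \<open>k\<close> stops the climb at the root, to which
  \<open>pmono\<close> does not apply.\<close>

lemma layer_mono:
  assumes "i1 \<le> i2" "i2 < cnt" "D (q i1) = D (q i2)" "k < D (q i1)"
  shows "\<exists>j1 j2. j1 \<le> j2 \<and> j2 < cnt \<and> (pa ^^ k) (q i1) = q j1 \<and> (pa ^^ k) (q i2) = q j2"
  using assms(4)
proof (induction k)
  case 0
  then show ?case using assms by auto
next
  case (Suc k)
  then obtain j1 j2 where j: "j1 \<le> j2" "j2 < cnt" "(pa ^^ k) (q i1) = q j1" "(pa ^^ k) (q i2) = q j2"
    by auto
  have "D (q j1) = D (q i1) - k" "D (q j2) = D (q i2) - k"
    using pa_pow[of "q i1" k] pa_pow[of "q i2" k] Suc.prems assms j by auto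
  then have "D (q j1) > 1" "D (q j2) > 1" using Suc.prems assms by simp_all
  then have ns: "0 < j1" "0 < j2" using q0 Ds by (cases j1; cases j2; auto)+
  obtain m1 where m1: "m1 < j1" "P (q j1) = q m1 + 1" using tree[of j1] ns j by auto
  obtain m2 where m2: "m2 < j2" "P (q j2) = q m2 + 1" using tree[of j2] ns j by auto
  have "m1 \<le> m2" using pmono[OF ns(1) j(1,2) _ _ m1(2) m2(2)] m1 m2 j by simp
  moreover have "m2 < cnt" using m2 j by simp
  moreover have "pa (q j1) = q m1" "pa (q j2) = q m2" using m1 m2 by (auto simp: pa_def)
  ultimately show ?case using j by auto
qed

text \<open>The ancestors of the three vertices at the depth of \<open>v\<close> stand in queue
  order. The outer two are both \<open>v\<close>, and positions in the queue are unique, so the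
  middle one is \<open>v\<close> as well.\<close>

lemma sub_contiguous:
  assumes "i1 \<le> i" "i \<le> i2" "i2 < cnt" "D (q i1) = D (q i)" "D (q i2) = D (q i)"
    "sub v (q i1)" "sub v (q i2)" "D v \<noteq> 0"
  shows "sub v (q i)"
proof -
  let ?k = "D (q i) - D v"
  have k: "?k < D (q i)" using assms Dq[of i] by simp
  obtain j1 j where j: "j1 \<le> j" "j < cnt" "(pa ^^ ?k) (q i1) = q j1" "(pa ^^ ?k) (q i) = q j"
    using layer_mono[of i1 i ?k] assms k by auto
  obtain j' j2 where j2: "j' \<le> j2" "j2 < cnt" "(pa ^^ ?k) (q i) = q j'" "(pa ^^ ?k) (q i2) = q j2"
    using layer_mono[of i i2 ?k] assms k by auto
  have "v = q j1" "v = q j2" using assms j j2 unfolding sub_def by auto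
  moreover have "j' = j" using j j2 inj by (auto simp: inj_on_def)
  moreover have "j1 = j2" using calculation j j2 inj by (auto simp: inj_on_def)
  ultimately have "j = j1" using j j2 by simp
  then show ?thesis using j assms \<open>v = q j1\<close> unfolding sub_def by simp
qed

text \<open>Every edge on the tree path to \<open>x\<close> has its lower end outside the subtree of
  \<open>v\<close>, whereas the lower end of the deleted edge is \<open>v\<close>.\<close>

lemma avoiding_root_walk:
  assumes "D v \<noteq> 0" "v \<noteq> s" "D x \<noteq> 0" "\<not> sub v x"
  shows "(s, x) \<in> adj (E - {{pa v, v}}) ^^ (D x - 1)"
  using assms(3,4)
proof (induction rule: tree_induct)
  case root
  then show ?case using Ds by simp
next
  case (step x)
  have xv: "x \<noteq> v" using sub_refl assms step.prems by auto
  then have ns: "\<not> sub v (pa x)" using sub_pa step by blast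
  then have "pa x \<noteq> v" using sub_refl assms by auto
  then have e: "{pa x, x} \<noteq> {pa v, v}" using xv by (auto simp: doubleton_eq_iff)
  note p = pa_step[OF step.hyps]
  have "(pa x, x) \<in> adj (E - {{pa v, v}})" using e p by (simp add: adj_def)
  moreover have "D x - 1 = Suc (D (pa x) - 1)" using p by simp
  ultimately show ?case using step.IH[OF ns] by auto
qed

text \<open>Since \<open>v\<close> lies on shortest paths both from \<open>s\<close> to \<open>y\<close> and from \<open>s\<close> to \<open>t\<close>, a shortest path
  between \<open>y\<close> and \<open>t\<close> gains nothing from the tree edge above \<open>v\<close>.\<close>

lemma avoiding_subtree_walk:
  assumes v: "D v \<noteq> 0" "v \<noteq> s" and y: "sub v y" and t: "sub v t" and k: "gdist E y t = enat k"
  shows "(y, t) \<in> adj (E - {{pa v, v}}) ^^ k"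
proof -
  note min = gdist_min[OF k]
  obtain f where f: "f 0 = y" "f k = t" "\<forall>i<k. (f i, f (Suc i)) \<in> adj E"
    using gdist_walk[OF k] unfolding relpow_fun_conv by blast
  have pre: "(y, f i) \<in> adj E ^^ i" if "i \<le> k" for i
    unfolding relpow_fun_conv using f that by (intro exI[of _ f]) auto
  have suf: "(f i, t) \<in> adj E ^^ (k - i)" if "i \<le> k" for i
    unfolding relpow_fun_conv using f that by (intro exI[of _ "\<lambda>j. f (i + j)"]) auto
  note p = pa_step[OF v]
  have vy: "(y, v) \<in> adj E ^^ (D y - D v)" using adj_pow_sym[OF sub_walk[OF y v(1)]] .
  have vt: "(v, t) \<in> adj E ^^ (D t - D v)" using sub_walk[OF t v(1)] .
  have "{f i, f (Suc i)} \<noteq> {pa v, v}" if i: "i < k" for i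
  proof
    assume "{f i, f (Suc i)} = {pa v, v}"
    then consider "f i = pa v" "f (Suc i) = v" | "f i = v" "f (Suc i) = pa v" by (auto simp: doubleton_eq_iff)
    then show False
    proof cases
      case 1
      \<comment> \<open>The tree leads from \<open>y\<close> up to \<open>v\<close> in
        \<open>D y - D v\<close> steps, while arriving at \<open>v\<close> through
        \<open>pa v\<close> takes at least two more, since \<open>pa v\<close> is one layer closer
        to \<open>s\<close>.\<close>
      have "k \<le> D y - D v + (k - Suc i)"
        using min[OF relpow_trans[OF vy, of t "k - Suc i"]] suf[of "Suc i"] 1 i by simp
      moreover have "(s, y) \<in> adj E ^^ (D (pa v) - 1 + i)"
        using relpow_trans[OF root_walk[of "pa v"], of y i] adj_pow_sym[OF pre[of i]] p 1 i by simp
      then have "D y \<le> D (pa v) - 1 + i + 1" using walk_D by blast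
      ultimately show False using p i by linarith
    next
      case 2
      \<comment> \<open>The mirror image at the other end: from \<open>v\<close> the tree reaches
        \<open>t\<close> in \<open>D t - D v\<close> steps, and a detour through \<open>pa v\<close>
        costs at least two more.\<close>
      have "k \<le> i + (D t - D v)"
        using min[OF relpow_trans[OF pre[of i], of t "D t - D v"]] vt 2 i by simp
      moreover have "(s, t) \<in> adj E ^^ (D (pa v) - 1 + (k - Suc i))"
        using relpow_trans[OF root_walk[of "pa v"], of t "k - Suc i"] suf[of "Suc i"] p 2 i by simp
      then have "D t \<le> D (pa v) - 1 + (k - Suc i) + 1" using walk_D by blast
      moreover have "D v \<le> D t" using t unfolding sub_def by simp
      ultimately show False using p i by linarith
    qed
  qed
  then have "\<forall>i<k. (f i, f (Suc i)) \<in> adj (E - {{pa v, v}})" using f by (auto simp: adj_def)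
  then show ?thesis using f unfolding relpow_fun_conv by blast
qed

definition slot :: "nat \<Rightarrow> nat \<Rightarrow> bool" where
  "slot y x \<longleftrightarrow> D y \<noteq> 0 \<and> (\<exists>c<3. F (3 * y + c) = x + 1 \<or> L (3 * y + c) = x + 1)"

text \<open>Tree path to \<open>x\<close>, crossing edge, shortest path from \<open>y\<close> to
  \<open>t\<close>. As \<open>D x\<close> is the distance from \<open>s\<close> plus one,
  \<open>D x + d\<close> already counts the crossing edge, which is not the deleted one because
  \<open>x\<close> is not the parent of \<open>y\<close>.\<close>

lemma replacement_le:
  assumes v: "D v \<noteq> 0" "v \<noteq> s" and t: "sub v t" and xy: "slot y x" "\<not> sub v x" "sub v y"
    and d: "gdist E t y = enat d"
  shows "gdist (E - {{pa v, v}}) s t \<le> enat (D x + d)"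
proof -
  have s: "D x \<noteq> 0" "{x, y} \<in> E" "P y \<noteq> x + 1" using xy(1) slots unfolding slot_def by blast+
  have "x \<noteq> v" using xy sub_refl v by auto
  moreover have "\<not> (x = pa v \<and> y = v)" using s(3) pa_step[OF v] by auto
  ultimately have "(x, y) \<in> adj (E - {{pa v, v}})" using s(2) by (auto simp: adj_def doubleton_eq_iff)
  with avoiding_root_walk[OF v s(1) xy(2)] have 1: "(s, y) \<in> adj (E - {{pa v, v}}) ^^ Suc (D x - 1)" by auto
  have "gdist E y t = enat d"
    using d gdist_walk[OF d] gdist_min[OF d] by (intro gdist_eqI) (auto dest: adj_pow_sym)
  from relpow_trans[OF 1 avoiding_subtree_walk[OF v xy(3) t this]] have "(s, t) \<in> adj (E - {{pa v, v}}) ^^ (D x + d)"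
    using s(1) by simp
  then show ?thesis by (rule gdist_le)
qed

text \<open>A replacement walk starts outside the subtree of \<open>v\<close> and ends inside, so
  some edge enters it. The lengths before and after this edge are bounded below by distances in
  \<open>E\<close>. Its outer end may be unrecorded, but by contiguity the first or the last
  recorded neighbour with the same label is also outside and gives the same value.\<close>

lemma replacement_ge:
  assumes v: "D v \<noteq> 0" "v \<noteq> s" and t: "sub v t" and k: "gdist (E - {{pa v, v}}) s t = enat k"
  shows "\<exists>x y d. slot y x \<and> \<not> sub v x \<and> sub v y \<and> gdist E t y = enat d \<and> D x + d \<le> k"
proof -
  obtain f where f: "f 0 = s" "f k = t" "\<forall>i<k. (f i, f (Suc i)) \<in> adj (E - {{pa v, v}})"
    using gdist_walk[OF k] unfolding relpow_fun_conv by blast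
  have fE: "(f i, f (Suc i)) \<in> adj E" if "i < k" for i using f that by (auto simp: adj_def)
  have pre: "(s, f i) \<in> adj E ^^ i" if "i \<le> k" for i
    unfolding relpow_fun_conv using f fE that by (intro exI[of _ f]) auto
  have suf: "(f i, t) \<in> adj E ^^ (k - i)" if "i \<le> k" for i
    unfolding relpow_fun_conv using f fE that by (intro exI[of _ "\<lambda>j. f (i + j)"]) auto
  have "\<not> sub v (f 0)" using sub_root v f by auto
  moreover have "sub v (f k)" using t f by simp
  ultimately obtain i where i: "i < k" "\<not> sub v (f i)" "sub v (f (Suc i))"
    using ex_least_nat_less[of "\<lambda>i. sub v (f i)" k] by blast
  let ?x = "f i" and ?y = "f (Suc i)"
  have e: "{?x, ?y} \<in> E" "{?x, ?y} \<noteq> {pa v, v}" using f i by (auto simp: adj_def)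
  have Dx: "D ?x \<noteq> 0" "D ?x \<le> i + 1" using walk_D[OF pre[of i]] i by auto
  have Dy: "D ?y \<noteq> 0" using walk_D[OF pre[of "Suc i"]] i by auto
  have "(t, ?y) \<in> adj E ^^ (k - Suc i)" using adj_pow_sym suf[of "Suc i"] i by simp
  from gdist_le[OF this] obtain d where d: "gdist E t ?y = enat d" "d \<le> k - Suc i"
    by (cases "gdist E t ?y") auto
  \<comment> \<open>A parent outside the subtree with its child inside is possible only at
    \<open>v\<close>, and that edge is deleted.\<close>
  have P: "P ?y \<noteq> ?x + 1"
  proof
    assume "P ?y = ?x + 1"
    then have x: "?x = pa ?y" by (simp add: pa_def)
    show False
    proof (cases "?y = v")
      case True
      then show False using x e by simp
    next
      case False
      moreover have "?y \<noteq> s"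
      proof
        assume "?y = s"
        then show False using sub_root i v by auto
      qed
      ultimately show False using sub_pa[OF Dy, of v] i x by simp
    qed
  qed
  obtain m where m: "?x = q m" "m < cnt" using Dx Dpos[of ?x] by auto
  let ?c = "D ?x + 1 - D ?y"
  obtain i1 i2 where s: "i1 \<le> m" "m \<le> i2" "i2 < cnt" "F (3 * ?y + ?c) = q i1 + 1" "L (3 * ?y + ?c) = q i2 + 1"
    using slotc[of m ?y] m P e by auto
  have xy: "D ?y \<le> D ?x + 1" using clos[of m ?y] m e by auto
  have yx: "D ?x \<le> D ?y + 1"
  proof -
    obtain m' where "?y = q m'" "m' < cnt" using Dy Dpos[of ?y] by auto
    then show ?thesis using clos[of m' ?x] e by (auto simp: insert_commute)
  qed
  have c: "?c < 3" using xy yx by simp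
  \<comment> \<open>The offset \<open>?c\<close> together with \<open>D ?y\<close> determines the
    label, so the two recorded neighbours lie in the layer of \<open>?x\<close>.\<close>
  have D12: "D (q i1) = D ?x" "D (q i2) = D ?x" using slots[OF Dy c, of "q i1"] slots[OF Dy c, of "q i2"] s xy by auto
  have "slot ?y (q i1)" "slot ?y (q i2)" unfolding slot_def using Dy c s by blast+
  moreover have "\<not> sub v (q i1) \<or> \<not> sub v (q i2)"
    using sub_contiguous[of i1 m i2 v] s D12 i v m by auto
  ultimately obtain x' where "slot ?y x'" "\<not> sub v x'" "D x' = D ?x" using D12 by auto
  moreover have "D ?x + d \<le> k" using Dx d i by simp
  ultimately show ?thesis using d i by (intro exI[of _ x'] exI[of _ ?y] exI[of _ d]) auto
qed

end

section \<open>Common ancestors with the target, and intervals of path edges\<close>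

section \<open>Positions along a shortest path\<close>

text \<open>The path is indexed by the values of \<open>D\<close>, so that it runs from \<open>p 1 = s\<close> to \<open>p len = t\<close>.\<close>

locale bfs_path = bfs n E s cnt q D P F L for n E s cnt q D P F L +
  fixes t len :: nat and p J :: "nat \<Rightarrow> nat"
  assumes len: "len = D t" "0 < len" and pt: "p len = t"
    and pp: "\<And>i. 1 \<le> i \<Longrightarrow> i < len \<Longrightarrow> p i = pa (p (Suc i))"
    and J: "\<And>x. D x \<noteq> 0 \<Longrightarrow> J x = (if D x \<le> len \<and> p (D x) = x then D x else J (pa x))"
begin

lemma path_pow: "k < len \<Longrightarrow> p (len - k) = (pa ^^ k) t"
proof (induction k)
  case (Suc k)
  then have "p (len - Suc k) = pa (p (Suc (len - Suc k)))" by (intro pp) auto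
  then show ?case using Suc by (simp add: Suc_diff_Suc)
qed (simp add: pt)

lemma path_D: "1 \<le> i \<Longrightarrow> i \<le> len \<Longrightarrow> D (p i) = i"
  using path_pow[of "len - i"] pa_pow[of t "len - i"] len by simp

lemma path_sub: "1 \<le> i \<Longrightarrow> i \<le> len \<Longrightarrow> sub (p i) t"
  using path_pow[of "len - i"] path_D[of i] len unfolding sub_def by simp

lemma path_s: "p 1 = s"
  using path_D[of 1] len D1 by simp

lemma path_ne: "1 \<le> i \<Longrightarrow> i < len \<Longrightarrow> D (p (Suc i)) \<noteq> 0 \<and> p (Suc i) \<noteq> s \<and> pa (p (Suc i)) = p i"
  using path_D[of "Suc i"] Ds pp[of i] by force

text \<open>\<open>J x\<close> is the depth of the lowest common ancestor of \<open>x\<close> and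
  \<open>t\<close>: a path vertex has its own depth, any other vertex inherits from its parent. The
  path vertices above \<open>x\<close> are those up to this depth.\<close>

lemma sub_J: "D x \<noteq> 0 \<Longrightarrow> 1 \<le> i \<Longrightarrow> i \<le> len \<Longrightarrow> sub (p i) x \<longleftrightarrow> i \<le> J x"
proof (induction arbitrary: i rule: tree_induct)
  case root
  have "J s = 1" using J[of s] Ds path_s len by simp
  moreover have "sub (p i) s \<longleftrightarrow> i = 1"
  proof
    assume "sub (p i) s"
    then have "p i = s" using sub_root[of "p i"] path_D[of i] root by simp
    then show "i = 1" using path_D[of i] root Ds by simp
  next
    assume "i = 1"
    then show "sub (p i) s" using sub_refl[of s] Ds path_s by simp
  qed
  ultimately show ?case using root(1) by simp
next
  case (step x)
  note ps = pa_step[OF step.hyps]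
  show ?case
  proof (cases "D x \<le> len \<and> p (D x) = x")
    case True
    have "sub (p i) x" if "i \<le> D x"
    proof -
      have "(pa ^^ (D x - i)) x = (pa ^^ (D x - i)) ((pa ^^ (len - D x)) t)"
      proof -
        have "p (len - (len - D x)) = x" using True by simp
        moreover have "len - D x < len" using step.hyps(1) len by simp
        ultimately show ?thesis using path_pow[of "len - D x"] by (simp only:)
      qed
      also have "\<dots> = (pa ^^ (D x - i + (len - D x))) t"
        by (simp add: funpow_add)
      also have "D x - i + (len - D x) = len - i" using True that by simp
      also have "(pa ^^ (len - i)) t = p i" using path_pow[of "len - i"] step.prems by simp
      finally show ?thesis using path_D[of i] step that unfolding sub_def by simp
    qed
    moreover have "\<not> sub (p i) x" if "\<not> i \<le> D x"
      using path_D[of i] step that unfolding sub_def by simp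
    ultimately show ?thesis using J[OF step.hyps(1)] True by auto
  next
    case False
    have "x \<noteq> p i" using False path_D[of i] step.prems by auto
    then show ?thesis using sub_pa[OF step.hyps] step.IH[OF step.prems] J[OF step.hyps(1)] False by auto
  qed
qed

lemma path_walk:
  assumes "\<forall>i. 1 \<le> i \<and> i < len \<longrightarrow> {p i, p (Suc i)} \<in> E'"
  shows "(s, t) \<in> adj E' ^^ (len - 1)"
  unfolding relpow_fun_conv using assms path_s pt len
  by (intro exI[of _ "\<lambda>i. p (Suc i)"]) (auto simp: adj_def)

lemma path_edge: "1 \<le> i \<Longrightarrow> i < len \<Longrightarrow> {p i, p (Suc i)} \<in> E"
  using path_ne[of i] pa_step[of "p (Suc i)"] by auto

text \<open>Deleting an edge off the path leaves the path intact, so the distance stays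
  \<open>len - 1\<close>, which is the default of \<open>reported_dist\<close>.\<close>

lemma correct_record_path:
  assumes len_ds: "length ds = len - 1"
    and ds: "\<And>i. 1 \<le> i \<Longrightarrow> i < len \<Longrightarrow> ds ! (i - 1) = gdist (E - {{p i, p (Suc i)}}) s t"
  shows "correct_record E s t (map p [1..<Suc len], ds)"
proof -
  let ?p = "map p [1..<Suc len]"
  have lp: "length ?p = len" by simp
  have nth: "?p ! i = p (Suc i)" if "i < len" for i using that by (simp del: upt_Suc)
  have ne: "?p \<noteq> []" using len by simp
  have walk: "is_walk E s t ?p"
    unfolding is_walk_def using ne lp nth path_edge path_s pt len
    by (auto simp: hd_conv_nth last_conv_nth simp del: upt_Suc)
  have gd: "gdist E s t = enat (len - 1)" using gdist_D[of t] len by simp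
  have pe: "path_edges ?p ! i = {p (Suc i), p (Suc (Suc i))}" if "i < len - 1" for i
    using that lp nth[of i] nth[of "Suc i"] by (simp add: path_edges_def del: upt_Suc)
  have lpe: "length (path_edges ?p) = len - 1" by (simp add: path_edges_def)
  have "reported_dist ?p ds e = gdist (E - {e}) s t" if "e \<in> E" for e
  proof (cases "map_of (zip (path_edges ?p) ds) e")
    case None
    then have "e \<notin> set (path_edges ?p)"
      using len_ds lpe by (metis map_of_zip_is_None)
    then have ne': "e \<noteq> {p i, p (Suc i)}" if "1 \<le> i" "i < len" for i
    proof -
      have "i - 1 < len - 1" using that by simp
      then have "path_edges ?p ! (i - 1) \<in> set (path_edges ?p)" using lpe by simp
      then show ?thesis using pe[of "i - 1"] that \<open>e \<notin> _\<close> by auto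
    qed
    have "(s, t) \<in> adj (E - {e}) ^^ (len - 1)"
      using path_edge ne' by (intro path_walk) force
    moreover have "len - 1 \<le> j" if "(s, t) \<in> adj (E - {e}) ^^ j" for j
      using gdist_min[OF gd, of j] adj_pow_mono[OF that] by auto
    ultimately have "gdist (E - {e}) s t = enat (len - 1)" by (rule gdist_eqI)
    then show ?thesis using None ne by (simp add: reported_dist_def del: upt_Suc)
  next
    case (Some d)
    \<comment> \<open>Whichever index \<open>map_of\<close> selects, its entry is the replacement
      distance for this very edge.\<close>
    then have "(e, d) \<in> set (zip (path_edges ?p) ds)" by (rule map_of_SomeD)
    then obtain i where "i < len - 1" "path_edges ?p ! i = e" "ds ! i = d"
      using lpe len_ds by (auto simp: in_set_zip)
    then have "d = gdist (E - {e}) s t" using pe[of i] ds[of "Suc i"] by auto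
    then show ?thesis using Some by (simp add: reported_dist_def)
  qed
  then show ?thesis
    using walk gd lp len_ds by (auto simp: correct_record_def simp del: upt_Suc)
qed

text \<open>The lower end of the \<open>i\<close>-th edge is \<open>p (Suc i)\<close>, so by
  \<open>sub_J\<close> the conditions "\<open>x\<close> outside, \<open>y\<close> inside" become
  \<open>J x < Suc i\<close> and \<open>Suc i \<le> J y\<close>.\<close>

lemma interval_le:
  assumes "1 \<le> i" "i < len" "slot y x" "J x \<le> i" "i < J y" "gdist E t y = enat d"
  shows "gdist (E - {{p i, p (Suc i)}}) s t \<le> enat (D x + d)"
proof -
  have "D y \<noteq> 0" "D x \<noteq> 0" using assms(3) slots unfolding slot_def by blast+
  then show ?thesis
    using replacement_le[of "p (Suc i)" t y x d] path_ne[OF assms(1,2)] path_sub[of "Suc i"]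
      sub_J[of x "Suc i"] sub_J[of y "Suc i"] assms by auto
qed

lemma interval_ge:
  assumes "1 \<le> i" "i < len" "gdist (E - {{p i, p (Suc i)}}) s t = enat k"
  shows "\<exists>x y d. slot y x \<and> J x \<le> i \<and> i < J y \<and> gdist E t y = enat d \<and> D x + d \<le> k"
proof -
  obtain x y d where *: "slot y x" "\<not> sub (p (Suc i)) x" "sub (p (Suc i)) y" "gdist E t y = enat d" "D x + d \<le> k"
    using replacement_ge[of "p (Suc i)" t k] path_ne[OF assms(1,2)] path_sub[of "Suc i"] assms by auto
  have "D y \<noteq> 0" "D x \<noteq> 0" using *(1) slots unfolding slot_def by blast+
  then show ?thesis
    using * sub_J[of x "Suc i"] sub_J[of y "Suc i"] assms by (intro exI[of _ x] exI[of _ y] exI[of _ d]) auto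
qed

end

section \<open>Proof rules with a clock, and the text of the search\<close>

section \<open>The program\<close>

abbreviation (input) zero :: exp where "zero \<equiv> Num 0"
abbreviation (input) one :: exp where "one \<equiv> Num 1"

inductive_cases big_SkipE: "big R Skip v A k v' A' k'"
inductive_cases big_AssignE: "big R (x ::= e) v A k v' A' k'"
inductive_cases big_PutE: "big R (Put a i j e) v A k v' A' k'"
inductive_cases big_SeqE: "big R (c ;; d) v A k v' A' k'"
inductive_cases big_CondE: "big R (Cond b c d) v A k v' A' k'"

lemma wp_Skip_iff: "wp R Skip Q v A k \<longleftrightarrow> Q v A k"
  unfolding wp_def by (blast intro: big.intros elim: big_SkipE)

lemma wp_Assign_iff: "wp R (x ::= e) Q v A k \<longleftrightarrow> safe R v A e \<and> Q (v(x := ev v A e)) A (Suc k)"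
  unfolding wp_def by (blast intro: big.intros elim: big_AssignE)

lemma wp_Put_iff: "wp R (Put a i j e) Q v A k \<longleftrightarrow> safe R v A i \<and> safe R v A j \<and> safe R v A e \<and>
    Q v (upd A a (ev v A i) (ev v A j) (ev v A e)) (Suc k)"
  unfolding wp_def by (blast intro: big.intros elim: big_PutE)

lemma wp_Seq_iff: "wp R (c ;; d) Q v A k \<longleftrightarrow> wp R c (wp R d Q) v A k"
  unfolding wp_def by (blast intro: big.intros elim: big_SeqE)

lemma wp_Cond_iff: "wp R (Cond b c d) Q v A k \<longleftrightarrow> bsafe R v A b \<and>
    (bev v A b \<longrightarrow> wp R c Q v A (Suc k)) \<and> (\<not> bev v A b \<longrightarrow> wp R d Q v A (Suc k))"
  unfolding wp_def by (cases "bev v A b") (auto intro: big.intros elim: big_CondE)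

lemmas wp_simps = wp_Skip_iff wp_Assign_iff wp_Put_iff wp_Seq_iff wp_Cond_iff

text \<open>The invariant is indexed by a ghost value that need not be stored anywhere, for instance
  the list of arcs still to be scanned. The measure \<open>g\<close> gives termination, and the time
  bound is a conjunct of the invariant.\<close>

lemma wp_loop:
  fixes g :: "'x \<Rightarrow> nat"
  assumes "I x v A k"
    and "\<And>x v A k. I x v A k \<Longrightarrow> bsafe R v A b"
    and "\<And>x v A k. I x v A k \<Longrightarrow> \<not> bev v A b \<Longrightarrow> Q v A (Suc k)"
    and "\<And>x v A k. I x v A k \<Longrightarrow> bev v A b \<Longrightarrow>
      wp R c (\<lambda>v' A' k'. \<exists>x'. g x' < g x \<and> I x' v' A' k') v A (Suc k)"
  shows "wp R (While b c) Q v A k"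
  using assms(1)
proof (induction "g x" arbitrary: x v A k rule: less_induct)
  case less
  show ?case
  proof (cases "bev v A b")
    case True
    obtain v' A' k' x' where 1: "big R c v A (Suc k) v' A' k'" "I x' v' A' k'" "g x' < g x"
      using assms(4)[OF less.prems True] unfolding wp_def by blast
    from less.hyps[OF 1(3,2)] show ?thesis
      unfolding wp_def using 1(1) assms(2)[OF less.prems] True by (blast intro: big.intros)
  next
    case False
    then show ?thesis
      unfolding wp_def using assms(2,3)[OF less.prems] by (blast intro: big.intros)
  qed
qed

definition sameV :: "var set \<Rightarrow> vars \<Rightarrow> vars \<Rightarrow> bool" where
  "sameV S v v' \<longleftrightarrow> (\<forall>x. x \<notin> S \<longrightarrow> v' x = v x)"

definition sameA :: "arr set \<Rightarrow> arrs \<Rightarrow> arrs \<Rightarrow> bool" where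
  "sameA S A A' \<longleftrightarrow> (\<forall>a. a \<notin> S \<longrightarrow> A' a = A a)"

lemma sameAD: "sameA S A A' \<Longrightarrow> a \<notin> S \<Longrightarrow> A' a = A a"
  by (simp add: sameA_def)

lemma same_refl: "sameV S v v" "sameA T A A"
  by (simp_all add: sameV_def sameA_def)

lemma sameV_upd: "sameV S v v' \<Longrightarrow> x \<in> S \<Longrightarrow> sameV S v (v'(x := c))"
  by (auto simp: sameV_def)

lemma sameA_upd: "sameA S A A' \<Longrightarrow> a \<in> S \<Longrightarrow> sameA S A (upd A' a i j c)"
  by (auto simp: sameA_def upd_def)

lemma sameV_trans: "sameV S v v' \<Longrightarrow> sameV T v' v'' \<Longrightarrow> S \<subseteq> U \<Longrightarrow> T \<subseteq> U \<Longrightarrow> sameV U v v''"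
  unfolding sameV_def by (metis subsetD)

lemma sameA_trans: "sameA S v v' \<Longrightarrow> sameA T v' v'' \<Longrightarrow> S \<subseteq> U \<Longrightarrow> T \<subseteq> U \<Longrightarrow> sameA U v v''"
  unfolding sameA_def by (metis subsetD)

lemmas same_upd = sameV_upd sameA_upd

lemma upd_same_arr: "upd A a i j x a = (A a)(i := (A a i)(j := x))"
  by (simp add: upd_def)

lemma upd_other_arr: "b \<noteq> a \<Longrightarrow> upd A a i j x b = A b"
  by (simp add: upd_def)

lemmas upd_simps = upd_same_arr upd_other_arr

text \<open>The position of an edge endpoint in the input doubles as the index of its arc cell, so
  edge \<open>i\<close> owns cells \<open>3 + 2 * i\<close> and \<open>4 + 2 * i\<close>. As these
  start at 3, the initial content 0 serves as the end-of-list mark.\<close>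

definition build :: com where
  "build =
    vK ::= Num 3 ;;
    vEN ::= Plus (Num 3) (Plus (Var vM) (Var vM)) ;;
    While (Less (Var vK) (Var vEN)) (
      vU ::= Get aIN zero (Var vK) ;;
      vW ::= Get aIN zero (Plus (Var vK) one) ;;
      Put aNXT zero (Var vK) (Get aHEAD zero (Var vU)) ;;
      Put aDST zero (Var vK) (Var vW) ;;
      Put aHEAD zero (Var vU) (Var vK) ;;
      Put aNXT zero (Plus (Var vK) one) (Get aHEAD zero (Var vW)) ;;
      Put aDST zero (Plus (Var vK) one) (Var vU) ;;
      Put aHEAD zero (Var vW) (Plus (Var vK) one) ;;
      vK ::= Plus (Var vK) (Num 2))"

text \<open>Vertices are scanned in queue order, so overwriting \<open>aLS\<close> every time leaves
  the last neighbour there, and writing \<open>aFS\<close> only when it is empty leaves the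
  first.\<close>

definition scan_arc :: com where
  "scan_arc =
    vY ::= Get aDST zero (Var vP) ;;
    Cond (Eq (Get aD (Var vSA) (Var vY)) zero)
      (Put aD (Var vSA) (Var vY) (Plus (Get aD (Var vSA) (Var vX)) one) ;;
       Put aPAR (Var vSA) (Var vY) (Plus (Var vX) one) ;;
       Put aQU (Var vSA) (Var vQT) (Var vY) ;;
       vQT ::= Plus (Var vQT) one)
      (Cond (Eq (Get aPAR (Var vSA) (Var vY)) (Plus (Var vX) one)) Skip
        (vCJ ::= Plus (Plus (Var vY) (Plus (Var vY) (Var vY)))
            (Minus (Plus (Get aD (Var vSA) (Var vX)) one) (Get aD (Var vSA) (Var vY))) ;;
         Put aLS (Var vSA) (Var vCJ) (Plus (Var vX) one) ;;
         Cond (Eq (Get aFS (Var vSA) (Var vCJ)) zero)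
           (Put aFS (Var vSA) (Var vCJ) (Plus (Var vX) one)) Skip)) ;;
    vP ::= Get aNXT zero (Var vP)"

definition visit_prog :: com where
  "visit_prog =
    vX ::= Get aQU (Var vSA) (Var vQH) ;;
    vP ::= Get aHEAD zero (Var vX) ;;
    While (Less zero (Var vP)) scan_arc ;;
    vQH ::= Plus (Var vQH) one"

definition bfs_prog :: com where
  "bfs_prog =
    Put aD (Var vSA) (Var vS) one ;;
    Put aPAR (Var vSA) (Var vS) (Plus (Var vS) one) ;;
    Put aQU (Var vSA) zero (Var vS) ;;
    vQH ::= zero ;;
    vQT ::= one ;;
    While (Less (Var vQH) (Var vQT)) visit_prog"

section \<open>Linked adjacency lists and the size bounds of an instance\<close>

subsection \<open>Adjacency lists\<close>

text \<open>The exact order of the linked lists: each edge pushes its two arcs to the front, whence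
  the reversal.\<close>

definition nb :: "(nat \<times> nat) list \<Rightarrow> nat \<Rightarrow> nat list" where
  "nb es x = concat (map (\<lambda>(u, w). (if w = x then [u] else []) @ (if u = x then [w] else [])) (rev es))"

lemma nb_Nil: "nb [] x = []" by (simp add: nb_def)

lemma nb_snoc: "nb (es @ [(u, w)]) x = (if w = x then [u] else []) @ (if u = x then [w] else []) @ nb es x"
  by (simp add: nb_def)

text \<open>\<open>b\<close> bounds the cells in use, so that old lists survive writes to cells from
  \<open>b\<close> on; \<open>chain_mono\<close> exploits this.\<close>

fun chain :: "(nat \<Rightarrow> nat) \<Rightarrow> (nat \<Rightarrow> nat) \<Rightarrow> nat \<Rightarrow> nat \<Rightarrow> nat list \<Rightarrow> bool" where
  "chain nx ds b p [] \<longleftrightarrow> p = 0"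
| "chain nx ds b p (x # xs) \<longleftrightarrow> 0 < p \<and> p < b \<and> ds p = x \<and> chain nx ds b (nx p) xs"

lemma chain_mono:
  "chain nx ds b p xs \<Longrightarrow> b \<le> b' \<Longrightarrow> (\<And>p. p < b \<Longrightarrow> nx' p = nx p \<and> ds' p = ds p) \<Longrightarrow> chain nx' ds' b' p xs"
  by (induction xs arbitrary: p) auto

lemma len_flat: "length (concat (map (\<lambda>(u, w). [u, w]) es)) = 2 * length es" for es :: "(nat \<times> nat) list"
  by (induction es) auto

lemma flat_nth: "i < length es \<Longrightarrow> concat (map (\<lambda>(u, w). [u, w]) es) ! (2 * i) = fst (es ! i) \<and>
    concat (map (\<lambda>(u, w). [u, w]) es) ! Suc (2 * i) = snd (es ! i)" for es :: "(nat \<times> nat) list"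
proof (induction es arbitrary: i)
  case (Cons e es)
  then show ?case by (cases i) (auto split: prod.splits)
qed simp

text \<open>\<open>R\<close> has to exceed every index and value. The largest are cubic in
  \<open>n\<close>: the output has at most \<open>2 * n\<close> words for each of at most
  \<open>n * n\<close> pairs, and the tables use up to \<open>n + 1\<close> rows per pair. A fourth
  power exceeds all this for every \<open>n\<close> and takes two squarings to compute.\<close>

locale inst =
  fixes n :: nat and E :: "nat set set" and es :: "(nat \<times> nat) list" and ss :: "nat list" and R :: nat
  assumes ug: "ugraph {..<n} E" and le: "lists_edges es E" and dss: "distinct ss"
    and sss: "set ss \<subseteq> {..<n}" and R: "R = (n + 2) ^ 4"
begin

abbreviation "m \<equiv> length es"
abbreviation "sg \<equiv> length ss"

definition inp :: "nat \<Rightarrow> nat" where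
  "inp j = (let xs = encode_input n es ss in if j < length xs then xs ! j else 0)"

lemma edge_es: "(u, w) \<in> set es \<Longrightarrow> {u, w} \<in> E"
  using le unfolding lists_edges_def by force

lemma edge_less: "{a, b} \<in> E \<Longrightarrow> a < n \<and> b < n \<and> a \<noteq> b"
  using ugraph_less[OF ug] .

lemma inp_simps: "inp 0 = n" "inp (Suc 0) = m" "inp 2 = sg"
  by (simp_all add: inp_def encode_input_def)

lemma inp_edge: "i < m \<Longrightarrow> inp (3 + 2 * i) = fst (es ! i) \<and> inp (4 + 2 * i) = snd (es ! i)"
proof -
  assume i: "i < m"
  have "encode_input n es ss = [n, m, sg] @ (concat (map (\<lambda>(u, w). [u, w]) es) @ ss)"
    by (simp add: encode_input_def)
  then have "encode_input n es ss ! (3 + j) = concat (map (\<lambda>(u, w). [u, w]) es) ! j" if "j < 2 * m" for j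
    using that by (simp add: nth_append len_flat nth_Cons')
  from this[of "2 * i"] this[of "Suc (2 * i)"] show ?thesis
    using i flat_nth[OF i] by (auto simp: inp_def encode_input_def len_flat)
qed

lemma inp_src: "a < sg \<Longrightarrow> inp (3 + 2 * m + a) = ss ! a"
  by (simp add: inp_def encode_input_def nth_append len_flat nth_Cons' Let_def)

lemma m_card: "m = card E"
  using le unfolding lists_edges_def by (metis distinct_card length_map)

lemma m_le: "m \<le> n * n"
proof -
  have "E \<subseteq> (\<lambda>(a, b). {a, b}) ` ({..<n} \<times> {..<n})"
    using ug unfolding ugraph_def by fastforce
  then have "card E \<le> card ({..<n} \<times> {..<n})"
    using surj_card_le[of "{..<n} \<times> {..<n}" E "\<lambda>(a, b). {a, b}"] by simp
  then show ?thesis using m_card by simp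
qed

lemma sg_le: "sg \<le> n"
  using distinct_card[OF dss] card_mono[OF _ sss] by simp

text \<open>In this form \<open>linarith\<close> treats the monomials as atoms, and
  \<open>n3\<close> compares them.\<close>

lemma R_expand: "R = n * n * n * n + 8 * (n * n * n) + 24 * (n * n) + 32 * n + 16"
  unfolding R by (simp add: eval_nat_numeral algebra_simps)

lemma n3: "n \<le> n * n" "n * n \<le> n * n * n"
  by simp_all

lemma nb_set: "y \<in> set (nb es' x) \<longleftrightarrow> (x, y) \<in> set es' \<or> (y, x) \<in> set es'"
proof (induction es' rule: rev_induct)
  case (snoc e es')
  obtain u w where "e = (u, w)" by fastforce
  then show ?case using snoc by (cases "w = x"; cases "u = x") (auto simp: nb_snoc)
next
  case Nil
  then show ?case by (simp add: nb_Nil)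
qed

lemma nb_adj: "y \<in> set (nb es x) \<longleftrightarrow> {x, y} \<in> E"
proof -
  have "{x, y} \<in> E \<longleftrightarrow> (\<exists>(u, w) \<in> set es. {x, y} = {u, w})"
    using le unfolding lists_edges_def by force
  then show ?thesis using nb_set[of y es x] by (auto simp: doubleton_eq_iff)
qed

text \<open>The handshake count; it bounds the total scanning work of one search.\<close>

lemma nb_sum: "(\<Sum>x<n. length (nb es x)) = 2 * m"
proof -
  have "(\<Sum>x<n. length (nb es' x)) = 2 * length es'" if "set es' \<subseteq> set es" for es'
    using that
  proof (induction es' rule: rev_induct)
    case (snoc e es')
    obtain u w where e: "e = (u, w)" by (cases e)
    then have uw: "u < n" "w < n" using edge_less[OF edge_es[of u w]] snoc.prems by auto
    have "(\<Sum>x<n. length (nb (es' @ [e]) x)) =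
      (\<Sum>x<n. if w = x then 1 else 0) + (\<Sum>x<n. if u = x then 1 else 0) + (\<Sum>x<n. length (nb es' x))"
      unfolding sum.distrib[symmetric] by (intro sum.cong) (auto simp: e nb_snoc)
    then show ?case using snoc uw by (simp add: sum.delta)
  qed (simp add: nb_Nil)
  then show ?thesis by simp
qed

text \<open>Like the later specifications, this one has an arbitrary continuation \<open>Q\<close>
  and puts the guarantees into a premise. It can thus be applied as a rule in the middle of a
  program, whatever follows.\<close>

lemma build_spec:
  assumes v: "v vM = m" and A: "A aIN 0 = inp" "\<And>x. A aHEAD 0 x = 0"
    and Q: "\<And>v' A' k'. v' vEN = 3 + 2 * m \<Longrightarrow> sameV {vK, vEN, vU, vW} v v' \<Longrightarrow>
      sameA {aHEAD, aNXT, aDST} A A' \<Longrightarrow>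
      (\<And>x. chain (A' aNXT 0) (A' aDST 0) R (A' aHEAD 0 x) (nb es x)) \<Longrightarrow>
      k' \<le> k + 10 * m + 3 \<Longrightarrow> Q v' A' k'"
  shows "wp R build Q v A k"
proof -
  define I where "I = (\<lambda>i v' A' k'. i \<le> m \<and> v' vK = 3 + 2 * i \<and> v' vEN = 3 + 2 * m \<and>
    sameV {vK, vEN, vU, vW} v v' \<and> sameA {aHEAD, aNXT, aDST} A A' \<and>
    (\<forall>x. chain (A' aNXT 0) (A' aDST 0) (3 + 2 * i) (A' aHEAD 0 x) (nb (take i es) x)) \<and>
    k' \<le> k + 10 * i + 2)"
  have Rm: "2 * m + 10 < R" using m_le R_expand n3 by linarith
  show ?thesis
    unfolding build_def
    apply (simp only: wp_Seq_iff)
    apply (simp add: wp_simps v)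
    apply (intro conjI; (use Rm in linarith)?)
    apply (rule wp_loop[where I = I and x = 0 and g = "\<lambda>i. m - i"])
    subgoal using A by (auto simp: I_def nb_Nil sameV_def sameA_def)
    subgoal by simp
    subgoal for i v' A' k'
    proof -
      assume "I i v' A' k'" and b: "\<not> bev v' A' (Less (Var vK) (Var vEN))"
      then have I: "i \<le> m" "v' vK = 3 + 2 * i" "v' vEN = 3 + 2 * m"
        "sameV {vK, vEN, vU, vW} v v'" "sameA {aHEAD, aNXT, aDST} A A'"
        "\<And>x. chain (A' aNXT 0) (A' aDST 0) (3 + 2 * i) (A' aHEAD 0 x) (nb (take i es) x)"
        "k' \<le> k + 10 * i + 2" by (auto simp: I_def)
      then have "i = m" using b by simp
      moreover have "chain (A' aNXT 0) (A' aDST 0) R (A' aHEAD 0 x) (nb es x)" for x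
      proof -
        have "chain (A' aNXT 0) (A' aDST 0) (3 + 2 * m) (A' aHEAD 0 x) (nb es x)"
          using I(6)[of x] \<open>i = m\<close> by simp
        then show ?thesis by (rule chain_mono) (use Rm in auto)
      qed
      ultimately show ?thesis using I by (intro Q) auto
    qed
    subgoal for i v' A' k'
    proof -
      assume "I i v' A' k'" and b: "bev v' A' (Less (Var vK) (Var vEN))"
      then have I: "i \<le> m" "v' vK = 3 + 2 * i" "v' vEN = 3 + 2 * m"
        "sameV {vK, vEN, vU, vW} v v'" "sameA {aHEAD, aNXT, aDST} A A'"
        "\<And>x. chain (A' aNXT 0) (A' aDST 0) (3 + 2 * i) (A' aHEAD 0 x) (nb (take i es) x)"
        "k' \<le> k + 10 * i + 2" by (auto simp: I_def)
      then have i: "i < m" using b by simp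
      obtain u w where uw: "es ! i = (u, w)" by fastforce
      have "(u, w) \<in> set es" using uw i by (metis nth_mem)
      then have "u \<noteq> w" using edge_less edge_es by blast
      have IN: "A' aIN 0 = inp" using I(5) A sameAD by fastforce
      have tk: "take (Suc i) es = take i es @ [(u, w)]" using uw i by (simp add: take_Suc_conv_app_nth)
      have iu: "inp (3 + 2 * i) = u" "inp (4 + 2 * i) = w" using inp_edge[OF i] uw by auto
      let ?K = "3 + 2 * i"
      let ?K' = "4 + 2 * i"
      let ?nx = "(A' aNXT 0)(?K := A' aHEAD 0 u, ?K' := A' aHEAD 0 w)"
      let ?ds = "(A' aDST 0)(?K := w, ?K' := u)"
      have old: "chain ?nx ?ds (5 + 2 * i) (A' aHEAD 0 x) (nb (take i es) x)" for x
        by (rule chain_mono[OF I(6)]) auto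
      \<comment> \<open>Since \<open>u \<noteq> w\<close> the two pushes concern different heads,
        and the old tails lie entirely below the two new cells.\<close>
      have new: "chain ?nx ?ds (5 + 2 * i) (((A' aHEAD 0)(u := ?K, w := ?K')) x) (nb (take (Suc i) es) x)" for x
        using old[of x] \<open>u \<noteq> w\<close> I(1-3) unfolding tk nb_snoc by auto
      have "I (Suc i) (v'(vU := u, vW := w, vK := 5 + 2 * i))
        (upd (upd (upd (upd (upd (upd A' aNXT 0 ?K (A' aHEAD 0 u)) aDST 0 ?K w) aHEAD 0 u ?K) aNXT 0 ?K'
           (A' aHEAD 0 w)) aDST 0 ?K' u) aHEAD 0 w ?K') kk" if "kk \<le> k' + 10" for kk
        unfolding I_def using that I i new \<open>u \<noteq> w\<close> by (simp add: upd_simps same_upd)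
      then show ?thesis
        using i Rm I(1-3) \<open>u \<noteq> w\<close>
        by (auto simp: wp_simps IN iu upd_simps intro!: exI[of _ "Suc i"])
    qed
    done
qed

end

section \<open>Invariant and running time of the search\<close>

section \<open>Correctness of the search\<close>

text \<open>The state while \<open>q qh\<close> is being scanned and its arcs to \<open>rest\<close>
  are pending; \<open>clos\<close> and \<open>slotc\<close> speak of scanned arcs only.
  \<open>near\<close> limits the queue to labels at most one above that of the head, and
  \<open>pnear\<close> places all parents at or before the head. These two are what keeps
  \<open>mono\<close> and \<open>pmono\<close> true when a vertex is appended.\<close>

locale binv = bfs_tree n E s qt q D P
  for n :: nat and E :: "nat set set" and s qh qt :: nat and rest :: "nat list"
    and q D P F L :: "nat \<Rightarrow> nat" +
  assumes qh: "qh \<le> qt"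
    and near: "\<And>i. qh < qt \<Longrightarrow> i < qt \<Longrightarrow> D (q i) \<le> D (q qh) + 1"
    and pnear: "\<And>i j. 0 < i \<Longrightarrow> i < qt \<Longrightarrow> j < qt \<Longrightarrow> P (q i) = q j + 1 \<Longrightarrow> j \<le> qh"
    and clos: "\<And>i y. i < qt \<Longrightarrow> {q i, y} \<in> E \<Longrightarrow> i < qh \<or> i = qh \<and> y \<notin> set rest \<Longrightarrow>
      D y \<noteq> 0 \<and> D y \<le> D (q i) + 1"
    and slotc: "\<And>i y. i < qt \<Longrightarrow> {q i, y} \<in> E \<Longrightarrow> i < qh \<or> i = qh \<and> y \<notin> set rest \<Longrightarrow> P y \<noteq> q i + 1 \<Longrightarrow>
      \<exists>i1 i2. i1 \<le> i \<and> i \<le> i2 \<and> i2 < qt \<and> i2 \<le> qh \<and>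
        F (3 * y + (D (q i) + 1 - D y)) = q i1 + 1 \<and> L (3 * y + (D (q i) + 1 - D y)) = q i2 + 1"
    and slots: "\<And>y c x. c < 3 \<Longrightarrow> F (3 * y + c) = x + 1 \<or> L (3 * y + c) = x + 1 \<Longrightarrow>
      (\<exists>i<qt. i \<le> qh \<and> x = q i) \<and> D y \<noteq> 0 \<and> {x, y} \<in> E \<and> P y \<noteq> x + 1 \<and> D x + 1 = D y + c"
begin

text \<open>If \<open>y\<close> precedes \<open>q i\<close> in the queue, it has been scanned
  completely and \<open>clos\<close> applies to \<open>y\<close>; otherwise the labels are ordered
  by \<open>mono\<close>. Thus the offset of a recorded arc is below 3.\<close>

lemma edge_near:
  assumes "i < qt" "i \<le> qh" "{q i, y} \<in> E" "D y \<noteq> 0"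
  shows "D (q i) \<le> D y + 1"
proof -
  obtain j where j: "y = q j" "j < qt" using Dpos[of y] assms(4) by auto
  show ?thesis
  proof (cases "j < i")
    case True
    then show ?thesis using clos[of j "q i"] j assms by (auto simp: insert_commute)
  next
    case False
    then show ?thesis using mono[of i j] j assms by simp
  qed
qed

lemma bfs: "qh = qt \<Longrightarrow> bfs n E s qt q D P F L"
proof (unfold_locales, goal_cases)
  case (1 i y)
  then show ?case using clos by blast
next
  case (2 i y)
  then show ?case using slotc[of i y] by blast
next
  case (3 y c x)
  have "D x \<noteq> 0" using slots[OF 3(3,4)] Dpos[of x] by blast
  then show ?case using slots[OF 3(3,4)] by blast
qed

lemma advance:
  assumes "rest = []" "qh < qt"
    and that: "\<And>y. Suc qh < qt \<Longrightarrow> {q (Suc qh), y} \<in> E \<Longrightarrow> y \<in> set rest'"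
  shows "binv n E s (Suc qh) qt rest' q D P F L"
proof (unfold_locales, goal_cases)
  case 1
  show ?case using assms by simp
next
  case (2 i)
  have "D (q i) \<le> D (q qh) + 1" using near 2 assms by blast
  also have "\<dots> \<le> D (q (Suc qh)) + 1" using mono[of qh "Suc qh"] 2 by simp
  finally show ?case .
next
  case (3 i j)
  then show ?case using pnear[of i j] by simp
next
  case (4 i y)
  then have "i \<le> qh" using that by (cases "i = Suc qh") auto
  then show ?case using clos[of i y] 4 assms by (cases "i = qh") auto
next
  case (5 i y)
  then have "i \<le> qh" using that by (cases "i = Suc qh") auto
  then show ?case using slotc[of i y] 5 assms by (cases "i = qh") fastforce+
next
  case (6 y c x)
  then show ?case using slots[OF 6] le_SucI by blast
qed

end

lemma binv_init:
  assumes "ugraph {..<n} E" "s < n" "\<forall>y. {s, y} \<in> E \<longrightarrow> y \<in> set rest"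
  shows "binv n E s 0 1 rest ((\<lambda>i. r i)(0 := s)) ((\<lambda>_. 0)(s := 1)) ((\<lambda>_. 0)(s := s + 1)) (\<lambda>_. 0) (\<lambda>_. 0)"
  using assms by unfold_locales (auto simp: inj_on_def)

text \<open>The new last vertex has the head as parent, so label order follows from
  \<open>near\<close> and parent order from \<open>pnear\<close>.\<close>

lemma binv_discover:
  assumes "binv n E s qh qt (y # rest) q D P F L" "qh < qt" "D y = 0" "{q qh, y} \<in> E"
  shows "binv n E s qh (Suc qt) rest (q(qt := y)) (D(y := D (q qh) + 1)) (P(y := q qh + 1)) F L"
proof -
  interpret binv n E s qh qt "y # rest" q D P F L by fact
  have yq: "y \<notin> q ` {..<qt}" using Dpos[of y] assms(3) by blast
  then have qy: "q i \<noteq> y" if "i < qt" for i using that by blast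
  have sy: "s \<noteq> y" using qy[of 0] cnt q0 by simp
  have yn: "y < n" using ugraph_less[OF ug assms(4)] by simp
  have old: "(q(qt := y)) i = q i" "(D(y := D (q qh) + 1)) (q i) = D (q i)" "(P(y := q qh + 1)) (q i) = P (q i)"
    if "i < qt" for i using that qy by auto
  have inj': "inj_on (q(qt := y)) {..<Suc qt}"
    using inj qy unfolding inj_on_def by (auto simp: less_Suc_eq) (metis lessThan_iff)+
  have idx: "j = l" if "q l = (q(qt := y)) j" "l < qt" "j < Suc qt" for j l
  proof (rule inj_onD[OF inj'])
    show "(q(qt := y)) j = (q(qt := y)) l" unfolding old(1)[OF that(2)] using that(1) by (rule sym)
  qed (use that(2,3) in auto)
  have eq: "j = qh" if "j < Suc qt" "q qh = (q(qt := y)) j" for j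
    using inj_onD[OF inj', of j qh] that assms(2) by simp
  \<comment> \<open>The slots of an undiscovered vertex are empty, so giving \<open>y\<close> a
    label invalidates no recorded offset.\<close>
  have Fy: "F (3 * y + c) = 0" "L (3 * y + c) = 0" if "c < 3" for c
    using slots[OF that, of y] assms(3) by (metis Suc_eq_plus1 not0_implies_Suc)+
  show ?thesis
  proof (unfold_locales, goal_cases)
    case 1 show ?case by (rule ug)
  next
    case 2 show ?case by simp
  next
    case 3 show ?case using q0 cnt by simp
  next
    case 4 show ?case by (rule inj')
  next
    case (5 i) then show ?case using qn yn by (auto simp: less_Suc_eq)
  next
    case 6 show ?case using Ds sy by simp
  next
    case (7 v)
    have "v \<in> (q(qt := y)) ` {..<Suc qt} \<longleftrightarrow> v = y \<or> v \<in> q ` {..<qt}"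
      by (auto simp: less_Suc_eq image_iff)
    then show ?case using Dpos[of v] by auto
  next
    case 8 show ?case using Ps sy by simp
  next
    case (9 i)
    show ?case
    proof (cases "i = qt")
      case True
      then show ?thesis using assms qy[of qh] by (intro exI[of _ qh]) auto
    next
      case False
      then have i: "i < qt" using 9 by simp
      then obtain j where "j < i" "P (q i) = q j + 1" "{q j, q i} \<in> E" "D (q i) = D (q j) + 1"
        using tree[of i] 9 by auto
      then show ?thesis using old[of i] old[of j] i by (intro exI[of _ j]) auto
    qed
  next
    case (10 i i')
    show ?case
    proof (cases "i' = qt")
      case True
      then show ?thesis using near[OF assms(2), of i] 10 old[of i] by (cases "i = qt") auto
    next
      case False
      then show ?thesis using mono[of i i'] 10 old[of i] old[of i'] by simp
    qed
  next
    case (11 i i' j j')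
    show ?case
    proof (cases "i' = qt")
      case True
      then have j': "j' = qh" using eq[of j'] 11 by simp
      show ?thesis
      proof (cases "i = qt")
        case True
        then show ?thesis using j' eq[of j] 11 by simp
      next
        case False
        then have i: "i < qt" using 11 by simp
        then obtain l where l: "l < i" "P (q i) = q l + 1" using tree[of i] 11 by auto
        then have "q l = (q(qt := y)) j" using 11(6) l(2) old(1)[OF i] old(3)[OF i] by (metis add_right_cancel)
        then have "l = j" using idx[of l j] 11(4) l(1) i by simp
        then show ?thesis using pnear[of i l] l i 11 j' by simp
      qed
    next
      case False
      then have i: "i < qt" "i' < qt" using 11 by simp_all
      have "j < qt" "j' < qt"
      proof -
        obtain l where l: "l < i" "P (q i) = q l + 1" using tree[of i] i 11 by auto
        then have "q l = (q(qt := y)) j" using 11(6) l(2) old(1)[OF i(1)] old(3)[OF i(1)] by (metis add_right_cancel)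
        then show "j < qt" using idx[of l j] 11(4) l(1) i by simp
        obtain l where l: "l < i'" "P (q i') = q l + 1" using tree[of i'] i 11 by auto
        then have "q l = (q(qt := y)) j'" using 11(7) l(2) old(1)[OF i(2)] old(3)[OF i(2)] by (metis add_right_cancel)
        then show "j' < qt" using idx[of l j'] 11(5) l(1) i by simp
      qed
      then show ?thesis using pmono[of i i' j j'] 11 i old[of i] old[of i'] by simp
    qed
  next
    case 12 show ?case using assms(2) by simp
  next
    case (13 i)
    then show ?case using near[OF assms(2), of i] old[of i] old[of qh] assms(2) by (cases "i = qt") auto
  next
    case (14 i j)
    show ?case
    proof (cases "i = qt")
      case True
      then show ?thesis using eq[of j] 14 by simp
    next
      case False
      then have i: "i < qt" using 14 by simp
      then obtain l where l: "l < i" "P (q i) = q l + 1" using tree[of i] 14 by auto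
      then have "q l = (q(qt := y)) j" using 14(4) l(2) old(1)[OF i] old(3)[OF i] by (metis add_right_cancel)
      then have "l = j" using idx[of l j] 14(3) l(1) i by simp
      then show ?thesis using pnear[of i l] l i 14 by simp
    qed
  next
    case (15 i z)
    then have i: "i < qt" "i \<le> qh" using assms(2) by auto
    show ?case
    proof (cases "z = y")
      case True
      have "D (q qh) \<le> D (q i) + 1 \<or> i = qh" if "i < qh"
        using that clos[of i y] 15 True assms(3) old[of i] i by auto
      \<comment> \<open>A completely scanned vertex adjacent to \<open>y\<close> would have
        discovered it by \<open>clos\<close>, so only the head remains.\<close>
      then have "i = qh" using i 15 True assms(3) clos[of i y] old[of i] by (cases "i < qh") auto
      then show ?thesis using True old[of qh] assms(2) by simp
    next
      case False
      then show ?thesis using clos[of i z] 15 i old[of i] by auto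
    qed
  next
    case (16 i z)
    then have i: "i < qt" "i \<le> qh" using assms(2) by auto
    show ?case
    proof (cases "z = y")
      case True
      have "i = qh" using i 16 True assms(3) clos[of i y] old[of i] by (cases "i < qh") auto
      then show ?thesis using True 16 old[of qh] assms(2) by simp
    next
      case False
      then obtain i1 i2 where *: "i1 \<le> i" "i \<le> i2" "i2 < qt" "i2 \<le> qh"
        "F (3 * z + (D (q i) + 1 - D z)) = q i1 + 1" "L (3 * z + (D (q i) + 1 - D z)) = q i2 + 1"
        using slotc[of i z] 16 i old[of i] by auto
      then show ?thesis using False old[of i] old[of i1] old[of i2] i
        by (intro exI[of _ i1] exI[of _ i2]) auto
    qed
  next
    case (17 z c x)
    have zy: "z \<noteq> y" using Fy[OF 17(1)] 17(2) by auto
    from slots[OF 17] obtain i where i: "i < qt" "i \<le> qh" "x = q i" by blast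
    then show ?case using slots[OF 17] zy qy[of i] by (auto intro!: exI[of _ i])
  qed
qed

lemma binv_skip:
  assumes "binv n E s qh qt (y # rest) q D P F L" "D y \<noteq> 0" "P y = q qh + 1" "qh < qt"
  shows "binv n E s qh qt rest q D P F L"
proof -
  interpret binv n E s qh qt "y # rest" q D P F L by fact
  have "D y \<le> D (q qh) + 1"
  proof -
    obtain i where "y = q i" "i < qt" using Dpos[of y] assms(2) by auto
    then show ?thesis using near assms(4) by blast
  qed
  show ?thesis
  proof (unfold_locales, goal_cases)
    case (4 i z)
    then show ?case using clos[of i z] assms \<open>D y \<le> _\<close> by (cases "i = qh \<and> z = y") auto
  next
    case (5 i z)
    then show ?case using slotc[of i z] assms by (cases "i = qh \<and> z = y") auto
  next
    case (6 y c x)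
    then show ?case using slots[OF 6] by blast
  qed (use qh near pnear in blast)+
qed

lemma slot_index_eq: "c < 3 \<Longrightarrow> c' < 3 \<Longrightarrow> 3 * y + c = 3 * y' + c' \<longleftrightarrow> y = y' \<and> c = (c' :: nat)"
  by presburger

text \<open>The head is the latest scanned vertex of the queue, hence the last neighbour so far, and
  the first one only if the slot was empty.\<close>

lemma binv_record:
  assumes "binv n E s qh qt (y # rest) q D P F L" "D y \<noteq> 0" "P y \<noteq> q qh + 1" "qh < qt" "{q qh, y} \<in> E"
  defines "j \<equiv> 3 * y + (D (q qh) + 1 - D y)"
  shows "binv n E s qh qt rest q D P (if F j = 0 then F(j := q qh + 1) else F) (L(j := q qh + 1))"
    "D y \<le> D (q qh) + 1" "D (q qh) \<le> D y + 1"
proof -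
  interpret binv n E s qh qt "y # rest" q D P F L by fact
  show Dy: "D y \<le> D (q qh) + 1"
  proof -
    obtain i where "y = q i" "i < qt" using Dpos[of y] assms(2) by auto
    then show ?thesis using near assms(4) by blast
  qed
  show Dx: "D (q qh) \<le> D y + 1" using edge_near[OF assms(4) _ assms(5,2)] by simp
  let ?F = "if F j = 0 then F(j := q qh + 1) else F"
  let ?L = "L(j := q qh + 1)"
  have c3: "D (q qh) + 1 - D y < 3" using Dx Dy by simp
  show "binv n E s qh qt rest q D P ?F ?L"
  proof (unfold_locales, goal_cases)
    case (4 i z)
    then show ?case using clos[of i z] assms Dy by (cases "i = qh \<and> z = y") auto
  next
    case (5 i z)
    show ?case
    proof (cases "i = qh \<and> z = y")
      case True
      \<comment> \<open>A slot that was already filled holds a vertex at or before the head, by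
        soundness of the slots.\<close>
      have "\<exists>i1\<le>qh. ?F j = q i1 + 1"
      proof (cases "F j = 0")
        case False
        then have "F j = (F j - 1) + 1" by simp
        then show ?thesis using slots[OF c3, of y "F j - 1"] False unfolding j_def by auto
      qed auto
      then obtain i1 where i1: "i1 \<le> qh" "?F j = q i1 + 1" by blast
      have zj: "3 * z + (D (q i) + 1 - D z) = j" using True by (simp add: j_def)
      have "?L j = q qh + 1" by simp
      then show ?thesis unfolding zj using True assms(4) i1 by (intro exI[of _ i1] exI[of _ qh]) blast
    next
      case False
      then have i: "i < qh \<or> i = qh \<and> z \<notin> set (y # rest)" using 5 by auto
      obtain i1 i2 where *: "i1 \<le> i" "i \<le> i2" "i2 < qt" "i2 \<le> qh"
        "F (3 * z + (D (q i) + 1 - D z)) = q i1 + 1" "L (3 * z + (D (q i) + 1 - D z)) = q i2 + 1"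
        using slotc[OF 5(1,2) i 5(4)] by blast
      have 1: "?F (3 * z + (D (q i) + 1 - D z)) = q i1 + 1" using *(5) by auto
      show ?thesis
      proof (cases "3 * z + (D (q i) + 1 - D z) = j")
        case True
        \<comment> \<open>An older arc shares the slot: its last entry moves on to the head, which
          stands no earlier in the queue than \<open>i\<close>.\<close>
        then have "?L (3 * z + (D (q i) + 1 - D z)) = q qh + 1" by simp
        then show ?thesis using 1 * i assms(4) by (intro exI[of _ i1] exI[of _ qh]) auto
      next
        case False
        then have "?L (3 * z + (D (q i) + 1 - D z)) = q i2 + 1" using *(6) by simp
        then show ?thesis using 1 * by blast
      qed
    qed
  next
    case (6 z c x)
    show ?case
    proof (cases "3 * z + c = j \<and> x = q qh")
      case True
      then have "z = y" "c = D (q qh) + 1 - D y" using slot_index_eq[OF 6(1) c3] unfolding j_def by auto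
      then show ?thesis using True assms(2-5) Dx Dy by auto
    next
      case False
      then have "F (3 * z + c) = x + 1 \<or> L (3 * z + c) = x + 1" using 6(2) by (auto split: if_splits)
      then show ?thesis using slots[OF 6(1)] by blast
    qed
  qed (use qh near pnear in blast)+
qed

context bfs_tree
begin

lemma cnt_le: "cnt \<le> n"
  using card_inj_on_le[OF inj, of "{..<n}"] qn by auto

lemma D_le: "D x \<le> n"
proof (cases "D x = 0")
  case False
  have "D (q i) \<le> i + 1" if "i < cnt" for i
    using that
  proof (induction i rule: less_induct)
    case (less i)
    show ?case
    proof (cases "i = 0")
      case False
      then obtain j where "j < i" "D (q i) = D (q j) + 1" using tree[of i] less.prems by auto
      then show ?thesis using less.IH[of j] less.prems by simp
    qed (use q0 Ds in simp)
  qed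
  moreover obtain i where "x = q i" "i < cnt" using Dpos[of x] False by auto
  ultimately show ?thesis using cnt_le by fastforce
qed simp

end

context inst
begin

lemma R_less: "10 * n + 10 < R"
  using R_expand n3 by linarith

lemma upd_row: "i' \<noteq> i \<Longrightarrow> upd A a i j x b i' = A b i'"
  by (simp add: upd_def)

abbreviation scanning where
  "scanning s a qh qt rest A \<equiv>
    binv n E s qh qt rest (A aQU a) (A aD a) (A aPAR a) (A aFS a) (A aLS a)"

lemma scan_spec:
  fixes v :: vars and A :: arrs
  assumes ch: "\<And>x. chain (A aNXT 0) (A aDST 0) R (A aHEAD 0 x) (nb es x)"
    and v: "v vSA = a" "v vQH = qh" "v vX = A aQU a qh" "v vP = A aHEAD 0 (A aQU a qh)" "qh < v vQT"
    and b: "scanning s a qh (v vQT) (nb es (A aQU a qh)) A"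
    and Q: "\<And>v' A' k'. sameV {vQT, vP, vY, vCJ} v v' \<Longrightarrow> sameA {aD, aPAR, aQU, aFS, aLS} A A' \<Longrightarrow>
      (\<And>b i. i \<noteq> a \<Longrightarrow> A' b i = A b i) \<Longrightarrow> qh < v' vQT \<Longrightarrow>
      (\<And>i. i \<le> qh \<Longrightarrow> A' aQU a i = A aQU a i) \<Longrightarrow>
      scanning s a qh (v' vQT) [] A' \<Longrightarrow>
      k' \<le> k + 10 * length (nb es (A aQU a qh)) + 1 \<Longrightarrow> Q v' A' k'"
  shows "wp R (While (Less zero (Var vP)) scan_arc) Q v A k"
proof -
  let ?x = "A aQU a qh"
  define I where "I = (\<lambda>rest v' A' k'.
    scanning s a qh (v' vQT) rest A' \<and>
    chain (A aNXT 0) (A aDST 0) R (v' vP) rest \<and> qh < v' vQT \<and> set rest \<subseteq> {y. {?x, y} \<in> E} \<and>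
    sameV {vQT, vP, vY, vCJ} v v' \<and> sameA {aD, aPAR, aQU, aFS, aLS} A A' \<and>
    (\<forall>b i. i \<noteq> a \<longrightarrow> A' b i = A b i) \<and> (\<forall>i\<le>qh. A' aQU a i = A aQU a i) \<and>
    k' + 10 * length rest \<le> k + 10 * length (nb es ?x))"
  show ?thesis
  proof (rule wp_loop[where I = I and x = "nb es ?x" and g = length])
    show "I (nb es ?x) v A k"
      unfolding I_def using b ch v nb_adj by (auto simp: same_refl)
  next
    fix rest v' A' k'
    assume "I rest v' A' k'"
    then show "bsafe R v' A' (Less zero (Var vP))" using R_less by simp
  next
    fix rest v' A' k'
    assume I: "I rest v' A' k'" and "\<not> bev v' A' (Less zero (Var vP))"
    then have "rest = []" unfolding I_def by (cases rest) auto
    then show "Q v' A' (Suc k')" using I unfolding I_def by (intro Q) auto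
  next
    fix rest v' A' k'
    assume I0: "I rest v' A' k'" and "bev v' A' (Less zero (Var vP))"
    then obtain y r where rest: "rest = y # r" unfolding I_def by (cases rest) auto
    have I: "scanning s a qh (v' vQT) (y # r) A'"
      "A aDST 0 (v' vP) = y" "chain (A aNXT 0) (A aDST 0) R (A aNXT 0 (v' vP)) r" "qh < v' vQT"
      "{?x, y} \<in> E" "set r \<subseteq> {y. {?x, y} \<in> E}" "sameV {vQT, vP, vY, vCJ} v v'"
      "sameA {aD, aPAR, aQU, aFS, aLS} A A'" "\<And>b i. i \<noteq> a \<Longrightarrow> A' b i = A b i"
      "\<And>i. i \<le> qh \<Longrightarrow> A' aQU a i = A aQU a i"
      "k' + 10 + 10 * length r \<le> k + 10 * length (nb es ?x)"
      using I0 unfolding I_def rest by auto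
    interpret b: binv n E s qh "v' vQT" "y # r" "A' aQU a" "A' aD a" "A' aPAR a" "A' aFS a" "A' aLS a"
      by (rule I(1))
    have vs: "v' vSA = a" "v' vX = ?x" using I(7) v by (simp_all add: sameV_def)
    have As: "A' aDST 0 = A aDST 0" "A' aNXT 0 = A aNXT 0" using I(8) by (simp_all add: sameA_def)
    have xq: "A' aQU a qh = ?x" using I(10) by simp
    have xy: "?x < n" "y < n" using edge_less[OF I(5)] by auto
    have QT: "v' vQT \<le> n" by (rule b.cnt_le)
    let ?D = "A' aD a" and ?P = "A' aPAR a"
    have D: "?D z \<le> n" for z by (rule b.D_le)
    \<comment> \<open>Demanding the invariant for all clock values up to a bound makes the
      postcondition monotone in time, so branches of different cost are treated alike.\<close>
    have "wp R (Cond (Eq (Get aD (Var vSA) (Var vY)) zero)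
      (Put aD (Var vSA) (Var vY) (Plus (Get aD (Var vSA) (Var vX)) one) ;;
       Put aPAR (Var vSA) (Var vY) (Plus (Var vX) one) ;;
       Put aQU (Var vSA) (Var vQT) (Var vY) ;;
       vQT ::= Plus (Var vQT) one)
      (Cond (Eq (Get aPAR (Var vSA) (Var vY)) (Plus (Var vX) one)) Skip
        (vCJ ::= Plus (Plus (Var vY) (Plus (Var vY) (Var vY)))
            (Minus (Plus (Get aD (Var vSA) (Var vX)) one) (Get aD (Var vSA) (Var vY))) ;;
         Put aLS (Var vSA) (Var vCJ) (Plus (Var vX) one) ;;
         Cond (Eq (Get aFS (Var vSA) (Var vCJ)) zero)
           (Put aFS (Var vSA) (Var vCJ) (Plus (Var vX) one)) Skip)))
      (\<lambda>v A k. \<forall>kk \<le> k + 1. I r (v(vP := A aNXT 0 (v vP))) A kk) (v'(vY := y)) A' (Suc (Suc k'))"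
      (is "wp R _ ?Q _ _ _")
    proof -
      consider (new) "?D y = 0" | (skip) "?D y \<noteq> 0" "?P y = ?x + 1" | (rec) "?D y \<noteq> 0" "?P y \<noteq> ?x + 1" by blast
      then show ?thesis
      proof cases
        case new
        have B: "binv n E s qh (Suc (v' vQT)) r ((A' aQU a)(v' vQT := y)) (?D(y := Suc (?D ?x))) (?P(y := Suc ?x))
            (A' aFS a) (A' aLS a)"
          using binv_discover[OF I(1,4) new] I(5) xq by simp
        show ?thesis using new B I D[of ?x] R_less xy QT
          by (auto simp: wp_simps vs As upd_simps I_def xq upd_row intro!: same_upd)
      next
        case skip
        have B: "binv n E s qh (v' vQT) r (A' aQU a) ?D ?P (A' aFS a) (A' aLS a)"
          using binv_skip[OF I(1) skip(1) _ I(4)] skip(2) xq by simp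
        show ?thesis using skip B I R_less xy
          by (auto simp: wp_simps vs As upd_simps I_def xq upd_row intro!: same_upd)
      next
        case rec
        let ?j = "3 * y + (?D ?x + 1 - ?D y)"
        have B: "binv n E s qh (v' vQT) r (A' aQU a) ?D ?P
           (if A' aFS a ?j = 0 then (A' aFS a)(?j := ?x + 1) else A' aFS a) ((A' aLS a)(?j := ?x + 1))"
          "?D y \<le> ?D ?x + 1" "?D ?x \<le> ?D y + 1"
          using binv_record[OF I(1) rec(1) _ I(4), unfolded xq, OF rec(2) I(5)] by blast+
        have j: "y + (y + y) + (?D ?x + 1 - ?D y) = ?j" by simp
        have j': "y + (y + y) + (Suc (?D ?x) - ?D y) = ?j" by simp
        show ?thesis
        proof (cases "A' aFS a ?j = 0")
          case True
          then show ?thesis using rec B I R_less xy D[of ?x] j j'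
            by (auto simp: wp_simps vs As upd_simps I_def xq upd_row intro!: same_upd)
        next
          case False
          then show ?thesis using rec B I R_less xy D[of ?x] j j'
            by (auto simp: wp_simps vs As upd_simps I_def xq upd_row intro!: same_upd)
        qed
      qed
    qed
    then show "wp R scan_arc (\<lambda>v' A' k'. \<exists>rest'. length rest' < length rest \<and> I rest' v' A' k') v' A' (Suc k')"
      unfolding scan_arc_def wp_Seq_iff wp_Assign_iff[of R vY]
      apply (simp add: As I(2) del: wp_simps)
      apply (rule conjI)
      subgoal using R_less by simp
      apply (erule wp_mono)
      using R_less apply (auto simp: wp_Assign_iff rest intro!: exI[of _ r])
      done
  qed
qed

lemma bfs_spec:
  fixes v :: vars and A :: arrs
  assumes ch: "\<And>x. chain (A aNXT 0) (A aDST 0) R (A aHEAD 0 x) (nb es x)"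
    and v: "v vSA = a" "v vS = s" "s < n"
    and z: "A aD a = (\<lambda>_. 0)" "A aPAR a = (\<lambda>_. 0)" "A aFS a = (\<lambda>_. 0)" "A aLS a = (\<lambda>_. 0)"
    and Q: "\<And>v' A' k'. sameV {vQH, vQT, vX, vP, vY, vCJ} v v' \<Longrightarrow> sameA {aD, aPAR, aQU, aFS, aLS} A A' \<Longrightarrow>
      (\<And>b i. i \<noteq> a \<Longrightarrow> A' b i = A b i) \<Longrightarrow>
      bfs n E s (v' vQT) (A' aQU a) (A' aD a) (A' aPAR a) (A' aFS a) (A' aLS a) \<Longrightarrow>
      k' \<le> k + 10 * n + 20 * m + 10 \<Longrightarrow> Q v' A' k'"
  shows "wp R bfs_prog Q v A k"
proof -
  define I where "I = (\<lambda>qh v' A' k'. v' vQH = qh \<and>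
    scanning s a qh (v' vQT) (if qh < v' vQT then nb es (A' aQU a qh) else []) A' \<and>
    sameV {vQH, vQT, vX, vP, vY, vCJ} v v' \<and> sameA {aD, aPAR, aQU, aFS, aLS} A A' \<and>
    (\<forall>b i. i \<noteq> a \<longrightarrow> A' b i = A b i) \<and>
    k' \<le> k + 5 + 5 * qh + 10 * (\<Sum>i<qh. length (nb es (A' aQU a i))))"
  have loop: "wp R (While (Less (Var vQH) (Var vQT)) visit_prog) Q v0 A0 k0" if "I 0 v0 A0 k0" for v0 A0 k0
  proof (rule wp_loop[where I = I and x = 0 and g = "\<lambda>qh. n - qh"])
    show "I 0 v0 A0 k0" by fact
  next
    fix qh v' A' k'
    assume "I qh v' A' k'"
    then show "bsafe R v' A' (Less (Var vQH) (Var vQT))" by simp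
  next
    fix qh v' A' k'
    assume I0: "I qh v' A' k'" and n: "\<not> bev v' A' (Less (Var vQH) (Var vQT))"
    then have I: "scanning s a qh (v' vQT) [] A'"
      "sameV {vQH, vQT, vX, vP, vY, vCJ} v v'" "sameA {aD, aPAR, aQU, aFS, aLS} A A'"
      "\<And>b i. i \<noteq> a \<Longrightarrow> A' b i = A b i"
      "k' \<le> k + 5 + 5 * qh + 10 * (\<Sum>i<qh. length (nb es (A' aQU a i)))"
      unfolding I_def by (auto split: if_splits)
    interpret b: binv n E s qh "v' vQT" "[]" "A' aQU a" "A' aD a" "A' aPAR a" "A' aFS a" "A' aLS a"
      by (rule I(1))
    have qh: "qh = v' vQT" using b.qh n I0 unfolding I_def by simp
    \<comment> \<open>The queue is injective, so the scanning costs add up to a sum of degrees over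
      distinct vertices, at most \<open>2 * m\<close>.\<close>
    have "(\<Sum>i<qh. length (nb es (A' aQU a i))) = (\<Sum>x \<in> A' aQU a ` {..<qh}. length (nb es x))"
      using b.inj unfolding qh by (simp add: sum.reindex)
    also have "\<dots> \<le> (\<Sum>x<n. length (nb es x))"
      using b.qn unfolding qh by (intro sum_mono2) auto
    finally have "k' + 1 \<le> k + 10 * n + 20 * m + 10"
      using I(5) nb_sum b.cnt_le qh by linarith
    then show "Q v' A' (Suc k')" using I b.bfs[OF qh] by (intro Q) auto
  next
    fix qh v' A' k'
    assume I0: "I qh v' A' k'" and n: "bev v' A' (Less (Var vQH) (Var vQT))"
    let ?x = "A' aQU a qh"
    have I: "v' vQH = qh" "qh < v' vQT"
      "scanning s a qh (v' vQT) (nb es ?x) A'"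
      "sameV {vQH, vQT, vX, vP, vY, vCJ} v v'" "sameA {aD, aPAR, aQU, aFS, aLS} A A'"
      "\<And>b i. i \<noteq> a \<Longrightarrow> A' b i = A b i"
      "k' \<le> k + 5 + 5 * qh + 10 * (\<Sum>i<qh. length (nb es (A' aQU a i)))"
      using I0 n unfolding I_def by auto
    interpret b: binv n E s qh "v' vQT" "nb es ?x" "A' aQU a" "A' aD a" "A' aPAR a" "A' aFS a" "A' aLS a"
      by (rule I(3))
    have vs: "v' vSA = a" using I(4) v by (simp add: sameV_def)
    have As: "A' aHEAD = A aHEAD" "A' aDST = A aDST" "A' aNXT = A aNXT" using I(5) by (simp_all add: sameA_def)
    have qn: "qh < n" using I(2) b.cnt_le by simp
    have "wp R (While (Less zero (Var vP)) scan_arc)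
      (\<lambda>v' A' k'. v' vQH = qh \<and> (\<forall>kk. kk \<le> Suc k' \<longrightarrow> I (Suc qh) (v'(vQH := Suc qh)) A' kk))
      (v'(vX := ?x, vP := A' aHEAD 0 ?x)) A' (Suc (Suc (Suc k')))" (is "wp R _ ?Q ?v _ ?k")
    proof (rule scan_spec[where a = a and qh = qh])
      fix v'' A'' k''
      assume "sameV {vQT, vP, vY, vCJ} ?v v''" and a: "sameA {aD, aPAR, aQU, aFS, aLS} A' A''"
        "\<And>b i. i \<noteq> a \<Longrightarrow> A'' b i = A' b i" "qh < v'' vQT" "\<And>i. i \<le> qh \<Longrightarrow> A'' aQU a i = A' aQU a i"
        "scanning s a qh (v'' vQT) [] A''"
        "k'' \<le> ?k + 10 * length (nb es ?x) + 1"
      interpret c: binv n E s qh "v'' vQT" "[]" "A'' aQU a" "A'' aD a" "A'' aPAR a" "A'' aFS a" "A'' aLS a"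
        by (rule a(5))
      have v'': "v'' vQH = qh" and sv: "sameV {vQH, vQT, vX, vP, vY, vCJ} v (v''(vQH := Suc qh))"
        using \<open>sameV _ ?v v''\<close> I(1,4) by (simp_all add: sameV_def)
      have sa: "sameA {aD, aPAR, aQU, aFS, aLS} A A''"
        using sameA_trans[OF I(5) a(1)] by simp
      have B: "scanning s a (Suc qh) (v'' vQT) (if Suc qh < v'' vQT then nb es (A'' aQU a (Suc qh)) else []) A''"
        using c.advance[OF refl a(3)] nb_adj by simp
      have "(\<Sum>i<Suc qh. length (nb es (A'' aQU a i))) = (\<Sum>i<qh. length (nb es (A' aQU a i))) + length (nb es ?x)"
        using a(4) by simp
      then have "I (Suc qh) (v''(vQH := Suc qh)) A'' kk" if "kk \<le> Suc k''" for kk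
        unfolding I_def using B sv sa a(2,6) I(6,7) that by simp
      then show "?Q v'' A'' k''" using v'' by simp
    qed (use ch I vs As in simp_all)
    then show "wp R visit_prog (\<lambda>v' A' k'. \<exists>qh'. n - qh' < n - qh \<and> I qh' v' A' k') v' A' (Suc k')"
      unfolding visit_prog_def wp_Seq_iff wp_Assign_iff[of R vX] wp_Assign_iff[of R vP]
      using R_less I(1) vs qn
      by (auto simp: wp_Assign_iff elim!: wp_mono intro!: exI[of _ "Suc qh"])
  qed
  let ?A = "upd (upd (upd A aD a s 1) aPAR a s (Suc s)) aQU a 0 s"
  have B: "scanning s a 0 1 (nb es s) ?A"
    using binv_init[OF ug v(3), of "nb es s" "A aQU a"] nb_adj by (simp add: upd_simps z)
  have "I 0 (v(vQH := 0, vQT := 1)) ?A (Suc (Suc (Suc (Suc (Suc k)))))"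
    unfolding I_def using B by (simp add: upd_simps upd_row same_upd same_refl)
  from loop[OF this] show ?thesis
    unfolding bfs_prog_def using R_less v by (simp add: wp_simps)
qed

end

section \<open>Decomposing intervals into dyadic blocks\<close>

section \<open>Offline interval minima\<close>

text \<open>Entry \<open>T k p\<close> of a table is a candidate minimum for all positions \<open>i\<close> with \<open>i div 2 ^ k = p\<close>;
  the value 0 stands for a missing entry.\<close>

definition covered :: "nat \<Rightarrow> (nat \<Rightarrow> nat \<Rightarrow> nat) \<Rightarrow> nat \<Rightarrow> nat \<Rightarrow> bool" where
  "covered n T i x \<longleftrightarrow> (\<exists>k. 0 < n div 2 ^ k \<and> 0 < T k (i div 2 ^ k) \<and> T k (i div 2 ^ k) \<le> x)"

text \<open>Quantifying over positions instead of blocks says directly that a value found for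
  \<open>i\<close> belongs to a candidate serving \<open>i\<close>.\<close>

definition sound :: "(nat \<Rightarrow> nat \<Rightarrow> nat) \<Rightarrow> (nat \<times> nat \<times> nat) set \<Rightarrow> bool" where
  "sound T U \<longleftrightarrow> (\<forall>k i. T k (i div 2 ^ k) \<noteq> 0 \<longrightarrow> (\<exists>l r. (l, r, T k (i div 2 ^ k)) \<in> U \<and> l \<le> i \<and> i < r))"

definition chmin :: "(nat \<Rightarrow> nat \<Rightarrow> nat) \<Rightarrow> nat \<Rightarrow> nat \<Rightarrow> nat \<Rightarrow> nat \<Rightarrow> nat \<Rightarrow> nat" where
  "chmin T k p x = (if T k p = 0 \<or> x < T k p then T(k := (T k)(p := x)) else T)"

lemma covered_chmin: "covered n T i x \<Longrightarrow> 0 < y \<Longrightarrow> covered n (chmin T k p y) i x"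
proof -
  assume "covered n T i x" and y: "0 < y"
  then obtain l where "0 < n div 2 ^ l" "0 < T l (i div 2 ^ l)" "T l (i div 2 ^ l) \<le> x"
    unfolding covered_def by blast
  then show ?thesis unfolding covered_def chmin_def using y by (intro exI[of _ l]) auto
qed

lemma covered_chmin_new: "0 < n div 2 ^ k \<Longrightarrow> 0 < y \<Longrightarrow> covered n (chmin T k (i div 2 ^ k) y) i y"
  unfolding covered_def chmin_def by (intro exI[of _ k]) auto

lemma sound_chmin:
  assumes "sound T U" "(l, r, y) \<in> U" "\<And>i. i div 2 ^ k = p \<Longrightarrow> l \<le> i \<and> i < r"
  shows "sound (chmin T k p y) U"
  unfolding sound_def
proof (intro allI impI)
  fix k' i
  assume nz: "chmin T k p y k' (i div 2 ^ k') \<noteq> 0"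
  show "\<exists>l r. (l, r, chmin T k p y k' (i div 2 ^ k')) \<in> U \<and> l \<le> i \<and> i < r"
  proof (cases "k' = k \<and> i div 2 ^ k' = p \<and> (T k p = 0 \<or> y < T k p)")
    case True
    then show ?thesis using assms(2) assms(3)[of i] by (auto simp: chmin_def)
  next
    case False
    then have "chmin T k p y k' (i div 2 ^ k') = T k' (i div 2 ^ k')" by (auto simp: chmin_def)
    then show ?thesis using nz assms(1) unfolding sound_def by metis
  qed
qed

text \<open>The invariant of the bottom-up decomposition of \<open>{l..<r}\<close> into dyadic blocks: at level \<open>k\<close> the
  blocks \<open>a, \<dots>, b - 1\<close> remain to be treated.\<close>

definition dyadic :: "nat \<Rightarrow> (nat \<Rightarrow> nat \<Rightarrow> nat) \<Rightarrow> nat \<Rightarrow> nat \<Rightarrow> nat \<Rightarrow> nat \<Rightarrow> nat \<Rightarrow> nat \<Rightarrow> bool" where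
  "dyadic n T l r y k a b \<longleftrightarrow> b \<le> n div 2 ^ k \<and>
     (\<forall>i. l \<le> i \<and> i < r \<longrightarrow> covered n T i y \<or> a \<le> i div 2 ^ k \<and> i div 2 ^ k < b) \<and>
     (\<forall>i. a \<le> i div 2 ^ k \<and> i div 2 ^ k < b \<longrightarrow> l \<le> i \<and> i < r)"

text \<open>A block with odd index is the right half of its parent, whose left half is not in the
  range; it must therefore be entered at this level.\<close>

lemma dyadic_left:
  assumes "dyadic n T l r y k a b" "a < b" "odd a" "0 < y" "sound T U" "(l, r, y) \<in> U"
  shows "dyadic n (chmin T k a y) l r y k (a + 1) b" "sound (chmin T k a y) U"
proof -
  have n: "0 < n div 2 ^ k" using assms unfolding dyadic_def by linarith
  have "covered n (chmin T k a y) i y \<or> a + 1 \<le> i div 2 ^ k \<and> i div 2 ^ k < b" if "l \<le> i" "i < r" for i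
  proof (cases "i div 2 ^ k = a")
    case True
    then show ?thesis using covered_chmin_new[OF n assms(4), of T i] by simp
  next
    case False
    then show ?thesis using assms(1) that covered_chmin[OF _ assms(4)] unfolding dyadic_def
      by (metis Suc_eq_plus1 Suc_leI le_neq_implies_less)
  qed
  then show "dyadic n (chmin T k a y) l r y k (a + 1) b"
    using assms(1) unfolding dyadic_def by auto
  show "sound (chmin T k a y) U"
    by (rule sound_chmin[OF assms(5,6)]) (use assms(1,2) in \<open>auto simp: dyadic_def\<close>)
qed

text \<open>Used for odd \<open>b\<close>: block \<open>b - 1\<close> is then the left half of its
  parent, whose right half lies beyond the range.\<close>

lemma dyadic_right:
  assumes "dyadic n T l r y k a b" "a < b" "0 < y" "sound T U" "(l, r, y) \<in> U"
  shows "dyadic n (chmin T k (b - 1) y) l r y k a (b - 1)" "sound (chmin T k (b - 1) y) U"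
proof -
  have n: "0 < n div 2 ^ k" using assms unfolding dyadic_def by linarith
  have "covered n (chmin T k (b - 1) y) i y \<or> a \<le> i div 2 ^ k \<and> i div 2 ^ k < b - 1" if "l \<le> i" "i < r" for i
  proof (cases "i div 2 ^ k = b - 1")
    case True
    then show ?thesis using covered_chmin_new[OF n assms(3), of T i] by simp
  next
    case False
    have "covered n T i y \<or> a \<le> i div 2 ^ k \<and> i div 2 ^ k < b"
      using assms(1) that unfolding dyadic_def by blast
    then show ?thesis using False covered_chmin[OF _ assms(3)] by auto
  qed
  then show "dyadic n (chmin T k (b - 1) y) l r y k a (b - 1)"
    using assms(1) unfolding dyadic_def by auto
  show "sound (chmin T k (b - 1) y) U"
    by (rule sound_chmin[OF assms(4,5)]) (use assms(1,2) in \<open>auto simp: dyadic_def\<close>)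
qed

lemma dyadic_up:
  assumes "dyadic n T l r y k a b" "even a" "even b"
  shows "dyadic n T l r y (Suc k) (a div 2) (b div 2)"
proof -
  have d: "i div 2 ^ Suc k = (i div 2 ^ k) div 2" for i :: nat
    by (metis div_mult2_eq power_Suc2)
  obtain a' b' where ab: "a = 2 * a'" "b = 2 * b'" using assms by (auto elim!: evenE)
  have "a div 2 \<le> j div 2 \<and> j div 2 < b div 2 \<longleftrightarrow> a \<le> j \<and> j < b" for j
    unfolding ab by auto
  then show ?thesis using assms(1) unfolding dyadic_def d by (auto simp: div_le_mono)
qed

text \<open>The bit length of \<open>n\<close>, which is the number of levels with
  \<open>0 < n div 2 ^ k\<close>. The unconditional equation would loop as a simplification
  rule.\<close>

fun blen :: "nat \<Rightarrow> nat" where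
  "blen n = (if n = 0 then 0 else 1 + blen (n div 2))"

declare blen.simps [simp del]

text \<open>A crude bound on the level number. It is enough for reserving \<open>n + 1\<close> table
  rows per reachable pair, since untouched rows cost no time.\<close>

lemma div_pow_less: "0 < n div 2 ^ k \<Longrightarrow> k < (n :: nat)"
proof -
  assume "0 < n div 2 ^ k"
  then have "2 ^ k \<le> n" by (simp add: div_greater_zero_iff)
  then show ?thesis using less_exp[of k] by linarith
qed

section \<open>One pair of sources in O(n log n) time\<close>

section \<open>Processing a pair of sources\<close>

definition chmin_prog :: "exp \<Rightarrow> com" where
  "chmin_prog p =
    Cond (Eq (Get aTAB (Var vK) p) zero) (Put aTAB (Var vK) p (Var vVAL))
      (Cond (Less (Var vVAL) (Get aTAB (Var vK) p)) (Put aTAB (Var vK) p (Var vVAL)) Skip)"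

definition level_prog :: com where
  "level_prog =
    Cond (Eq (Odd (Var vL)) one) (chmin_prog (Var vL) ;; vL ::= Plus (Var vL) one) Skip ;;
    Cond (Eq (Odd (Var vR)) one) (vR ::= Minus (Var vR) one ;; chmin_prog (Var vR)) Skip ;;
    vL ::= Half (Var vL) ;;
    vR ::= Half (Var vR) ;;
    vK ::= Plus (Var vK) one"

definition insert_prog :: com where
  "insert_prog =
    While (Less (Var vL) (Var vR)) level_prog"

definition tab :: "arrs \<Rightarrow> nat \<Rightarrow> nat \<Rightarrow> nat \<Rightarrow> nat" where
  "tab A tb k p = A aTAB (tb + k) p"

definition chminA :: "arrs \<Rightarrow> nat \<Rightarrow> nat \<Rightarrow> nat \<Rightarrow> arrs" where
  "chminA A k p x = (if A aTAB k p = 0 \<or> x < A aTAB k p then upd A aTAB k p x else A)"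

lemma tab_chminA: "tab (chminA A (tb + k) p x) tb = chmin (tab A tb) k p x"
  by (intro ext) (auto simp: tab_def chminA_def chmin_def upd_def)

lemma chminA_row: "i \<noteq> k \<Longrightarrow> chminA A k p x aTAB i = A aTAB i"
  by (simp add: chminA_def upd_def)

lemma sameA_chminA: "sameA S A A' \<Longrightarrow> aTAB \<in> S \<Longrightarrow> sameA S A (chminA A' k p x)"
  by (simp add: chminA_def sameA_upd)

lemma wp_chmin:
  assumes "safe R v A p" "0 < R" "\<And>kk. kk \<le> k + 3 \<Longrightarrow> Q v (chminA A (v vK) (ev v A p) (v vVAL)) kk"
  shows "wp R (chmin_prog p) Q v A k"
  using assms by (auto simp: chmin_prog_def wp_simps chminA_def)

context inst
begin

text \<open>The time bound uses \<open>blen (n div 2 ^ k')\<close>, the number of levels left, as a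
  potential. The range is empty at the latest when \<open>n div 2 ^ k'\<close> vanishes, because
  \<open>dyadic\<close> keeps the right end below it.\<close>

lemma insert_spec:
  fixes v :: vars and A :: arrs
  assumes v: "v vL = l" "v vR = r" "v vVAL = y" "v vK = tb" "0 < y" "r \<le> n" "tb + n + 1 < R"
    and U: "sound (tab A tb) U" "(l, r, y) \<in> U"
    and Q: "\<And>v' A' k'. sameV {vL, vR, vK} v v' \<Longrightarrow> sameA {aTAB} A A' \<Longrightarrow>
      (\<And>i. i < tb \<or> tb + n < i \<Longrightarrow> A' aTAB i = A aTAB i) \<Longrightarrow> sound (tab A' tb) U \<Longrightarrow>
      (\<And>i x. covered n (tab A tb) i x \<Longrightarrow> covered n (tab A' tb) i x) \<Longrightarrow>
      (\<And>i. l \<le> i \<Longrightarrow> i < r \<Longrightarrow> covered n (tab A' tb) i y) \<Longrightarrow>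
      k' \<le> k + 1 + 14 * blen n \<Longrightarrow> Q v' A' k'"
  shows "wp R insert_prog Q v A k"
proof -
  define I where "I = (\<lambda>k' v' A' c. v' vK = tb + k' \<and> dyadic n (tab A' tb) l r y k' (v' vL) (v' vR) \<and>
    sameV {vL, vR, vK} v v' \<and> sameA {aTAB} A A' \<and>
    (\<forall>i. i < tb \<or> tb + n < i \<longrightarrow> A' aTAB i = A aTAB i) \<and> sound (tab A' tb) U \<and>
    (\<forall>i x. covered n (tab A tb) i x \<longrightarrow> covered n (tab A' tb) i x) \<and>
    c + 14 * blen (n div 2 ^ k') \<le> k + 14 * blen n)"
  show ?thesis
    unfolding insert_prog_def
  proof (rule wp_loop[where I = I and x = 0 and g = "\<lambda>k. n - k"])
    show "I 0 v A k" unfolding I_def dyadic_def using v U by (auto simp: same_refl)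
  next
    fix k' v' A' c
    assume "I k' v' A' c"
    then show "bsafe R v' A' (Less (Var vL) (Var vR))" by simp
  next
    fix k' v' A' c
    assume I: "I k' v' A' c" and "\<not> bev v' A' (Less (Var vL) (Var vR))"
    then have "covered n (tab A' tb) i y" if "l \<le> i" "i < r" for i
      using that unfolding I_def dyadic_def by auto
    then show "Q v' A' (Suc c)" using I unfolding I_def by (intro Q) auto
  next
    fix k' v' A' c
    assume I0: "I k' v' A' c" and "bev v' A' (Less (Var vL) (Var vR))"
    then have I: "v' vK = tb + k'" "dyadic n (tab A' tb) l r y k' (v' vL) (v' vR)"
      "sameV {vL, vR, vK} v v'" "sameA {aTAB} A A'"
      "\<And>i. i < tb \<or> tb + n < i \<Longrightarrow> A' aTAB i = A aTAB i" "sound (tab A' tb) U"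
      "\<And>i x. covered n (tab A tb) i x \<Longrightarrow> covered n (tab A' tb) i x"
      "c + 14 * blen (n div 2 ^ k') \<le> k + 14 * blen n" and lt: "v' vL < v' vR"
      unfolding I_def by auto
    have pos: "0 < n div 2 ^ k'" using I(2) lt unfolding dyadic_def by linarith
    have k'n: "k' < n" using div_pow_less[OF pos] .
    have bl: "blen (n div 2 ^ k') = 1 + blen (n div 2 ^ Suc k')"
      using pos by (subst blen.simps) (simp add: div_mult2_eq[symmetric] mult.commute)
    have rn: "v' vR \<le> n" using I(2) unfolding dyadic_def by (meson div_le_dividend le_trans)
    have vy: "v' vVAL = y" using I(3) v by (simp add: sameV_def)
    define L1 where "L1 = (if odd (v' vL) then v' vL + 1 else v' vL)"
    define R1 where "R1 = (if odd (v' vR) then v' vR - 1 else v' vR)"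
    define A1 where "A1 = (if odd (v' vL) then chminA A' (tb + k') (v' vL) y else A')"
    define A2 where "A2 = (if odd (v' vR) then chminA A1 (tb + k') R1 y else A1)"
    have 1: "dyadic n (tab A1 tb) l r y k' L1 (v' vR)" "sound (tab A1 tb) U"
      using dyadic_left[OF I(2) lt _ v(5) I(6) U(2)] I(2,6) by (auto simp: A1_def L1_def tab_chminA)
    \<comment> \<open>If the right end is odd and the range is a single block, the left end is even,
      so the left step has not consumed the block that the right step enters.\<close>
    have L1R: "L1 < v' vR" if "odd (v' vR)"
      using lt that unfolding L1_def by (cases "v' vR = v' vL + 1") auto
    have 2: "dyadic n (tab A2 tb) l r y k' L1 R1" "sound (tab A2 tb) U"
      using dyadic_right[OF 1(1) L1R v(5) 1(2) U(2)] 1 by (auto simp: A2_def R1_def tab_chminA)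
    have 3: "dyadic n (tab A2 tb) l r y (Suc k') (L1 div 2) (R1 div 2)"
      by (rule dyadic_up[OF 2(1)]) (auto simp: L1_def R1_def)
    have rows: "A2 aTAB i = A aTAB i" if "i < tb \<or> tb + n < i" for i
      using I(5)[OF that] that k'n by (auto simp: A1_def A2_def chminA_row)
    have cov: "covered n (tab A2 tb) i x" if "covered n (tab A tb) i x" for i x
      using I(7)[OF that] by (auto simp: A1_def A2_def tab_chminA intro!: covered_chmin v(5))
    have sA: "sameA {aTAB} A A2" using I(4) by (auto simp: A1_def A2_def intro!: sameA_chminA)
    have I': "I (Suc k') (v'(vL := L1 div 2, vR := R1 div 2, vK := Suc (tb + k'))) A2 cc" if "cc \<le> c + 14" for cc
      unfolding I_def using 3 rows cov sA 2(2) I(3,8) bl that by (auto intro!: same_upd)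
    have W2: "wp R (Cond (Eq (Odd (Var vR)) one) (vR ::= Minus (Var vR) one ;; chmin_prog (Var vR)) Skip)
       (\<lambda>v'' A'' cc. v'' = v'(vL := L1, vR := R1) \<and> A'' = A2 \<and> cc \<le> c + 11) (v'(vL := L1)) A1 cc"
      if "cc \<le> c + 6" for cc
      using R_less I(1) that vy lt
      by (auto simp: wp_simps A2_def R1_def odd_iff_mod_2_eq_one intro!: wp_chmin)
    have W1: "wp R (Cond (Eq (Odd (Var vL)) one) (chmin_prog (Var vL) ;; vL ::= Plus (Var vL) one) Skip)
       (\<lambda>v'' A'' cc. v'' = v'(vL := L1) \<and> A'' = A1 \<and> cc \<le> c + 6) v' A' (Suc c)"
      using R_less I(1) rn lt vy
      by (auto simp: wp_simps A1_def L1_def odd_iff_mod_2_eq_one intro!: wp_chmin)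
    show "wp R level_prog (\<lambda>v' A' c. \<exists>x'. n - x' < n - k' \<and> I x' v' A' c) v' A' (Suc c)"
      unfolding level_prog_def wp_Seq_iff
    proof (rule wp_mono[OF W1], clarify)
      fix cc assume "cc \<le> c + 6"
      from W2[OF this] show "wp R (Cond (Eq (Odd (Var vR)) one) (vR ::= Minus (Var vR) one ;; chmin_prog (Var vR)) Skip)
         (wp R (vL ::= Half (Var vL)) (wp R (vR ::= Half (Var vR)) (wp R (vK ::= Plus (Var vK) one)
          (\<lambda>v' A' c. \<exists>x'. n - x' < n - k' \<and> I x' v' A' c)))) (v'(vL := L1)) A1 cc"
      proof (rule wp_mono, clarify)
        fix cc assume "cc \<le> c + 11"
        then show "wp R (vL ::= Half (Var vL)) (wp R (vR ::= Half (Var vR)) (wp R (vK ::= Plus (Var vK) one)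
          (\<lambda>v' A' c. \<exists>x'. n - x' < n - k' \<and> I x' v' A' c))) (v'(vL := L1, vR := R1)) A2 cc"
          using I' I(1) k'n R_less v(7)
          by (auto simp: wp_simps fun_upd_twist intro!: exI[of _ "Suc k'"])
      qed
    qed
  qed
qed

end

context bfs_tree
begin

lemma D_less_n: "D x \<noteq> 0 \<Longrightarrow> x < n"
  using Dpos[of x] qn by auto

lemma P_le:
  assumes "D x \<noteq> 0"
  shows "0 < P x" "D (P x - 1) \<noteq> 0" "P x \<le> n"
proof -
  obtain i where i: "x = q i" "i < cnt" using assms Dpos[of x] by auto
  have "0 < P x \<and> D (P x - 1) \<noteq> 0 \<and> P x \<le> n"
  proof (cases "i = 0")
    case True
    then show ?thesis using i q0 Ps Ds qn[of 0] cnt by auto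
  next
    case False
    then obtain j where j: "j < i" "P (q i) = q j + 1" using tree[of i] i by auto
    moreover have "D (q j) \<noteq> 0" using Dpos[of "q j"] i j by auto
    ultimately show ?thesis using i qn[of j] by auto
  qed
  then show "0 < P x" "D (P x - 1) \<noteq> 0" "P x \<le> n" by auto
qed

end

context bfs_path
begin

lemma J_le: "D x \<noteq> 0 \<Longrightarrow> J x \<le> len"
proof (induction rule: tree_induct)
  case root
  then show ?case using J[of s] Ds path_s len by simp
next
  case (step x)
  then show ?case using J[of x] by simp
qed

end

definition climb_prog :: com where
  "climb_prog =
    Put aOUT zero (Var vK) (Var vX) ;;
    vX ::= Minus (Get aPAR (Var vSA) (Var vX)) one ;;
    vK ::= Minus (Var vK) one"

definition path_prog :: com where
  "path_prog =
    vX ::= Var vT ;;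
    vK ::= Plus (Var vO) (Var vLEN) ;;
    While (Less (Var vO) (Var vK)) climb_prog"

text \<open>In queue order the parent's entry is ready. The cells \<open>vO + 1\<close> up to
  \<open>vO + vLEN\<close> of the output, just filled with the path, serve as the array of path
  vertices by depth.\<close>

definition branch_prog :: com where
  "branch_prog =
    vX ::= Get aQU (Var vSA) (Var vI) ;;
    vDX ::= Get aD (Var vSA) (Var vX) ;;
    Put aJ zero (Var vX) (Get aJ zero (Minus (Get aPAR (Var vSA) (Var vX)) one)) ;;
    Cond (Less (Var vDX) (Plus (Var vLEN) one))
      (Cond (Eq (Get aOUT zero (Plus (Var vO) (Var vDX))) (Var vX))
        (Put aJ zero (Var vX) (Var vDX)) Skip) Skip ;;
    vI ::= Plus (Var vI) one"

definition index_prog :: com where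
  "index_prog =
    vI ::= zero ;;
    vCN ::= Get aQN zero (Var vSA) ;;
    While (Less (Var vI) (Var vCN)) branch_prog"

text \<open>\<open>vSB\<close> selects the search from the target. Both labels are distances plus
  one, so subtracting one leaves d(s,x) + 1 + d(t,y).\<close>

definition interval_prog :: com where
  "interval_prog =
    Cond (Less zero (Var vZ))
      (vX ::= Minus (Var vZ) one ;;
       vL ::= Get aJ zero (Var vX) ;;
       vR ::= Get aJ zero (Var vY) ;;
       vVAL ::= Minus (Plus (Get aD (Var vSA) (Var vX)) (Get aD (Var vSB) (Var vY))) one ;;
       vK ::= Var vTB ;;
       insert_prog) Skip"

definition slot_prog :: com where
  "slot_prog =
    vZ ::= Get aFS (Var vSA) (Var vCJ) ;;
    interval_prog ;;
    vZ ::= Get aLS (Var vSA) (Var vCJ) ;;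
    interval_prog ;;
    vCJ ::= Plus (Var vCJ) one"

definition vertex_prog :: com where
  "vertex_prog =
    vY ::= Get aQU (Var vSA) (Var vI) ;;
    vCJ ::= Plus (Var vY) (Plus (Var vY) (Var vY)) ;;
    vCE ::= Plus (Var vCJ) (Num 3) ;;
    While (Less (Var vCJ) (Var vCE)) slot_prog"

definition intervals_prog :: com where
  "intervals_prog =
    vI ::= zero ;;
    While (Less (Var vI) (Var vCN)) (vertex_prog ;; vI ::= Plus (Var vI) one)"

definition lookup_prog :: com where
  "lookup_prog =
    Cond (Less zero (Get aTAB (Var vK) (Var vPOS)))
      (Cond (Less (Get aTAB (Var vK) (Var vPOS)) (Var vVAL))
        (vVAL ::= Get aTAB (Var vK) (Var vPOS)) Skip) Skip ;;
    vPOS ::= Half (Var vPOS) ;;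
    vLV ::= Half (Var vLV) ;;
    vK ::= Plus (Var vK) one"

text \<open>The start value \<open>n\<close> encodes infinity; halving a copy of \<open>n\<close>
  counts exactly the levels that an insertion can use.\<close>

definition query_prog :: com where
  "query_prog =
    vVAL ::= Var vN ;;
    vPOS ::= Var vI ;;
    vLV ::= Var vN ;;
    vK ::= Var vTB ;;
    While (Less zero (Var vLV)) lookup_prog"

definition answer_prog :: com where
  "answer_prog =
    query_prog ;;
    Put aOUT zero (Plus (Plus (Var vO) (Var vLEN)) (Var vI)) (Var vVAL) ;;
    vI ::= Plus (Var vI) one"

definition answers_prog :: com where
  "answers_prog =
    vI ::= one ;;
    While (Less (Var vI) (Var vLEN)) answer_prog"

text \<open>Advancing \<open>vTB\<close> hands rows that are still zero to the next pair. A nonempty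
  record takes \<open>2 * vLEN\<close> words: the length, that many vertices, and one distance
  fewer.\<close>

definition pair_prog :: com where
  "pair_prog =
    vLEN ::= Get aD (Var vSA) (Var vT) ;;
    Put aOUT zero (Var vO) (Var vLEN) ;;
    Cond (Less zero (Var vLEN))
      (path_prog ;; index_prog ;; intervals_prog ;; answers_prog ;;
       vO ::= Plus (Var vO) (Plus (Var vLEN) (Var vLEN)) ;;
       vTB ::= Plus (Var vTB) (Plus (Var vN) one))
      (vO ::= Plus (Var vO) one)"

text \<open>Being attained, unless it is the default \<open>n\<close>, will bound the distance from
  above; lying below all covering values will bound it from below.\<close>

definition query_result :: "nat \<Rightarrow> (nat \<Rightarrow> nat \<Rightarrow> nat) \<Rightarrow> nat \<Rightarrow> nat \<Rightarrow> bool" where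
  "query_result n T i x \<longleftrightarrow> x \<le> n \<and> (x < n \<longrightarrow> x \<noteq> 0 \<and> (\<exists>k. T k (i div 2 ^ k) = x)) \<and>
     (\<forall>y. covered n T i y \<longrightarrow> x \<le> y)"

locale source_pair = inst n E es ss R + S: bfs n E s cnt q D P F L + T: bfs n E t cnt' q' D' P' F' L'
  for n E es ss R s cnt q D P F L t cnt' q' D' P' F' L' +
  fixes a b ob tb len :: nat
  assumes len: "len = D t" "0 < len" and room: "ob + 2 * n + 2 < R" "tb + n + 1 < R"
begin

definition rows :: "arrs \<Rightarrow> bool" where
  "rows A \<longleftrightarrow> A aQU a = q \<and> A aD a = D \<and> A aPAR a = P \<and> A aFS a = F \<and> A aLS a = L \<and> A aD b = D' \<and>
     A aQN 0 a = cnt"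

definition params :: "vars \<Rightarrow> bool" where
  "params v \<longleftrightarrow> v vN = n \<and> v vSA = a \<and> v vSB = b \<and> v vT = t \<and> v vO = ob \<and> v vTB = tb \<and> v vLEN = len"

lemma rows_same: "rows A \<Longrightarrow> sameA X A A' \<Longrightarrow> X \<subseteq> {aOUT, aJ, aTAB} \<Longrightarrow> rows A'"
  unfolding rows_def sameA_def by auto

lemma params_same: "params v \<Longrightarrow> sameV X v v' \<Longrightarrow> X \<inter> {vN, vSA, vSB, vT, vO, vTB, vLEN} = {} \<Longrightarrow> params v'"
  unfolding params_def sameV_def by auto

definition pth :: "nat \<Rightarrow> nat" where
  "pth i = (S.pa ^^ (len - i)) t"

lemma len_le: "len \<le> n"
  using S.D_le len by simp

lemma pa_Suc: "P x - Suc 0 = S.pa x"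
  by (simp add: S.pa_def)

lemma path_spec:
  assumes v: "params v" and A: "rows A"
    and Q: "\<And>v' A' k'. sameV {vX, vK} v v' \<Longrightarrow> sameA {aOUT} A A' \<Longrightarrow>
      (\<And>j. j \<le> ob \<or> ob + len < j \<Longrightarrow> A' aOUT 0 j = A aOUT 0 j) \<Longrightarrow>
      (\<And>i. 1 \<le> i \<Longrightarrow> i \<le> len \<Longrightarrow> A' aOUT 0 (ob + i) = pth i) \<Longrightarrow> k' \<le> k + 3 + 4 * n \<Longrightarrow> Q v' A' k'"
  shows "wp R path_prog Q v A k"
proof -
  define I where "I = (\<lambda>j v' A' k'. j \<le> len \<and> v' vK = ob + (len - j) \<and> v' vX = (S.pa ^^ j) t \<and>
    sameV {vX, vK} v v' \<and> sameA {aOUT} A A' \<and>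
    (\<forall>j. j \<le> ob \<or> ob + len < j \<longrightarrow> A' aOUT 0 j = A aOUT 0 j) \<and>
    (\<forall>i. len - j < i \<and> i \<le> len \<longrightarrow> A' aOUT 0 (ob + i) = pth i) \<and> k' \<le> k + 2 + 4 * j)"
  have reach: "D ((S.pa ^^ j) t) \<noteq> 0" for j
    using len S.P_le(2) by (induction j) (auto simp: S.pa_def)
  have loop: "wp R (While (Less (Var vO) (Var vK)) climb_prog) Q v0 A0 k0" if "I 0 v0 A0 k0" for v0 A0 k0
  proof (rule wp_loop[where I = I and x = 0 and g = "\<lambda>j. len - j"])
    show "I 0 v0 A0 k0" by fact
  next
    fix j v' A' k'
    assume "I j v' A' k'"
    then show "bsafe R v' A' (Less (Var vO) (Var vK))" by simp
  next
    fix j v' A' k'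
    assume I: "I j v' A' k'" and n: "\<not> bev v' A' (Less (Var vO) (Var vK))"
    have "v' vO = ob" using I v by (simp add: I_def params_def sameV_def)
    moreover have "j \<le> len" "v' vK = ob + (len - j)" using I by (simp_all add: I_def)
    ultimately have "j = len" using n by simp
    then show "Q v' A' (Suc k')" using I len_le unfolding I_def by (intro Q) auto
  next
    fix j v' A' k'
    assume I0: "I j v' A' k'" and n: "bev v' A' (Less (Var vO) (Var vK))"
    then have I: "v' vK = ob + (len - j)" "v' vX = (S.pa ^^ j) t"
      "sameV {vX, vK} v v'" "sameA {aOUT} A A'"
      "\<And>j. j \<le> ob \<or> ob + len < j \<Longrightarrow> A' aOUT 0 j = A aOUT 0 j"
      "\<And>i. len - j < i \<Longrightarrow> i \<le> len \<Longrightarrow> A' aOUT 0 (ob + i) = pth i" "k' \<le> k + 2 + 4 * j"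
      unfolding I_def by auto
    have vs: "v' vO = ob" "v' vSA = a" using I(3) v by (simp_all add: params_def sameV_def)
    then have j: "j < len" using I(1) n by simp
    have rA: "A' aPAR a = P" using rows_same[OF A I(4)] by (simp add: rows_def)
    have pj: "pth (len - j) = (S.pa ^^ j) t" using j by (simp add: pth_def)
    let ?A = "upd A' aOUT 0 (ob + (len - j)) ((S.pa ^^ j) t)"
    have "?A aOUT 0 (ob + i) = pth i" if "len - Suc j < i" "i \<le> len" for i
      using I(6)[of i] that pj by (cases "i = len - j") (auto simp: upd_simps)
    moreover have "?A aOUT 0 i = A aOUT 0 i" if "i \<le> ob \<or> ob + len < i" for i
      using I(5)[OF that] that j by (auto simp: upd_simps)
    ultimately have "I (Suc j) (v'(vX := S.pa ((S.pa ^^ j) t), vK := ob + (len - Suc j))) ?A kk"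
      if "kk \<le> k' + 4" for kk
      unfolding I_def using j I(3,4,7) that by (auto intro!: same_upd)
    then show "wp R climb_prog (\<lambda>v' A' k'. \<exists>x'. len - x' < len - j \<and> I x' v' A' k') v' A' (Suc k')"
      using j R_less S.P_le(1)[OF reach[of j]]
      by (auto simp: climb_prog_def wp_simps upd_simps pa_Suc I(1,2) rA vs intro!: exI[of _ "Suc j"])
  qed
  have "I 0 (v(vX := t, vK := ob + len)) A (Suc (Suc k))"
    unfolding I_def by (auto simp: same_upd same_refl)
  from loop[OF this] show ?thesis
    unfolding path_prog_def using v R_less room len_le by (simp add: wp_simps params_def)
qed

definition index_eq :: "(nat \<Rightarrow> nat) \<Rightarrow> nat \<Rightarrow> bool" where
  "index_eq J x \<longleftrightarrow> J x = (if D x \<le> len \<and> pth (D x) = x then D x else J (S.pa x))"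

lemma pth_1: "pth 1 = s"
  using S.pa_pow[of t "len - 1"] S.D1[of "pth 1"] len unfolding pth_def by simp

lemma index_spec:
  assumes v: "params v" and A: "rows A"
    and p: "\<And>i. 1 \<le> i \<Longrightarrow> i \<le> len \<Longrightarrow> A aOUT 0 (ob + i) = pth i"
    and Q: "\<And>v' A' k'. sameV {vI, vCN, vX, vDX} v v' \<Longrightarrow> sameA {aJ} A A' \<Longrightarrow> v' vCN = cnt \<Longrightarrow>
      (\<And>x. D x \<noteq> 0 \<Longrightarrow> index_eq (A' aJ 0) x) \<Longrightarrow> k' \<le> k + 3 + 8 * n \<Longrightarrow> Q v' A' k'"
  shows "wp R index_prog Q v A k"
proof -
  define I where "I = (\<lambda>i v' A' k'. i \<le> cnt \<and> v' vI = i \<and> v' vCN = cnt \<and> 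
    sameV {vI, vCN, vX, vDX} v v' \<and> sameA {aJ} A A' \<and>
    (\<forall>i'<i. index_eq (A' aJ 0) (q i')) \<and> k' \<le> k + 2 + 8 * i)"
  have loop: "wp R (While (Less (Var vI) (Var vCN)) branch_prog) Q v0 A0 k0" if "I 0 v0 A0 k0" for v0 A0 k0
  proof (rule wp_loop[where I = I and x = 0 and g = "\<lambda>i. cnt - i"])
    show "I 0 v0 A0 k0" by fact
  next
    fix i v' A' k'
    assume "I i v' A' k'"
    then show "bsafe R v' A' (Less (Var vI) (Var vCN))" by simp
  next
    fix i v' A' k'
    assume I: "I i v' A' k'" and n: "\<not> bev v' A' (Less (Var vI) (Var vCN))"
    have "index_eq (A' aJ 0) x" if "D x \<noteq> 0" for x
      using I n that S.Dpos[of x] by (auto simp: I_def)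
    then show "Q v' A' (Suc k')" using I S.cnt_le unfolding I_def by (intro Q) auto
  next
    fix i v' A' k'
    assume I0: "I i v' A' k'" and n: "bev v' A' (Less (Var vI) (Var vCN))"
    then have I: "i < cnt" "v' vI = i" "v' vCN = cnt"
      "sameV {vI, vCN, vX, vDX} v v'" "sameA {aJ} A A'"
      "\<And>i'. i' < i \<Longrightarrow> index_eq (A' aJ 0) (q i')" "k' \<le> k + 2 + 8 * i"
      unfolding I_def by auto
    have vs: "v' vO = ob" "v' vSA = a" "v' vLEN = len" using I(4) v by (simp_all add: params_def sameV_def)
    have rA: "A' aPAR a = P" "A' aD a = D" "A' aQU a = q" using rows_same[OF A I(5)] by (simp_all add: rows_def)
    have OUT: "A' aOUT = A aOUT" using I(5) by (simp add: sameA_def)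
    let ?x = "q i"
    have Dx: "D ?x \<noteq> 0" using S.Dq[OF I(1)] by simp
    note pO = p[of "D ?x"]
    let ?c = "if D ?x \<le> len \<and> pth (D ?x) = ?x then D ?x else A' aJ 0 (S.pa ?x)"
    let ?J = "(A' aJ 0)(?x := ?c)"
    have old: "q i' \<noteq> ?x" if "i' < i" for i'
      using S.inj I(1) that by (auto simp: inj_on_def)
    \<comment> \<open>Writing the entry of \<open>?x\<close> must not disturb an entry that other
      vertices inherit. Only the root is its own parent, and it lies on the path, so its entry is
      its depth and a stale value is overwritten.\<close>
    have pa_old: "S.pa (q i') \<noteq> ?x \<or> i = 0 \<and> i' = 0" if i': "i' \<le> i" for i'
    proof (cases "i' = 0")
      case True
      then have "S.pa (q i') = s" using S.q0 S.Ps by (simp add: S.pa_def)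
      then show ?thesis using old[of 0] True S.q0 by (cases "i = 0") auto
    next
      case False
      then obtain j where "j < i'" "S.pa (q i') = q j" using S.pa_tree[of i'] i' I(1) by auto
      then show ?thesis using old[of j] i' by auto
    qed
    have new: "index_eq ?J (q i')" if "i' < Suc i" for i'
    proof (cases "i' = i")
      case True
      show ?thesis
      proof (cases "i = 0")
        case True
        then have "q i = s" using S.q0 by simp
        then show ?thesis using \<open>i' = i\<close> pth_1 S.Ds len(2) by (simp add: index_eq_def)
      next
        case False
        then show ?thesis using \<open>i' = i\<close> pa_old[of i] by (auto simp: index_eq_def)
      qed
    next
      case False
      then show ?thesis using that I(6)[of i'] old[of i'] pa_old[of i'] by (auto simp: index_eq_def)
    qed
    have fin: "I (Suc i) (v'(vX := ?x, vDX := D ?x, vI := Suc i)) A'' kk"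
      if "kk \<le> k' + 8" "sameA {aJ} A A''" "A'' aJ 0 = ?J" for A'' kk
      unfolding I_def using I(1,3,4,7) new that by (auto intro!: same_upd)
    have A1: "sameA {aJ} A (upd A' aJ 0 ?x (A' aJ 0 (S.pa ?x)))"
      "sameA {aJ} A (upd (upd A' aJ 0 ?x (A' aJ 0 (S.pa ?x))) aJ 0 ?x (D ?x))"
      using I(5) by (auto intro!: same_upd)
    show "wp R branch_prog (\<lambda>v' A' k'. \<exists>x'. cnt - x' < cnt - i \<and> I x' v' A' k') v' A' (Suc k')"
      using I(1) R_less S.P_le(1)[OF Dx] S.cnt_le len_le Dx room A1
      by (auto simp: branch_prog_def wp_simps upd_simps pa_Suc rA vs I(2) OUT pO intro!: exI[of _ "Suc i"] fin)
  qed
  have "I 0 (v(vI := 0, vCN := cnt)) A (Suc (Suc k))"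
    unfolding I_def by (auto simp: same_upd same_refl)
  from loop[OF this] show ?thesis
    unfolding index_prog_def using v A R_less by (simp add: wp_simps params_def rows_def)
qed

text \<open>The interval of path positions for which a slot neighbour \<open>x\<close> of \<open>y\<close> gives a replacement path.\<close>

definition ivals :: "(nat \<Rightarrow> nat) \<Rightarrow> (nat \<times> nat \<times> nat) set" where
  "ivals J = {(J x, J y, D x + D' y - 1) | x y. S.slot y x}"

text \<open>Insertions only improve coverage; this preorder lets \<open>served\<close>, once
  established, persist through all later insertions.\<close>

definition grown :: "(nat \<times> nat \<times> nat) set \<Rightarrow> arrs \<Rightarrow> arrs \<Rightarrow> bool" where
  "grown U A A' \<longleftrightarrow> sameA {aTAB} A A' \<and> (\<forall>i. i < tb \<or> tb + n < i \<longrightarrow> A' aTAB i = A aTAB i) \<and>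
     sound (tab A' tb) U \<and> (\<forall>i x. covered n (tab A tb) i x \<longrightarrow> covered n (tab A' tb) i x)"

lemma grown_refl: "sound (tab A tb) U \<Longrightarrow> grown U A A"
  by (simp add: grown_def same_refl)

lemma grown_trans: "grown U A A' \<Longrightarrow> grown U A' A'' \<Longrightarrow> grown U A A''"
  unfolding grown_def sameA_def by auto

definition served :: "arrs \<Rightarrow> (nat \<Rightarrow> nat) \<Rightarrow> nat \<Rightarrow> nat \<Rightarrow> bool" where
  "served A J x y \<longleftrightarrow> (\<forall>i. J x \<le> i \<and> i < J y \<longrightarrow> covered n (tab A tb) i (D x + D' y - 1))"

lemma served_grown: "served A J x y \<Longrightarrow> grown U A A' \<Longrightarrow> served A' J x y"
  unfolding served_def grown_def by blast

text \<open>Edges are undirected and \<open>t\<close> is reached from \<open>s\<close>, so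
  \<open>t\<close> reaches \<open>x\<close> by way of \<open>s\<close>. Hence
  \<open>D' y - 1\<close> is a true distance for every candidate.\<close>

lemma reach_both: "D x \<noteq> 0 \<Longrightarrow> D' x \<noteq> 0"
proof -
  assume "D x \<noteq> 0"
  then have "(s, x) \<in> adj E ^^ (D x - 1)" by (rule S.root_walk)
  moreover have "(t, s) \<in> adj E ^^ (D t - 1)"
    using S.root_walk[of t] len by (auto intro: adj_pow_sym)
  ultimately have "(t, x) \<in> adj E ^^ (D t - 1 + (D x - 1))" by (rule relpow_trans[rotated])
  then show "D' x \<noteq> 0" using T.walk_D by blast
qed

lemma slot_D: "S.slot y x \<Longrightarrow> D y \<noteq> 0 \<and> D x \<noteq> 0"
  using S.slots unfolding S.slot_def by blast

lemma interval_spec: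
  assumes v: "params v" "v vZ = z" "v vY = y" and A: "rows A" "A aJ 0 = J"
    and z: "z \<noteq> 0 \<Longrightarrow> S.slot y (z - 1)" and J: "\<And>x. D x \<noteq> 0 \<Longrightarrow> J x \<le> n"
    and U: "sound (tab A tb) (ivals J)"
    and Q: "\<And>v' A' k'. sameV {vX, vL, vR, vVAL, vK} v v' \<Longrightarrow> grown (ivals J) A A' \<Longrightarrow>
      (z \<noteq> 0 \<Longrightarrow> served A' J (z - 1) y) \<Longrightarrow> k' \<le> k + 8 + 14 * blen n \<Longrightarrow> Q v' A' k'"
  shows "wp R interval_prog Q v A k"
proof (cases "z = 0")
  case True
  then show ?thesis
    unfolding interval_prog_def using v R_less
    by (auto simp: wp_simps intro!: Q same_refl grown_refl[OF U])
next
  case False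
  let ?x = "z - 1"
  note sl = z[OF False]
  have Dxy: "D y \<noteq> 0" "D ?x \<noteq> 0" "D' y \<noteq> 0" using slot_D[OF sl] reach_both by auto
  let ?val = "D ?x + D' y - 1"
  have U': "(J ?x, J y, ?val) \<in> ivals J" unfolding ivals_def using sl by blast
  let ?v = "v(vX := ?x, vL := J ?x, vR := J y, vVAL := ?val, vK := tb)"
  have "wp R insert_prog Q ?v A (Suc (Suc (Suc (Suc (Suc (Suc k))))))"
  proof (rule insert_spec[where l = "J ?x" and r = "J y" and y = ?val and tb = tb and U = "ivals J"])
    fix v' A' k'
    assume a: "sameV {vL, vR, vK} ?v v'" "sameA {aTAB} A A'"
      "\<And>i. i < tb \<or> tb + n < i \<Longrightarrow> A' aTAB i = A aTAB i" "sound (tab A' tb) (ivals J)"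
      "\<And>i x. covered n (tab A tb) i x \<Longrightarrow> covered n (tab A' tb) i x"
      "\<And>i. J ?x \<le> i \<Longrightarrow> i < J y \<Longrightarrow> covered n (tab A' tb) i ?val"
      "k' \<le> Suc (Suc (Suc (Suc (Suc (Suc k))))) + 1 + 14 * blen n"
    have "sameV {vX, vL, vR, vVAL, vK} v v'" using a(1) by (simp add: sameV_def)
    moreover have "grown (ivals J) A A'" unfolding grown_def using a by blast
    moreover have "served A' J ?x y" unfolding served_def using a(6) by blast
    ultimately show "Q v' A' k'" using a(7) by (intro Q) auto
  qed (use Dxy J U U' room in auto)
  then show ?thesis
    unfolding interval_prog_def using False v A R_less Dxy S.D_le[of ?x] T.D_le[of y]
    by (simp add: wp_simps params_def rows_def)
qed

text \<open>Three offsets with a first and a last neighbour each make six insertions, which explains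
  \<open>84 = 6 * 14\<close>.\<close>

lemma vertex_spec:
  assumes v: "params v" "v vI = i" "i < cnt" and A: "rows A" "A aJ 0 = J"
    and J: "\<And>x. D x \<noteq> 0 \<Longrightarrow> J x \<le> n" and U: "sound (tab A tb) (ivals J)"
    and Q: "\<And>v' A' k'. sameV {vX, vL, vR, vVAL, vK, vY, vCJ, vCE, vZ} v v' \<Longrightarrow> grown (ivals J) A A' \<Longrightarrow>
      (\<And>x. S.slot (q i) x \<Longrightarrow> served A' J x (q i)) \<Longrightarrow> k' \<le> k + 70 + 84 * blen n \<Longrightarrow> Q v' A' k'"
  shows "wp R vertex_prog Q v A k"
proof -
  let ?y = "q i"
  let ?X = "{vX, vL, vR, vVAL, vK, vY, vCJ, vCE, vZ}"
  have Dy: "D ?y \<noteq> 0" using S.Dq[OF v(3)] by simp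
  have yn: "?y < n" using S.D_less_n[OF Dy] .
  define I where "I = (\<lambda>c v' A' k'. c \<le> 3 \<and> v' vCJ = 3 * ?y + c \<and> v' vCE = 3 * ?y + 3 \<and> v' vY = ?y \<and>
    sameV ?X v v' \<and> grown (ivals J) A A' \<and>
    (\<forall>c'<c. \<forall>x. F (3 * ?y + c') = x + 1 \<or> L (3 * ?y + c') = x + 1 \<longrightarrow> served A' J x ?y) \<and>
    k' \<le> k + 4 + c * (20 + 28 * blen n))"
  have loop: "wp R (While (Less (Var vCJ) (Var vCE)) slot_prog) Q v0 A0 k0" if "I 0 v0 A0 k0" for v0 A0 k0
  proof (rule wp_loop[where I = I and x = 0 and g = "\<lambda>c. 3 - c"])
    show "I 0 v0 A0 k0" by fact
  next
    fix c v' A' k'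
    assume "I c v' A' k'"
    then show "bsafe R v' A' (Less (Var vCJ) (Var vCE))" by simp
  next
    fix c v' A' k'
    assume I: "I c v' A' k'" and n: "\<not> bev v' A' (Less (Var vCJ) (Var vCE))"
    then have c: "c = 3" by (auto simp: I_def)
    have "served A' J x ?y" if "S.slot ?y x" for x
      using I that unfolding I_def c S.slot_def by blast
    then show "Q v' A' (Suc k')" using I unfolding I_def c by (intro Q) auto
  next
    fix c v' A' k'
    assume I0: "I c v' A' k'" and n: "bev v' A' (Less (Var vCJ) (Var vCE))"
    then have I: "c < 3" "v' vCJ = 3 * ?y + c" "v' vCE = 3 * ?y + 3" "v' vY = ?y"
      "sameV ?X v v'" "grown (ivals J) A A'"
      "\<And>c' x. c' < c \<Longrightarrow> F (3 * ?y + c') = x + 1 \<or> L (3 * ?y + c') = x + 1 \<Longrightarrow> served A' J x ?y"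
      "k' \<le> k + 4 + c * (20 + 28 * blen n)"
      unfolding I_def by auto
    have g: "rows B \<and> B aJ 0 = J \<and> sound (tab B tb) (ivals J)" if "grown (ivals J) A B" for B
      using that A rows_same[OF A(1), of "{aTAB}" B] unfolding grown_def by (auto simp: sameA_def)
    have par: "params v''" if "sameV ?X v v''" for v''
      using params_same[OF v(1) that] by simp
    let ?j = "3 * ?y + c"
    have sl: "S.slot ?y (F ?j - 1)" if "F ?j \<noteq> 0" unfolding S.slot_def using that I(1) Dy by (auto intro!: exI[of _ c])
    have sl2: "S.slot ?y (L ?j - 1)" if "L ?j \<noteq> 0" unfolding S.slot_def using that I(1) Dy by (auto intro!: exI[of _ c])
    have fin: "\<exists>c'. 3 - c' < 3 - c \<and> I c' (v''(vCJ := Suc (v'' vCJ))) B (Suc kk)"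
      if "sameV ?X v v''" "v'' vCJ = ?j" "v'' vCE = 3 * ?y + 3" "v'' vY = ?y" "grown (ivals J) A B" "grown (ivals J) A' B"
        "F ?j \<noteq> 0 \<Longrightarrow> served B J (F ?j - 1) ?y" "L ?j \<noteq> 0 \<Longrightarrow> served B J (L ?j - 1) ?y"
        "kk \<le> k' + 19 + 28 * blen n" for v'' B kk
    proof -
      note FL = that(6-8)
      have "served B J x ?y" if "c' < Suc c" "F (3 * ?y + c') = x + 1 \<or> L (3 * ?y + c') = x + 1" for c' x
      proof (cases "c' = c")
        case True
        then show ?thesis using that(2) FL(2,3) by auto
      next
        case False
        then show ?thesis using that I(7)[of c' x] served_grown FL(1) by auto
      qed
      then have "I (Suc c) (v''(vCJ := Suc (v'' vCJ))) B (Suc kk)"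
        unfolding I_def using that I(1,8) by (auto intro!: same_upd)
      then show ?thesis using I(1) by (intro exI[of _ "Suc c"]) auto
    qed
    let ?Q = "\<lambda>v' A' k'. \<exists>c'. 3 - c' < 3 - c \<and> I c' v' A' k'"
    have W2: "wp R interval_prog (wp R (vCJ ::= Plus (Var vCJ) one) ?Q) (v''(vZ := L ?j)) B kk"
      if "sameV ?X v v''" "v'' vCJ = ?j" "v'' vCE = 3 * ?y + 3" "v'' vY = ?y" "grown (ivals J) A B" "grown (ivals J) A' B"
        "F ?j \<noteq> 0 \<Longrightarrow> served B J (F ?j - 1) ?y" "kk \<le> k' + 11 + 14 * blen n" for v'' B kk
    proof (rule interval_spec[where z = "L ?j" and y = ?y and J = J])
      show "params (v''(vZ := L ?j))" using par that(1) by (auto intro!: same_upd)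
      show "rows B" "B aJ 0 = J" "sound (tab B tb) (ivals J)" using g[OF that(5)] by auto
      fix v3 A3 k3
      assume a: "sameV {vX, vL, vR, vVAL, vK} (v''(vZ := L ?j)) v3" "grown (ivals J) B A3"
        "L ?j \<noteq> 0 \<Longrightarrow> served A3 J (L ?j - 1) ?y" "k3 \<le> kk + 8 + 14 * blen n"
      have s3: "sameV ?X v v3" "v3 vCJ = ?j" "v3 vCE = 3 * ?y + 3" "v3 vY = ?y"
        using a(1) that(1-4) by (auto simp: sameV_def)
      have "?Q (v3(vCJ := Suc (v3 vCJ))) A3 (Suc k3)"
        by (rule fin[OF s3 grown_trans[OF that(5) a(2)] grown_trans[OF that(6) a(2)]])
          (use a served_grown that(7,8) in auto)
      then show "wp R (vCJ ::= Plus (Var vCJ) one) ?Q v3 A3 k3"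
        using s3 I(1) yn R_less by (simp add: wp_simps)
    qed (use sl2 J that in auto)
    have "wp R interval_prog (wp R (vZ ::= Get aLS (Var vSA) (Var vCJ)) (wp R interval_prog
        (wp R (vCJ ::= Plus (Var vCJ) one) ?Q))) (v'(vZ := F ?j)) A' (Suc (Suc k'))"
    proof (rule interval_spec[where z = "F ?j" and y = ?y and J = J])
      show "params (v'(vZ := F ?j))" using par I(5) by (auto intro!: same_upd)
      show "rows A'" "A' aJ 0 = J" "sound (tab A' tb) (ivals J)" using g[OF I(6)] by auto
      fix v3 A3 k3
      assume a: "sameV {vX, vL, vR, vVAL, vK} (v'(vZ := F ?j)) v3" "grown (ivals J) A' A3"
        "F ?j \<noteq> 0 \<Longrightarrow> served A3 J (F ?j - 1) ?y" "k3 \<le> Suc (Suc k') + 8 + 14 * blen n"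
      have s3: "sameV ?X v v3" "v3 vCJ = ?j" "v3 vCE = 3 * ?y + 3" "v3 vY = ?y"
        using a(1) I(2-5) by (auto simp: sameV_def)
      have gA: "grown (ivals J) A A3" using grown_trans[OF I(6) a(2)] .
      have "A3 aLS a = L" "v3 vSA = a" using g[OF gA] par[OF s3(1)] by (auto simp: rows_def params_def)
      moreover have "wp R interval_prog (wp R (vCJ ::= Plus (Var vCJ) one) ?Q) (v3(vZ := L ?j)) A3 (Suc k3)"
        using W2[OF s3 gA a(2,3)] a(4) by simp
      ultimately show "wp R (vZ ::= Get aLS (Var vSA) (Var vCJ)) (wp R interval_prog
        (wp R (vCJ ::= Plus (Var vCJ) one) ?Q)) v3 A3 k3"
        using s3 by (simp add: wp_Assign_iff)
    qed (use sl J I in auto)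
    moreover have "A' aFS a = F" "v' vSA = a" using g[OF I(6)] par[OF I(5)] by (auto simp: rows_def params_def)
    ultimately show "wp R slot_prog ?Q v' A' (Suc k')"
      unfolding slot_prog_def wp_Seq_iff wp_Assign_iff[of R vZ "Get aFS (Var vSA) (Var vCJ)"] using I(2) by simp
  qed
  have "I 0 (v(vY := ?y, vCJ := ?y + (?y + ?y), vCE := 3 * ?y + 3)) A (Suc (Suc (Suc k)))"
    unfolding I_def using grown_refl[OF U] by (auto simp: same_refl intro!: same_upd)
  from loop[OF this] show ?thesis
    unfolding vertex_prog_def using v A R_less yn by (simp add: wp_simps params_def rows_def)
qed

lemma intervals_spec:
  assumes v: "params v" "v vCN = cnt" and A: "rows A" "A aJ 0 = J"
    and J: "\<And>x. D x \<noteq> 0 \<Longrightarrow> J x \<le> n" and U: "sound (tab A tb) (ivals J)"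
    and Q: "\<And>v' A' k'. sameV {vX, vL, vR, vVAL, vK, vY, vCJ, vCE, vZ, vI} v v' \<Longrightarrow> grown (ivals J) A A' \<Longrightarrow>
      (\<And>x y. S.slot y x \<Longrightarrow> served A' J x y) \<Longrightarrow> k' \<le> k + 2 + n * (72 + 84 * blen n) \<Longrightarrow> Q v' A' k'"
  shows "wp R intervals_prog Q v A k"
proof -
  let ?X = "{vX, vL, vR, vVAL, vK, vY, vCJ, vCE, vZ, vI}"
  define I where "I = (\<lambda>i v' A' k'. i \<le> cnt \<and> v' vI = i \<and> sameV ?X v v' \<and> grown (ivals J) A A' \<and>
    (\<forall>i'<i. \<forall>x. S.slot (q i') x \<longrightarrow> served A' J x (q i')) \<and> k' \<le> k + 1 + i * (72 + 84 * blen n))"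
  have loop: "wp R (While (Less (Var vI) (Var vCN)) (vertex_prog ;; vI ::= Plus (Var vI) one)) Q v0 A0 k0"
    if "I 0 v0 A0 k0" for v0 A0 k0
  proof (rule wp_loop[where I = I and x = 0 and g = "\<lambda>i. cnt - i"])
    show "I 0 v0 A0 k0" by fact
  next
    fix i v' A' k'
    assume "I i v' A' k'"
    then show "bsafe R v' A' (Less (Var vI) (Var vCN))" by simp
  next
    fix i v' A' k'
    assume I: "I i v' A' k'" and n: "\<not> bev v' A' (Less (Var vI) (Var vCN))"
    have "v' vCN = cnt" using I v(2) by (simp add: I_def sameV_def)
    then have i: "i = cnt" using I n by (simp add: I_def)
    have "served A' J x y" if "S.slot y x" for x y
      using slot_D[OF that] I that S.Dpos[of y] unfolding I_def i by auto
    moreover have "Suc k' \<le> k + 2 + n * (72 + 84 * blen n)"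
    proof -
      have "cnt * (72 + 84 * blen n) \<le> n * (72 + 84 * blen n)"
        using S.cnt_le by (rule mult_le_mono1)
      moreover have "k' \<le> k + 1 + cnt * (72 + 84 * blen n)" using I by (simp add: I_def i)
      ultimately show ?thesis by linarith
    qed
    ultimately show "Q v' A' (Suc k')" using I unfolding I_def i by (intro Q) auto
  next
    fix i v' A' k'
    assume I0: "I i v' A' k'" and n: "bev v' A' (Less (Var vI) (Var vCN))"
    have "v' vCN = cnt" using I0 v(2) by (simp add: I_def sameV_def)
    then have I: "i < cnt" "v' vI = i" "sameV ?X v v'" "grown (ivals J) A A'"
      "\<And>i' x. i' < i \<Longrightarrow> S.slot (q i') x \<Longrightarrow> served A' J x (q i')" "k' \<le> k + 1 + i * (72 + 84 * blen n)"
      using I0 n unfolding I_def by auto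
    have g: "rows A'" "A' aJ 0 = J" "sound (tab A' tb) (ivals J)"
      using I(4) A rows_same[OF A(1), of "{aTAB}" A'] unfolding grown_def by (auto simp: sameA_def)
    have par: "params v'" using params_same[OF v(1) I(3)] by simp
    show "wp R (vertex_prog ;; vI ::= Plus (Var vI) one) (\<lambda>v' A' k'. \<exists>x'. cnt - x' < cnt - i \<and> I x' v' A' k') v' A' (Suc k')"
      unfolding wp_Seq_iff
    proof (rule vertex_spec[OF par I(2,1) g(1,2) J g(3)])
      fix v'' A'' k''
      assume a: "sameV {vX, vL, vR, vVAL, vK, vY, vCJ, vCE, vZ} v' v''" "grown (ivals J) A' A''"
        "\<And>x. S.slot (q i) x \<Longrightarrow> served A'' J x (q i)" "k'' \<le> Suc k' + 70 + 84 * blen n"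
      have vi: "v'' vI = i" using a(1) I(2) by (simp add: sameV_def)
      have sv: "sameV ?X v v''" using sameV_trans[OF I(3) a(1), of ?X] by simp
      have "served A'' J x (q i')" if "i' < Suc i" "S.slot (q i') x" for i' x
        using that a(3) I(5)[of i' x] served_grown[OF _ a(2)] by (cases "i' = i") auto
      then have "I (Suc i) (v''(vI := Suc i)) A'' (Suc k'')"
        unfolding I_def using I(1,6) sv grown_trans[OF I(4) a(2)] a(4) by (auto intro!: same_upd)
      then show "wp R (vI ::= Plus (Var vI) one) (\<lambda>v' A' k'. \<exists>x'. cnt - x' < cnt - i \<and> I x' v' A' k') v'' A'' k''"
        using I(1) S.cnt_le R_less by (auto simp: wp_simps vi intro!: exI[of _ "Suc i"])
    qed
  qed
  have "I 0 (v(vI := 0)) A (Suc k)"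
    unfolding I_def using grown_refl[OF U] by (auto simp: same_refl intro!: same_upd)
  from loop[OF this] show ?thesis
    unfolding intervals_prog_def using R_less by (simp add: wp_simps)
qed

lemma query_spec:
  assumes v: "params v" "v vI = i"
    and Q: "\<And>v' k'. sameV {vVAL, vPOS, vLV, vK} v v' \<Longrightarrow> query_result n (tab A tb) i (v' vVAL) \<Longrightarrow>
      k' \<le> k + 5 + 7 * blen n \<Longrightarrow> Q v' A k'"
  shows "wp R query_prog Q v A k"
proof -
  let ?X = "{vVAL, vPOS, vLV, vK}"
  let ?T = "tab A tb"
  define I where "I = (\<lambda>l v' A' k'. A' = A \<and> v' vK = tb + l \<and> v' vPOS = i div 2 ^ l \<and> v' vLV = n div 2 ^ l \<and>
    sameV ?X v v' \<and> v' vVAL \<le> n \<and> (v' vVAL < n \<longrightarrow> v' vVAL \<noteq> 0 \<and> (\<exists>k. ?T k (i div 2 ^ k) = v' vVAL)) \<and>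
    (\<forall>l'<l. ?T l' (i div 2 ^ l') \<noteq> 0 \<longrightarrow> v' vVAL \<le> ?T l' (i div 2 ^ l')) \<and>
    k' + 7 * blen (n div 2 ^ l) \<le> k + 4 + 7 * blen n)"
  have half: "j div 2 ^ l div 2 = j div 2 ^ Suc l" for j l :: nat
    by (simp add: div_mult2_eq[symmetric] mult.commute)
  have loop: "wp R (While (Less zero (Var vLV)) lookup_prog) Q v0 A0 k0" if "I 0 v0 A0 k0" for v0 A0 k0
  proof (rule wp_loop[where I = I and x = 0 and g = "\<lambda>l. n - l"])
    show "I 0 v0 A0 k0" by fact
  next
    fix l v' A' k'
    assume "I l v' A' k'"
    then show "bsafe R v' A' (Less zero (Var vLV))" using R_less by simp
  next
    fix l v' A' k'
    assume I: "I l v' A' k'" and n: "\<not> bev v' A' (Less zero (Var vLV))"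
    have n0: "n div 2 ^ l = 0" using I n by (simp add: I_def)
    \<comment> \<open>\<open>covered\<close> counts only levels with
      \<open>0 < n div 2 ^ l'\<close>, and all of these have been visited when the halved copy of
      \<open>n\<close> reaches 0.\<close>
    have "l' < l" if "0 < n div 2 ^ l'" for l'
    proof (rule ccontr)
      assume "\<not> l' < l"
      then have "(2::nat) ^ l \<le> 2 ^ l'" by simp
      then show False using that n0 div_le_mono2[of "2 ^ l" "2 ^ l'" n] by simp
    qed
    then have "v' vVAL \<le> y" if "covered n ?T i y" for y
      using I that unfolding I_def covered_def by (metis le_trans less_numeral_extra(3))
    then have "query_result n ?T i (v' vVAL)" using I unfolding query_result_def I_def by blast
    then show "Q v' A' (Suc k')" using I unfolding I_def by (auto intro: Q)
  next
    fix l v' A' k'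
    assume I0: "I l v' A' k'" and n: "bev v' A' (Less zero (Var vLV))"
    then have I: "A' = A" "v' vK = tb + l" "v' vPOS = i div 2 ^ l" "v' vLV = n div 2 ^ l" "sameV ?X v v'"
      "v' vVAL \<le> n" "v' vVAL < n \<Longrightarrow> v' vVAL \<noteq> 0 \<and> (\<exists>k. ?T k (i div 2 ^ k) = v' vVAL)"
      "\<And>l'. l' < l \<Longrightarrow> ?T l' (i div 2 ^ l') \<noteq> 0 \<Longrightarrow> v' vVAL \<le> ?T l' (i div 2 ^ l')"
      "k' + 7 * blen (n div 2 ^ l) \<le> k + 4 + 7 * blen n" "0 < n div 2 ^ l"
      unfolding I_def by auto
    have ln: "l < n" using div_pow_less[OF I(10)] .
    have bl: "blen (n div 2 ^ l) = 1 + blen (n div 2 ^ Suc l)"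
      using I(10) by (subst blen.simps) (simp add: half)
    have tl: "A aTAB (tb + l) (i div 2 ^ l) = ?T l (i div 2 ^ l)" by (simp add: tab_def)
    let ?t = "?T l (i div 2 ^ l)"
    let ?x = "if 0 < ?t \<and> ?t < v' vVAL then ?t else v' vVAL"
    have new: "?x \<le> ?T l' (i div 2 ^ l')" if "l' < Suc l" "?T l' (i div 2 ^ l') \<noteq> 0" for l'
      using that I(8)[of l'] by (cases "l' = l") auto
    have fin: "I (Suc l) (v''(vPOS := i div 2 ^ Suc l, vLV := n div 2 ^ Suc l, vK := Suc (tb + l))) A kk"
      if "kk \<le> k' + 7" "v'' = v' \<and> \<not> (0 < ?t \<and> ?t < v' vVAL) \<or> v'' = v'(vVAL := ?t) \<and> 0 < ?t \<and> ?t < v' vVAL" for v'' kk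
    proof -
      have "v'' vVAL = ?x" "sameV ?X v v''" using that(2) I(5) by (auto intro!: same_upd)
      moreover have "?x \<le> n" "?x < n \<longrightarrow> ?x \<noteq> 0 \<and> (\<exists>k. ?T k (i div 2 ^ k) = ?x)" using I(6,7) by auto
      ultimately show ?thesis unfolding I_def using new I(9) bl that(1) by (auto intro!: same_upd)
    qed
    show "wp R lookup_prog (\<lambda>v' A' k'. \<exists>x'. n - x' < n - l \<and> I x' v' A' k') v' A' (Suc k')"
      using ln R_less room fin[of _ v'] fin[of _ "v'(vVAL := ?t)"]
      by (auto simp: lookup_prog_def wp_simps I(1-4) tl half simp del: power_Suc intro!: exI[of _ "Suc l"])
  qed
  have "I 0 (v(vVAL := n, vPOS := i, vLV := n, vK := tb)) A (Suc (Suc (Suc (Suc k))))"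
    unfolding I_def by (auto simp: same_refl intro!: same_upd)
  from loop[OF this] show ?thesis
    unfolding query_prog_def using v by (simp add: wp_simps params_def)
qed

lemma answers_spec:
  assumes v: "params v"
    and Q: "\<And>v' A' k'. sameV {vVAL, vPOS, vLV, vK, vI} v v' \<Longrightarrow> sameA {aOUT} A A' \<Longrightarrow>
      (\<And>j. j \<le> ob + len \<Longrightarrow> A' aOUT 0 j = A aOUT 0 j) \<Longrightarrow>
      (\<And>i. 1 \<le> i \<Longrightarrow> i < len \<Longrightarrow> query_result n (tab A tb) i (A' aOUT 0 (ob + len + i))) \<Longrightarrow>
      k' \<le> k + 2 + n * (8 + 7 * blen n) \<Longrightarrow> Q v' A' k'"
  shows "wp R answers_prog Q v A k"
proof -
  let ?X = "{vVAL, vPOS, vLV, vK, vI}"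
  define I where "I = (\<lambda>i v' A' k'. i < len \<and> v' vI = Suc i \<and> sameV ?X v v' \<and> sameA {aOUT} A A' \<and>
    (\<forall>j \<le> ob + len. A' aOUT 0 j = A aOUT 0 j) \<and>
    (\<forall>i'. 1 \<le> i' \<and> i' \<le> i \<longrightarrow> query_result n (tab A tb) i' (A' aOUT 0 (ob + len + i'))) \<and>
    k' \<le> k + 1 + i * (8 + 7 * blen n))"
  have loop: "wp R (While (Less (Var vI) (Var vLEN)) answer_prog) Q v0 A0 k0" if "I 0 v0 A0 k0" for v0 A0 k0
  proof (rule wp_loop[where I = I and x = 0 and g = "\<lambda>i. len - i"])
    show "I 0 v0 A0 k0" by fact
  next
    fix i v' A' k'
    assume "I i v' A' k'"
    then show "bsafe R v' A' (Less (Var vI) (Var vLEN))" by simp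
  next
    fix i v' A' k'
    assume I: "I i v' A' k'" and n: "\<not> bev v' A' (Less (Var vI) (Var vLEN))"
    have "v' vLEN = len" using I v by (simp add: I_def params_def sameV_def)
    then have i: "len = Suc i" using I n by (simp add: I_def)
    moreover have "Suc k' \<le> k + 2 + n * (8 + 7 * blen n)"
    proof -
      have "i * (8 + 7 * blen n) \<le> n * (8 + 7 * blen n)"
        using len_le i by (intro mult_le_mono1) simp
      moreover have "k' \<le> k + 1 + i * (8 + 7 * blen n)" using I by (simp add: I_def)
      ultimately show ?thesis by linarith
    qed
    ultimately show "Q v' A' (Suc k')" using I unfolding I_def by (intro Q) auto
  next
    fix i v' A' k'
    assume I0: "I i v' A' k'" and n: "bev v' A' (Less (Var vI) (Var vLEN))"
    have "v' vLEN = len" using I0 v by (simp add: I_def params_def sameV_def)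
    then have I: "Suc i < len" "v' vI = Suc i" "sameV ?X v v'" "sameA {aOUT} A A'"
      "\<And>j. j \<le> ob + len \<Longrightarrow> A' aOUT 0 j = A aOUT 0 j"
      "\<And>i'. 1 \<le> i' \<Longrightarrow> i' \<le> i \<Longrightarrow> query_result n (tab A tb) i' (A' aOUT 0 (ob + len + i'))"
      "k' \<le> k + 1 + i * (8 + 7 * blen n)"
      using I0 n unfolding I_def by auto
    have par: "params v'" using params_same[OF v I(3)] by simp
    have tA: "tab A' tb = tab A tb" using I(4) by (intro ext) (simp add: tab_def sameA_def)
    show "wp R answer_prog (\<lambda>v' A' k'. \<exists>x'. len - x' < len - i \<and> I x' v' A' k') v' A' (Suc k')"
      unfolding answer_prog_def wp_Seq_iff
    proof (rule query_spec[OF par I(2)])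
      fix v'' k''
      assume a: "sameV {vVAL, vPOS, vLV, vK} v' v''" "query_result n (tab A' tb) (Suc i) (v'' vVAL)"
        "k'' \<le> Suc k' + 5 + 7 * blen n"
      have vs: "v'' vI = Suc i" "v'' vO = ob" "v'' vLEN = len"
        using a(1) I(2) par by (simp_all add: sameV_def params_def)
      have sv: "sameV ?X v v''" using sameV_trans[OF I(3) a(1), of ?X] by simp
      let ?A = "upd A' aOUT 0 (ob + len + Suc i) (v'' vVAL)"
      have "query_result n (tab A tb) i' (?A aOUT 0 (ob + len + i'))" if "1 \<le> i'" "i' \<le> Suc i" for i'
        using that I(6)[of i'] a(2) tA by (cases "i' = Suc i") (auto simp: upd_simps)
      then have "I (Suc i) (v''(vI := Suc (Suc i))) ?A kk" if "kk \<le> k'' + 2" for kk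
        unfolding I_def using I(1,4,5,7) sv a(3) that by (auto simp: upd_simps intro!: same_upd)
      then show "wp R (Put aOUT zero (Plus (Plus (Var vO) (Var vLEN)) (Var vI)) (Var vVAL))
        (wp R (vI ::= Plus (Var vI) one) (\<lambda>v' A' k'. \<exists>x'. len - x' < len - i \<and> I x' v' A' k')) v'' A' k''"
        using I(1) len_le room R_less by (auto simp: wp_simps vs intro!: exI[of _ "Suc i"])
    qed
  qed
  have "I 0 (v(vI := 1)) A (Suc k)"
    unfolding I_def using len by (auto simp: same_refl intro!: same_upd)
  from loop[OF this] show ?thesis
    unfolding answers_prog_def using R_less by (simp add: wp_simps)
qed

lemma path_locale:
  assumes "\<And>x. D x \<noteq> 0 \<Longrightarrow> index_eq J x"
  shows "bfs_path n E s cnt q D P F L t len pth J"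
proof (unfold_locales, goal_cases)
  case 3
  show ?case by (simp add: pth_def)
next
  case (4 i)
  then have "len - i = Suc (len - Suc i)" by simp
  then show ?case by (simp add: pth_def)
next
  case (5 x)
  then show ?case using assms by (simp add: index_eq_def)
qed (rule len)+

text \<open>A value below \<open>n\<close> belongs to a candidate serving \<open>i\<close>, so it is
  at least the distance; the optimal candidate from \<open>interval_ge\<close> covers
  \<open>i\<close>, so it is at most the distance. Finite distances are below \<open>n\<close>,
  hence the default survives exactly when no replacement path exists.\<close>

lemma query_dist:
  assumes J: "\<And>x. D x \<noteq> 0 \<Longrightarrow> index_eq J x" and so: "sound (tab A tb) (ivals J)"
    and se: "\<And>x y. S.slot y x \<Longrightarrow> served A J x y" and i: "1 \<le> i" "i < len"
    and r: "query_result n (tab A tb) i z"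
  shows "z = encode_dist n (gdist (E - {{pth i, pth (Suc i)}}) s t)"
proof -
  interpret B: bfs_path n E s cnt q D P F L t len pth J by (rule path_locale) (rule J)
  let ?E = "E - {{pth i, pth (Suc i)}}"
  have up: "gdist ?E s t \<le> enat z" if "z < n"
  proof -
    obtain k where k: "tab A tb k (i div 2 ^ k) = z" "z \<noteq> 0"
      using r \<open>z < n\<close> unfolding query_result_def by auto
    then obtain l h where "(l, h, z) \<in> ivals J" "l \<le> i" "i < h"
      using so unfolding sound_def by metis
    then obtain x y where xy: "S.slot y x" "J x \<le> i" "i < J y" "z = D x + D' y - 1"
      unfolding ivals_def by auto
    have D'y: "D' y \<noteq> 0" using slot_D[OF xy(1)] reach_both by blast
    then have "gdist E t y = enat (D' y - 1)" using T.gdist_D by simp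
    from B.interval_le[OF i xy(1-3) this] show ?thesis using xy(4) D'y by simp
  qed
  have lo: "z \<le> d" if d: "gdist ?E s t = enat d" for d
  proof -
    obtain x y e where xy: "S.slot y x" "J x \<le> i" "i < J y" "gdist E t y = enat e" "D x + e \<le> d"
      using B.interval_ge[OF i d] by blast
    have "D' y \<noteq> 0" using slot_D[OF xy(1)] reach_both by blast
    then have e: "e = D' y - 1" using xy(4) T.gdist_D[of y] by simp
    have "covered n (tab A tb) i (D x + D' y - 1)" using se[OF xy(1)] xy(2,3) unfolding served_def by blast
    then have "z \<le> D x + D' y - 1" using r unfolding query_result_def by blast
    then show ?thesis using e xy(5) \<open>D' y \<noteq> 0\<close> by simp
  qed
  show ?thesis
  proof (cases "gdist ?E s t")
    case (enat d)
    have "s < n" using S.D_less_n[of s] S.Ds by simp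
    then have "d < n" using gdist_less[OF ug _ _ enat] by blast
    then have "z < n" using lo[OF enat] by simp
    then show ?thesis using up lo[OF enat] enat by (simp add: encode_dist_def)
  next
    case infinity
    then have "\<not> z < n" using up by auto
    then show ?thesis using r infinity by (simp add: query_result_def encode_dist_def)
  qed
qed

end

definition pair_vars :: "var set" where
  "pair_vars = {vLEN, vX, vK, vI, vCN, vDX, vY, vCJ, vCE, vZ, vL, vR, vVAL, vPOS, vLV, vO, vTB}"

text \<open>One contract for reachable and unreachable targets, whose records differ in length; the
  outer loops see only how far \<open>vO\<close> and \<open>vTB\<close> move.\<close>

definition pair_post :: "nat \<Rightarrow> nat set set \<Rightarrow> nat \<Rightarrow> nat \<Rightarrow> vars \<Rightarrow> arrs \<Rightarrow> nat \<Rightarrow> vars \<Rightarrow> arrs \<Rightarrow> nat \<Rightarrow> bool" where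
  "pair_post n E s t v A k v' A' k' \<longleftrightarrow> sameV pair_vars v v' \<and> sameA {aOUT, aJ, aTAB} A A' \<and>
     v vO \<le> v' vO \<and> v' vO \<le> v vO + 2 * n \<and> v' vTB \<le> v vTB + n + 1 \<and>
     (\<forall>j < v vO. A' aOUT 0 j = A aOUT 0 j) \<and> (\<forall>i \<ge> v' vTB. \<forall>j. A' aTAB i j = 0) \<and>
     (\<exists>rec. correct_record E s t rec \<and> encode_record n rec = map (A' aOUT 0) [v vO ..< v' vO]) \<and>
     k' \<le> k + 20 + n * (100 + 91 * blen n)"

lemma map_upt_shift: "map (\<lambda>i. f (c + i)) [a..<b] = map f [c + a..<c + b]"
  by (induction b) auto

lemma wp_Seq_eq: "wp R (c ;; d) Q = wp R c (wp R d Q)"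
  by (intro ext) (rule wp_Seq_iff)

lemma (in source_pair) record_spec:
  assumes p: "\<And>i. 1 \<le> i \<Longrightarrow> i \<le> len \<Longrightarrow> O' (ob + i) = pth i" and l: "O' ob = len"
    and J: "\<And>x. D x \<noteq> 0 \<Longrightarrow> index_eq J x"
    and z: "\<And>i. 1 \<le> i \<Longrightarrow> i < len \<Longrightarrow>
      O' (ob + len + i) = encode_dist n (gdist (E - {{pth i, pth (Suc i)}}) s t)"
  shows "\<exists>rec. correct_record E s t rec \<and> encode_record n rec = map O' [ob ..< ob + (len + len)]"
proof -
  interpret B: bfs_path n E s cnt q D P F L t len pth J by (rule path_locale) (rule J)
  let ?ds = "map (\<lambda>i. gdist (E - {{pth i, pth (Suc i)}}) s t) [1..<len]"
  have c: "correct_record E s t (map pth [1..<Suc len], ?ds)"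
    by (rule B.correct_record_path) (auto simp: nth_append)
  have "[ob ..< ob + (len + len)] = ob # [ob + 1 ..< ob + Suc len] @ [ob + len + 1 ..< ob + len + len]"
    using len(2) upt_add_eq_append[of "ob + 1" "ob + Suc len" "len - 1"]
    by (simp add: upt_conv_Cons add.assoc del: upt_Suc)
  then have "map O' [ob ..< ob + (len + len)] =
    O' ob # map (\<lambda>i. O' (ob + i)) [1..<Suc len] @ map (\<lambda>i. O' (ob + len + i)) [1..<len]"
    unfolding map_upt_shift by (simp only: list.map map_append)
  moreover have "map (\<lambda>i. O' (ob + i)) [1..<Suc len] = map pth [1..<Suc len]"
    using p by (intro map_cong refl) auto
  moreover have "map (\<lambda>i. O' (ob + len + i)) [1..<len] = map (encode_dist n) ?ds"
    using z by (simp add: comp_def)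
  ultimately have "encode_record n (map pth [1..<Suc len], ?ds) = map O' [ob ..< ob + (len + len)]"
    using l by (simp add: encode_record_def del: upt_Suc)
  then show ?thesis using c by blast
qed

text \<open>Per vertex, path, index, intervals and answers cost
  \<open>4 + 8 + 72 + 8 \<le> 100\<close>; per vertex and level, insertions and lookups cost
  \<open>84 + 7 = 91\<close>.\<close>

lemma (in source_pair) pair_spec:
  assumes v: "v vN = n" "v vSA = a" "v vSB = b" "v vT = t" "v vO = ob" "v vTB = tb" and A: "rows A"
    and fresh: "\<And>i j. tb \<le> i \<Longrightarrow> A aTAB i j = 0"
  shows "wp R pair_prog (pair_post n E s t v A k) v A k"
proof -
  let ?Q = "pair_post n E s t v A k"
  let ?v1 = "v(vLEN := len)" and ?A1 = "upd A aOUT 0 ob len"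
  let ?fin = "wp R (vO ::= Plus (Var vO) (Plus (Var vLEN) (Var vLEN)))
        (wp R (vTB ::= Plus (Var vTB) (Plus (Var vN) one)) ?Q)"
  have par: "params ?v1" using v by (simp add: params_def)
  have r1: "rows ?A1" using A by (simp add: rows_def upd_simps)
  have "wp R path_prog (wp R index_prog (wp R intervals_prog (wp R answers_prog ?fin))) ?v1 ?A1 (Suc (Suc (Suc k)))"
  proof (rule path_spec[OF par r1])
    fix v2 A2 k2
    assume a2: "sameV {vX, vK} ?v1 v2" "sameA {aOUT} ?A1 A2"
      "\<And>j. j \<le> ob \<or> ob + len < j \<Longrightarrow> A2 aOUT 0 j = ?A1 aOUT 0 j"
      "\<And>i. 1 \<le> i \<Longrightarrow> i \<le> len \<Longrightarrow> A2 aOUT 0 (ob + i) = pth i" "k2 \<le> Suc (Suc (Suc k)) + 3 + 4 * n"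
    have p2: "params v2" using params_same[OF par a2(1)] by simp
    have r2: "rows A2" using rows_same[OF r1 a2(2)] by simp
    show "wp R index_prog (wp R intervals_prog (wp R answers_prog ?fin)) v2 A2 k2"
    proof (rule index_spec[OF p2 r2 a2(4)])
      fix v3 A3 k3
      assume a3: "sameV {vI, vCN, vX, vDX} v2 v3" "sameA {aJ} A2 A3" "v3 vCN = cnt"
        "\<And>x. D x \<noteq> 0 \<Longrightarrow> index_eq (A3 aJ 0) x" "k3 \<le> k2 + 3 + 8 * n"
      have p3: "params v3" using params_same[OF p2 a3(1)] by simp
      have r3: "rows A3" using rows_same[OF r2 a3(2)] by simp
      let ?J = "A3 aJ 0"
      interpret B: bfs_path n E s cnt q D P F L t len pth ?J by (rule path_locale) (rule a3(4))
      have Jn: "?J x \<le> n" if "D x \<noteq> 0" for x using B.J_le[OF that] len_le by simp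
      have T3: "A3 aTAB = A aTAB" using a2(2) a3(2) by (simp add: sameA_def upd_simps)
      then have so: "sound (tab A3 tb) (ivals ?J)" using fresh by (simp add: sound_def tab_def)
      show "wp R intervals_prog (wp R answers_prog ?fin) v3 A3 k3"
      proof (rule intervals_spec[OF p3 a3(3) r3 refl Jn so])
        fix v4 A4 k4
        assume a4: "sameV {vX, vL, vR, vVAL, vK, vY, vCJ, vCE, vZ, vI} v3 v4" "grown (ivals ?J) A3 A4"
          "\<And>x y. S.slot y x \<Longrightarrow> served A4 ?J x y" "k4 \<le> k3 + 2 + n * (72 + 84 * blen n)"
        have p4: "params v4" using params_same[OF p3 a4(1)] by simp
        have g4: "sameA {aTAB} A3 A4" "\<And>i. tb + n < i \<Longrightarrow> A4 aTAB i = A3 aTAB i" "sound (tab A4 tb) (ivals ?J)"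
          using a4(2) unfolding grown_def by auto
        show "wp R answers_prog ?fin v4 A4 k4"
        proof (rule answers_spec[OF p4])
          fix v5 A5 k5
          assume a5: "sameV {vVAL, vPOS, vLV, vK, vI} v4 v5" "sameA {aOUT} A4 A5"
            "\<And>j. j \<le> ob + len \<Longrightarrow> A5 aOUT 0 j = A4 aOUT 0 j"
            "\<And>i. 1 \<le> i \<Longrightarrow> i < len \<Longrightarrow> query_result n (tab A4 tb) i (A5 aOUT 0 (ob + len + i))"
            "k5 \<le> k4 + 2 + n * (8 + 7 * blen n)"
          have p5: "params v5" using params_same[OF p4 a5(1)] by simp
          let ?v = "v5(vO := ob + (len + len), vTB := tb + (n + 1))"
          have out: "A5 aOUT 0 j = A2 aOUT 0 j" if "j \<le> ob + len" for j
            using a5(3)[OF that] g4(1) a3(2) by (simp add: sameA_def)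
          have "\<exists>rec. correct_record E s t rec \<and>
            encode_record n rec = map (A5 aOUT 0) [ob ..< ob + (len + len)]"
          proof (rule record_spec[OF _ _ a3(4)])
            show "A5 aOUT 0 (ob + i) = pth i" if "1 \<le> i" "i \<le> len" for i
              using out[of "ob + i"] a2(4)[OF that] that by simp
            show "A5 aOUT 0 ob = len" using out[of ob] a2(3)[of ob] by (simp add: upd_simps)
            show "A5 aOUT 0 (ob + len + i) = encode_dist n (gdist (E - {{pth i, pth (Suc i)}}) s t)"
              if "1 \<le> i" "i < len" for i
              by (rule query_dist[OF a3(4) g4(3) a4(3) that a5(4)[OF that]])
          qed
          moreover have "sameV pair_vars v ?v"
            using a2(1) a3(1) a4(1) a5(1) unfolding pair_vars_def sameV_def by simp
          moreover have "sameA {aOUT, aJ, aTAB} A A5"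
            using a2(2) a3(2) g4(1) a5(2) unfolding sameA_def by (simp add: upd_simps)
          moreover have "A5 aOUT 0 j = A aOUT 0 j" if "j < ob" for j
            using out[of j] a2(3)[of j] that by (simp add: upd_simps)
          moreover have "A5 aTAB i j = 0" if "tb + (n + 1) \<le> i" for i j
            using g4(2)[of i] a5(2) T3 fresh[of i] that by (simp add: sameA_def)
          moreover have "k5 + 2 \<le> k + 20 + n * (100 + 91 * blen n)"
            using a2(5) a3(5) a4(4) a5(5) by (simp add: algebra_simps)
          ultimately have "?Q ?v A5 (Suc (Suc k5))"
            unfolding pair_post_def using v len_le by simp
          then show "?fin v5 A5 k5"
            using p5 len_le room R_less by (simp add: wp_simps params_def)
        qed
      qed
    qed
  qed
  then show ?thesis
    unfolding pair_prog_def using len A v R_less by (simp add: wp_simps wp_Seq_eq rows_def)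
qed

text \<open>Deleting an edge cannot make \<open>t\<close> reachable, so the one-word record with
  empty path reports infinity for every edge.\<close>

lemma (in inst) unreachable_spec:
  assumes S: "bfs n E s cnt q D P F L" and v: "v vSA = a" "v vT = t" and A: "A aD a = D" and t: "D t = 0"
    and fresh: "\<And>i j. v vTB \<le> i \<Longrightarrow> A aTAB i j = 0" and room: "v vO + 1 < R"
  shows "wp R pair_prog (pair_post n E s t v A k) v A k"
proof -
  interpret S: bfs n E s cnt q D P F L by (rule S)
  have inf: "gdist E s t = \<infinity>" using S.gdist_D t by simp
  have "gdist (E - {e}) s t = \<infinity>" for e
  proof (rule gdist_infI, rule notI)
    fix j assume "(s, t) \<in> adj (E - {e}) ^^ j"
    then have "(s, t) \<in> adj E ^^ j" by (rule adj_pow_mono) auto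
    then show False using S.walk_D t by blast
  qed
  then have c: "correct_record E s t ([], [])"
    using inf by (simp add: correct_record_def reported_dist_def path_edges_def)
  have n: "0 < n" using S.cnt_le S.cnt by simp
  let ?A = "upd A aOUT 0 (v vO) 0"
  have "encode_record n ([], []) = map (?A aOUT 0) [v vO ..< v vO + 1]"
    by (simp add: encode_record_def upd_simps)
  then have "pair_post n E s t v A k (v(vLEN := 0, vO := v vO + 1)) ?A (Suc (Suc (Suc (Suc k))))"
    unfolding pair_post_def using c n fresh
    by (auto simp: pair_vars_def upd_simps same_refl intro!: same_upd)
  then show ?thesis
    unfolding pair_prog_def using v A t R_less room by (simp add: wp_simps)
qed

section \<open>All pairs in row-major order, and the total number of ticks\<close>

section \<open>All pairs of sources\<close>

definition source_prog :: com where
  "source_prog =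
    vS ::= Get aIN zero (Plus (Var vEN) (Var vSA)) ;;
    bfs_prog ;;
    Put aQN zero (Var vSA) (Var vQT) ;;
    vSA ::= Plus (Var vSA) one"

definition sources_prog :: com where
  "sources_prog =
    vSA ::= zero ;;
    While (Less (Var vSA) (Var vSG)) source_prog"

definition target_prog :: com where
  "target_prog =
    vT ::= Get aIN zero (Plus (Var vEN) (Var vSB)) ;;
    pair_prog ;;
    vSB ::= Plus (Var vSB) one"

definition row_prog :: com where
  "row_prog =
    vSB ::= zero ;;
    While (Less (Var vSB) (Var vSG)) target_prog"

definition pairs_prog :: com where
  "pairs_prog =
    vO ::= zero ;;
    vTB ::= zero ;;
    vSA ::= zero ;;
    While (Less (Var vSA) (Var vSG)) (row_prog ;; vSA ::= Plus (Var vSA) one)"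

text \<open>Without sources the bound is a constant, and even reading the edges would exceed it;
  hence the test before \<open>build\<close>.\<close>

definition main_prog :: com where
  "main_prog =
    vN ::= Get aIN zero zero ;;
    vM ::= Get aIN zero one ;;
    vSG ::= Get aIN zero (Num 2) ;;
    Cond (Less zero (Var vSG)) (build ;; sources_prog ;; pairs_prog) Skip"

lemma div_mod_index: "b < k \<Longrightarrow> (a * k + b) div k = a \<and> (a * k + b) mod k = (b :: nat)"
  by (metis add.commute add_0 div_less div_mult_self1 mod_less mod_mult_self1 not_less_zero)

context inst
begin

definition searched :: "arrs \<Rightarrow> nat \<Rightarrow> bool" where
  "searched A a \<longleftrightarrow> bfs n E (ss ! a) (A aQN 0 a) (A aQU a) (A aD a) (A aPAR a) (A aFS a) (A aLS a)"

lemma src_less: "a < sg \<Longrightarrow> ss ! a < n"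
  using sss nth_mem[of a ss] by (meson lessThan_iff subsetD)

lemma input_less: "3 + 2 * m + sg < R"
  using m_le sg_le R_expand n3 by linarith

lemma sources_spec:
  fixes v :: vars and A :: arrs
  assumes v: "v vSG = sg" "v vEN = 3 + 2 * m" and A: "A aIN 0 = inp"
    and ch: "\<And>x. chain (A aNXT 0) (A aDST 0) R (A aHEAD 0 x) (nb es x)"
    and z: "\<And>a b. b \<in> {aD, aPAR, aFS, aLS} \<Longrightarrow> A b a = (\<lambda>_. 0)"
    and Q: "\<And>v' A' k'. sameV {vSA, vS, vQH, vQT, vX, vP, vY, vCJ} v v' \<Longrightarrow>
      sameA {aD, aPAR, aQU, aFS, aLS, aQN} A A' \<Longrightarrow> (\<And>a. a < sg \<Longrightarrow> searched A' a) \<Longrightarrow>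
      k' \<le> k + 2 + sg * (10 * n + 20 * m + 14) \<Longrightarrow> Q v' A' k'"
  shows "wp R sources_prog Q v A k"
proof -
  let ?X = "{vSA, vS, vQH, vQT, vX, vP, vY, vCJ}"
  let ?Y = "{aD, aPAR, aQU, aFS, aLS, aQN}"
  define I where "I = (\<lambda>i v' A' k'. i \<le> sg \<and> v' vSA = i \<and> sameV ?X v v' \<and> sameA ?Y A A' \<and>
    (\<forall>a<i. searched A' a) \<and> (\<forall>a\<ge>i. \<forall>b\<in>{aD, aPAR, aFS, aLS}. A' b a = (\<lambda>_. 0)) \<and>
    k' \<le> k + 1 + i * (10 * n + 20 * m + 14))"
  have loop: "wp R (While (Less (Var vSA) (Var vSG)) source_prog) Q v0 A0 k0" if "I 0 v0 A0 k0" for v0 A0 k0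
  proof (rule wp_loop[where I = I and x = 0 and g = "\<lambda>i. sg - i"])
    show "I 0 v0 A0 k0" by fact
  next
    fix i v' A' k'
    assume "I i v' A' k'"
    then show "bsafe R v' A' (Less (Var vSA) (Var vSG))" by simp
  next
    fix i v' A' k'
    assume I: "I i v' A' k'" and n: "\<not> bev v' A' (Less (Var vSA) (Var vSG))"
    have "v' vSG = sg" using I v by (simp add: I_def sameV_def)
    then have i: "i = sg" using I n by (simp add: I_def)
    then show "Q v' A' (Suc k')" using I unfolding I_def by (intro Q) auto
  next
    fix i v' A' k'
    assume I0: "I i v' A' k'" and n: "bev v' A' (Less (Var vSA) (Var vSG))"
    have vs: "v' vSG = sg" "v' vEN = 3 + 2 * m" using I0 v by (simp_all add: I_def sameV_def)
    then have I: "i < sg" "v' vSA = i" "sameV ?X v v'" "sameA ?Y A A'" "\<And>a. a < i \<Longrightarrow> searched A' a"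
      "\<And>a b. i \<le> a \<Longrightarrow> b \<in> {aD, aPAR, aFS, aLS} \<Longrightarrow> A' b a = (\<lambda>_. 0)"
      "k' \<le> k + 1 + i * (10 * n + 20 * m + 14)"
      using I0 n unfolding I_def by auto
    have As: "A' aIN 0 = inp" "A' aNXT = A aNXT" "A' aDST = A aDST" "A' aHEAD = A aHEAD"
      using I(4) A by (simp_all add: sameA_def)
    let ?s = "ss ! i"
    have src: "inp (3 + 2 * m + i) = ?s" using inp_src[OF I(1)] .
    let ?Q = "\<lambda>v' A' k'. \<exists>x'. sg - x' < sg - i \<and> I x' v' A' k'"
    have "wp R bfs_prog (wp R (Put aQN zero (Var vSA) (Var vQT) ;; vSA ::= Plus (Var vSA) one) ?Q)
      (v'(vS := ?s)) A' (Suc (Suc k'))"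
    proof (rule bfs_spec[where a = i and s = ?s])
      fix v'' A'' k''
      assume a: "sameV {vQH, vQT, vX, vP, vY, vCJ} (v'(vS := ?s)) v''" "sameA {aD, aPAR, aQU, aFS, aLS} A' A''"
        "\<And>b a. a \<noteq> i \<Longrightarrow> A'' b a = A' b a"
        "bfs n E ?s (v'' vQT) (A'' aQU i) (A'' aD i) (A'' aPAR i) (A'' aFS i) (A'' aLS i)"
        "k'' \<le> Suc (Suc k') + 10 * n + 20 * m + 10"
      have vi: "v'' vSA = i" using a(1) I(2) by (simp add: sameV_def)
      let ?A = "upd A'' aQN 0 i (v'' vQT)"
      have Q0: "A'' aQN = A' aQN" using a(2) by (simp add: sameA_def)
      have "searched ?A a" if "a < Suc i" for a
      proof (cases "a = i")
        case True
        then show ?thesis using a(4) by (simp add: searched_def upd_simps)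
      next
        case False
        then show ?thesis using I(5)[of a] that a(3)[of a] Q0 by (simp add: searched_def upd_simps)
      qed
      moreover have "?A b a = (\<lambda>_. 0)" if "Suc i \<le> a" "b \<in> {aD, aPAR, aFS, aLS}" for a b
        using I(6)[of a b] a(3)[of a b] that by (auto simp: upd_simps)
      moreover have "sameA ?Y A ?A" using sameA_trans[OF I(4) a(2), of ?Y] by (auto intro!: same_upd)
      moreover have "sameV ?X v (v''(vSA := Suc i))" using a(1) I(3) unfolding sameV_def by simp
      ultimately have "I (Suc i) (v''(vSA := Suc i)) ?A kk" if "kk \<le> k'' + 2" for kk
        unfolding I_def using I(1,7) a(5) that by auto
      then show "wp R (Put aQN zero (Var vSA) (Var vQT) ;; vSA ::= Plus (Var vSA) one) ?Q v'' A'' k''"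
        using I(1) R_less sg_le by (auto simp: wp_simps vi intro!: exI[of _ "Suc i"])
    qed (use ch As I src_less in \<open>auto\<close>)
    then show "wp R source_prog ?Q v' A' (Suc k')"
      unfolding source_prog_def wp_Seq_eq wp_Assign_iff[of R vS] using I(1,2) vs As src input_less R_less by simp
  qed
  have "I 0 (v(vSA := 0)) A (Suc k)"
    unfolding I_def using z by (auto simp: same_refl intro!: same_upd)
  from loop[OF this] show ?thesis
    unfolding sources_prog_def using R_less by (simp add: wp_simps)
qed

lemma pair_any:
  assumes ab: "a < sg" "b < sg" and v: "v vN = n" "v vSA = a" "v vSB = b" "v vT = ss ! b"
    and A: "searched A a" "searched A b" and fresh: "\<And>i j. v vTB \<le> i \<Longrightarrow> A aTAB i j = 0"
    and room: "v vO + 2 * n + 2 < R" "v vTB + n + 1 < R"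
  shows "wp R pair_prog (pair_post n E (ss ! a) (ss ! b) v A k) v A k"
proof (cases "A aD a (ss ! b) = 0")
  case True
  show ?thesis
    by (rule unreachable_spec[OF A(1)[unfolded searched_def] v(2,4)]) (use True fresh room in auto)
next
  case False
  interpret S: bfs n E "ss ! a" "A aQN 0 a" "A aQU a" "A aD a" "A aPAR a" "A aFS a" "A aLS a"
    using A(1) unfolding searched_def .
  interpret T: bfs n E "ss ! b" "A aQN 0 b" "A aQU b" "A aD b" "A aPAR b" "A aFS b" "A aLS b"
    using A(2) unfolding searched_def .
  interpret source_pair n E es ss R "ss ! a" "A aQN 0 a" "A aQU a" "A aD a" "A aPAR a" "A aFS a" "A aLS a"
    "ss ! b" "A aQN 0 b" "A aQU b" "A aD b" "A aPAR b" "A aFS b" "A aLS b" a b "v vO" "v vTB" "A aD a (ss ! b)"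
    using False room by unfold_locales auto
  show ?thesis
    by (rule pair_spec) (use v fresh in \<open>auto simp: rows_def\<close>)
qed

text \<open>Pair number \<open>i\<close> in row-major order has source index \<open>i div sg\<close>
  and target index \<open>i mod sg\<close>. The bounds linear in \<open>c\<close> keep output and
  tables within \<open>R\<close>.\<close>

definition recorded :: "vars \<Rightarrow> arrs \<Rightarrow> nat \<Rightarrow> bool" where
  "recorded v A c \<longleftrightarrow> v vO \<le> 2 * n * c \<and> v vTB \<le> (n + 1) * c \<and> (\<forall>i\<ge>v vTB. \<forall>j. A aTAB i j = 0) \<and>
     (\<exists>rs. length rs = c \<and> (\<forall>i<c. correct_record E (ss ! (i div sg)) (ss ! (i mod sg)) (rs ! i)) \<and>
        concat (map (encode_record n) rs) = map (A aOUT 0) [0..<v vO])"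

definition row_time :: nat where
  "row_time = 23 + n * (100 + 91 * blen n)"

lemma pair_index:
  assumes "a < sg" "b < sg"
  shows "(a * sg + b) div sg = a" "(a * sg + b) mod sg = b" "a * sg + b < n * n"
proof -
  show "(a * sg + b) div sg = a" "(a * sg + b) mod sg = b" using div_mod_index[OF assms(2), of a] by blast+
  have "a * sg + b < (a + 1) * sg" using assms by simp
  also have "\<dots> \<le> n * n" using assms sg_le by (intro mult_le_mono) auto
  finally show "a * sg + b < n * n" .
qed

lemma recorded_step:
  assumes r: "recorded v A c" and p: "pair_post n E (ss ! (c div sg)) (ss ! (c mod sg)) v A k v' A' k'"
  shows "recorded v' A' (Suc c)"
proof -
  from r obtain rs where rs: "length rs = c" "concat (map (encode_record n) rs) = map (A aOUT 0) [0..<v vO]"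
    "\<And>i. i < c \<Longrightarrow> correct_record E (ss ! (i div sg)) (ss ! (i mod sg)) (rs ! i)"
    unfolding recorded_def by blast
  from p obtain rec where rec: "correct_record E (ss ! (c div sg)) (ss ! (c mod sg)) rec"
    "encode_record n rec = map (A' aOUT 0) [v vO ..< v' vO]" unfolding pair_post_def by blast
  have o: "v vO \<le> v' vO" "\<And>j. j < v vO \<Longrightarrow> A' aOUT 0 j = A aOUT 0 j" using p unfolding pair_post_def by auto
  have "correct_record E (ss ! (i div sg)) (ss ! (i mod sg)) ((rs @ [rec]) ! i)" if "i < Suc c" for i
    using that rs(1,3) rec(1) by (cases "i = c") (auto simp: nth_append)
  moreover have "concat (map (encode_record n) (rs @ [rec])) = map (A' aOUT 0) [0..<v' vO]"
  proof -
    have "map (A aOUT 0) [0..<v vO] = map (A' aOUT 0) [0..<v vO]" using o(2) by simp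
    moreover have "[0..<v' vO] = [0..<v vO] @ [v vO..<v' vO]"
      using upt_add_eq_append[of 0 "v vO" "v' vO - v vO"] o(1) by simp
    ultimately show ?thesis using rs(2) rec(2) by simp
  qed
  ultimately show ?thesis
    using r p rs(1) unfolding recorded_def pair_post_def
    by (auto simp: algebra_simps intro!: exI[of _ "rs @ [rec]"])
qed

lemma recorded_room:
  assumes "recorded v A c" "c < n * n"
  shows "v vO + 2 * n + 2 < R" "v vTB + n + 1 < R"
proof -
  have "2 * n * c \<le> 2 * n * (n * n)" "(n + 1) * c \<le> (n + 1) * (n * n)"
    using assms(2) by (intro mult_le_mono2; simp)+
  then have "v vO \<le> 2 * n * (n * n)" "v vTB \<le> (n + 1) * (n * n)"
    using assms(1) unfolding recorded_def by linarith+
  then have "v vO \<le> 2 * (n * n * n)" "v vTB \<le> n * n * n + n * n"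
    by (simp_all add: algebra_simps)
  then show "v vO + 2 * n + 2 < R" "v vTB + n + 1 < R"
    using R_expand n3 by linarith+
qed

definition pairs_vars :: "var set" where
  "pairs_vars = insert vSA (insert vSB (insert vT pair_vars))"

definition ready :: "vars \<Rightarrow> arrs \<Rightarrow> bool" where
  "ready v A \<longleftrightarrow> v vN = n \<and> v vSG = sg \<and> v vEN = 3 + 2 * m \<and> A aIN 0 = inp \<and> (\<forall>a<sg. searched A a)"

lemma ready_post:
  assumes "ready v A" "pair_post n E s t v A k v' A' k'"
  shows "ready v' A'" "v' vSA = v vSA" "v' vSB = v vSB"
  using assms unfolding ready_def pair_post_def sameV_def sameA_def searched_def pair_vars_def by auto

lemma row_spec:
  fixes v :: vars and A :: arrs
  assumes r: "ready v A" and a: "v vSA = a" "a < sg" and c: "recorded v A (a * sg)"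
    and Q: "\<And>v' A' k'. ready v' A' \<Longrightarrow> v' vSA = a \<Longrightarrow> recorded v' A' (Suc a * sg) \<Longrightarrow>
      k' \<le> k + 2 + sg * row_time \<Longrightarrow> Q v' A' k'"
  shows "wp R row_prog Q v A k"
proof -
  define I where "I = (\<lambda>b v' A' k'. b \<le> sg \<and> ready v' A' \<and> v' vSA = a \<and> v' vSB = b \<and>
    recorded v' A' (a * sg + b) \<and> k' \<le> k + 1 + b * row_time)"
  have loop: "wp R (While (Less (Var vSB) (Var vSG)) target_prog) Q v0 A0 k0" if "I 0 v0 A0 k0" for v0 A0 k0
  proof (rule wp_loop[where I = I and x = 0 and g = "\<lambda>i. sg - i"])
    show "I 0 v0 A0 k0" by fact
  next
    fix b v' A' k'
    assume "I b v' A' k'"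
    then show "bsafe R v' A' (Less (Var vSB) (Var vSG))" by simp
  next
    fix b v' A' k'
    assume I: "I b v' A' k'" and n: "\<not> bev v' A' (Less (Var vSB) (Var vSG))"
    then have "b = sg" by (simp add: I_def ready_def)
    then show "Q v' A' (Suc k')" using I unfolding I_def by (intro Q) (auto simp: add.commute)
  next
    fix b v' A' k'
    assume I0: "I b v' A' k'" and n: "bev v' A' (Less (Var vSB) (Var vSG))"
    then have I: "b < sg" "ready v' A'" "v' vSA = a" "v' vSB = b" "recorded v' A' (a * sg + b)"
      "k' \<le> k + 1 + b * row_time"
      by (auto simp: I_def ready_def)
    note rd = I(2)[unfolded ready_def]
    note ix = pair_index[OF a(2) I(1)]
    let ?v = "v'(vT := ss ! b)"
    let ?Q = "\<lambda>v' A' k'. \<exists>x'. sg - x' < sg - b \<and> I x' v' A' k'"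
    have rv: "recorded ?v A' (a * sg + b)" "ready ?v A'" using I(2,5) by (simp_all add: recorded_def ready_def)
    have "wp R pair_prog (pair_post n E (ss ! a) (ss ! b) ?v A' (Suc (Suc k'))) ?v A' (Suc (Suc k'))"
    proof (rule pair_any[OF a(2) I(1)])
      show "A' aTAB i j = 0" if "?v vTB \<le> i" for i j
        using rv(1) that unfolding recorded_def by blast
    qed (use I rd a(2) recorded_room[OF rv(1) ix(3)] in auto)
    then have "wp R pair_prog (wp R (vSB ::= Plus (Var vSB) one) ?Q) ?v A' (Suc (Suc k'))"
    proof (rule wp_mono)
      fix v'' A'' k''
      assume p: "pair_post n E (ss ! a) (ss ! b) ?v A' (Suc (Suc k')) v'' A'' k''"
      have "recorded v'' A'' (Suc (a * sg + b))"
        using recorded_step[OF rv(1)] p ix by simp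
      moreover have v'': "ready v'' A''" "v'' vSA = a" "v'' vSB = b"
        using ready_post[OF rv(2) p] I by auto
      moreover have "k'' + 1 \<le> k + 1 + Suc b * row_time"
        using p I(6) unfolding pair_post_def row_time_def by simp
      ultimately have "I (Suc b) (v''(vSB := Suc b)) A'' (Suc k'')"
        unfolding I_def using I(1) by (auto simp: ready_def recorded_def)
      then show "wp R (vSB ::= Plus (Var vSB) one) ?Q v'' A'' k''"
        using v'' I(1) sg_le R_less by (auto simp: wp_simps intro!: exI[of _ "Suc b"])
    qed
    then show "wp R target_prog ?Q v' A' (Suc k')"
      unfolding target_prog_def wp_Seq_eq wp_Assign_iff[of R vT]
      using I(1,4) rd inp_src[OF I(1)] input_less R_less by simp
  qed
  have "I 0 (v(vSB := 0)) A (Suc k)"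
    unfolding I_def using r a c by (auto simp: ready_def recorded_def)
  from loop[OF this] show ?thesis
    unfolding row_prog_def using R_less by (simp add: wp_simps)
qed

lemma pairs_spec:
  fixes v :: vars and A :: arrs
  assumes r: "ready v A" and z: "\<And>i j. A aTAB i j = 0"
    and Q: "\<And>v' A' k'. recorded v' A' (sg * sg) \<Longrightarrow> k' \<le> k + 4 + sg * (4 + sg * row_time) \<Longrightarrow> Q v' A' k'"
  shows "wp R pairs_prog Q v A k"
proof -
  define I where "I = (\<lambda>a v' A' k'. a \<le> sg \<and> ready v' A' \<and> v' vSA = a \<and> recorded v' A' (a * sg) \<and>
    k' \<le> k + 3 + a * (4 + sg * row_time))"
  have loop: "wp R (While (Less (Var vSA) (Var vSG)) (row_prog ;; vSA ::= Plus (Var vSA) one)) Q v0 A0 k0"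
    if "I 0 v0 A0 k0" for v0 A0 k0
  proof (rule wp_loop[where I = I and x = 0 and g = "\<lambda>i. sg - i"])
    show "I 0 v0 A0 k0" by fact
  next
    fix a v' A' k'
    assume "I a v' A' k'"
    then show "bsafe R v' A' (Less (Var vSA) (Var vSG))" by simp
  next
    fix a v' A' k'
    assume I: "I a v' A' k'" and n: "\<not> bev v' A' (Less (Var vSA) (Var vSG))"
    then have "a = sg" by (simp add: I_def ready_def)
    then show "Q v' A' (Suc k')" using I unfolding I_def by (intro Q) auto
  next
    fix a v' A' k'
    assume I0: "I a v' A' k'" and n: "bev v' A' (Less (Var vSA) (Var vSG))"
    then have I: "a < sg" "ready v' A'" "v' vSA = a" "recorded v' A' (a * sg)" "k' \<le> k + 3 + a * (4 + sg * row_time)"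
      by (auto simp: I_def ready_def)
    let ?Q = "\<lambda>v' A' k'. \<exists>x'. sg - x' < sg - a \<and> I x' v' A' k'"
    show "wp R (row_prog ;; vSA ::= Plus (Var vSA) one) ?Q v' A' (Suc k')"
      unfolding wp_Seq_eq
    proof (rule row_spec[OF I(2,3,1,4)])
      fix v'' A'' k''
      assume b: "ready v'' A''" "v'' vSA = a" "recorded v'' A'' (Suc a * sg)" "k'' \<le> Suc k' + 2 + sg * row_time"
      have "Suc k'' \<le> k + 3 + Suc a * (4 + sg * row_time)" using b(4) I(5) by simp
      then have "I (Suc a) (v''(vSA := Suc a)) A'' (Suc k'')"
        unfolding I_def using b I(1) by (auto simp: ready_def recorded_def)
      then show "wp R (vSA ::= Plus (Var vSA) one) ?Q v'' A'' k''"
        using b(2) I(1) sg_le R_less by (auto simp: wp_simps intro!: exI[of _ "Suc a"])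
    qed
  qed
  have "I 0 (v(vO := 0, vTB := 0, vSA := 0)) A (Suc (Suc (Suc k)))"
    unfolding I_def using r z by (auto simp: ready_def recorded_def)
  from loop[OF this] show ?thesis
    unfolding pairs_prog_def using R_less by (simp add: wp_simps)
qed

text \<open>The output predicate asks for records as a function of the two sources, while the loops
  produce a list. Since \<open>ss\<close> is distinct, a source determines its position, and the
  list can be read back as such a function.\<close>

lemma recorded_output:
  assumes "recorded v A (sg * sg)"
  shows "is_subset_rp_output n E ss (map (A aOUT 0) [0..<v vO])"
proof -
  from assms obtain rs where rs: "length rs = sg * sg"
    "concat (map (encode_record n) rs) = map (A aOUT 0) [0..<v vO]"
    "\<And>i. i < sg * sg \<Longrightarrow> correct_record E (ss ! (i div sg)) (ss ! (i mod sg)) (rs ! i)"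
    unfolding recorded_def by blast
  define ix where "ix s = (THE i. i < sg \<and> ss ! i = s)" for s
  have ix: "ix (ss ! i) = i" if "i < sg" for i
    unfolding ix_def using that dss by (auto simp: nth_eq_iff_index_eq)
  define Rf where "Rf s t = rs ! (ix s * sg + ix t)" for s t
  have lt: "a * sg + b < sg * sg" if "a < sg" "b < sg" for a b
  proof -
    have "a * sg + b < (a + 1) * sg" using that by simp
    also have "\<dots> \<le> sg * sg" using that by (intro mult_le_mono1) simp
    finally show ?thesis .
  qed
  have "correct_record E s t (Rf s t)" if st: "s \<in> set ss" "t \<in> set ss" for s t
  proof -
    obtain a b where ab: "a < sg" "b < sg" "s = ss ! a" "t = ss ! b" using st by (auto simp: in_set_conv_nth)
    then show ?thesis using rs(3)[OF lt[OF ab(1,2)]] ix div_mod_index[OF ab(2), of a] by (simp add: Rf_def)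
  qed
  moreover have "map (\<lambda>(s, t). Rf s t) (List.product ss ss) = rs"
  proof (rule nth_equalityI)
    fix i assume "i < length (map (\<lambda>(s, t). Rf s t) (List.product ss ss))"
    then have i: "i < sg * sg" by simp
    then have "0 < sg" by (cases sg) auto
    then have "i div sg < sg" "i mod sg < sg" using i by (auto simp: less_mult_imp_div_less)
    then show "map (\<lambda>(s, t). Rf s t) (List.product ss ss) ! i = rs ! i"
      using i by (simp add: List.product_nth Rf_def ix)
  qed (simp add: rs(1))
  then have "concat (map (\<lambda>(s, t). encode_record n (Rf s t)) (List.product ss ss)) = concat (map (encode_record n) rs)"
    by (auto simp: split_def comp_def)
  ultimately show ?thesis
    unfolding is_subset_rp_output_def using rs(2) by (intro exI[of _ Rf]) auto
qed

definition init_arrs :: arrs where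
  "init_arrs = (\<lambda>a i j. if a = aIN \<and> i = 0 then inp j else 0)"

definition ticks :: nat where
  "ticks = 30 * (sg * m) + 300 * (sg * sg * n * (1 + blen n)) + 20"

lemma main_spec:
  "wp R main_prog (\<lambda>v A k. \<exists>l. is_subset_rp_output n E ss (map (A aOUT 0) [0..<l]) \<and> l < R \<and> k \<le> ticks)
    (\<lambda>_. 0) init_arrs 0"
  (is "wp R main_prog ?Q _ _ _")
proof (cases "sg = 0")
  case True
  have "is_subset_rp_output n E ss []"
    using True unfolding is_subset_rp_output_def by simp
  then have "\<exists>l. is_subset_rp_output n E ss (map (\<lambda>j. 0) [0..<l]) \<and> l < R \<and> Suc (Suc (Suc (Suc 0))) \<le> ticks"
    using R_less by (intro exI[of _ 0]) (simp add: ticks_def)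
  moreover have "inp 2 = 0" using inp_simps(3) True by metis
  ultimately show ?thesis
    unfolding main_prog_def using R_less by (simp add: wp_simps init_arrs_def)
next
  case False
  then have n1: "1 \<le> n" "1 \<le> sg" using sg_le by linarith+
  let ?v = "(\<lambda>_. 0)(vN := n, vM := m, vSG := sg)"
  let ?A = init_arrs
  have "wp R build (wp R sources_prog (wp R pairs_prog ?Q)) ?v ?A (Suc (Suc (Suc (Suc 0))))"
  proof (rule build_spec)
    fix v1 A1 k1
    assume a1: "v1 vEN = 3 + 2 * m" "sameV {vK, vEN, vU, vW} ?v v1" "sameA {aHEAD, aNXT, aDST} ?A A1"
      "\<And>x. chain (A1 aNXT 0) (A1 aDST 0) R (A1 aHEAD 0 x) (nb es x)" "k1 \<le> Suc (Suc (Suc (Suc 0))) + 10 * m + 3"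
    show "wp R sources_prog (wp R pairs_prog ?Q) v1 A1 k1"
    proof (rule sources_spec)
      show "v1 vEN = 3 + 2 * m" by (rule a1(1))
      show "chain (A1 aNXT 0) (A1 aDST 0) R (A1 aHEAD 0 x) (nb es x)" for x by (rule a1(4))
      show "v1 vSG = sg" using a1(2) by (simp add: sameV_def)
      show "A1 aIN 0 = inp" using a1(3) by (simp add: sameA_def init_arrs_def)
      show "A1 b a = (\<lambda>_. 0)" if "b \<in> {aD, aPAR, aFS, aLS}" for a b
        using a1(3) that by (auto simp: sameA_def init_arrs_def)
      fix v2 A2 k2
      assume a2: "sameV {vSA, vS, vQH, vQT, vX, vP, vY, vCJ} v1 v2"
        "sameA {aD, aPAR, aQU, aFS, aLS, aQN} A1 A2" "\<And>a. a < sg \<Longrightarrow> searched A2 a"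
        "k2 \<le> k1 + 2 + sg * (10 * n + 20 * m + 14)"
      have "ready v2 A2"
        unfolding ready_def using a1(1-3) a2(1-3) by (simp add: sameV_def sameA_def init_arrs_def)
      then show "wp R pairs_prog ?Q v2 A2 k2"
      proof (rule pairs_spec)
        show "A2 aTAB i j = 0" for i j using a1(3) a2(2) by (simp add: sameA_def init_arrs_def)
        fix v3 A3 k3
        assume a3: "recorded v3 A3 (sg * sg)" "k3 \<le> k2 + 4 + sg * (4 + sg * row_time)"
        have "v3 vO \<le> 2 * (n * n * n)"
        proof -
          have "sg * sg \<le> n * n" using sg_le by (intro mult_le_mono)
          then have "2 * n * (sg * sg) \<le> 2 * n * (n * n)" by (rule mult_le_mono2)
          then have "v3 vO \<le> 2 * n * (n * n)" using a3(1) unfolding recorded_def by linarith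
          then show ?thesis by (simp add: algebra_simps)
        qed
        then have "v3 vO < R" using R_expand by linarith
        moreover have "k3 \<le> ticks"
        proof -
          \<comment> \<open>With at least one source, and so one vertex, the lower-order terms, the
            cost of \<open>build\<close> included, are absorbed into the two main terms.\<close>
          have le: "m \<le> sg * m" "1 \<le> sg * sg * n" "sg \<le> sg * sg * n" "sg * n \<le> sg * sg * n" "sg * sg \<le> sg * sg * n"
            using n1 by simp_all
          have "k3 \<le> 4 + 10 * m + 3 + (2 + sg * (10 * n + 20 * m + 14)) + (4 + sg * (4 + sg * row_time))"
            using a1(5) a2(4) a3(2) by linarith
          also have "\<dots> = 13 + 10 * m + 10 * (sg * n) + 20 * (sg * m) + 18 * sg + 23 * (sg * sg) +
            100 * (sg * sg * n) + 91 * (sg * sg * n * blen n)"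
            by (simp add: row_time_def algebra_simps)
          also have "\<dots> \<le> 20 + 30 * (sg * m) + 300 * (sg * sg * n) + 300 * (sg * sg * n * blen n)"
            using le by linarith
          also have "\<dots> = ticks" by (simp add: ticks_def algebra_simps)
          finally show ?thesis .
        qed
        ultimately show "?Q v3 A3 k3"
          using recorded_output[OF a3(1)] by blast
      qed
    qed
  qed (simp_all add: init_arrs_def fun_eq_iff)
  then show ?thesis
    unfolding main_prog_def using False inp_simps R_less by (simp add: wp_simps wp_Seq_eq init_arrs_def)
qed

end

section \<open>Set-up of the side length, word size, and the final bound\<close>

section \<open>The word RAM program\<close>

text \<open>Register 0 is initially 0, so the load fetches \<open>n\<close>; squaring
  \<open>n + 2\<close> twice puts \<open>R\<close> into register 1.\<close>

definition prefix :: "instr list" where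
  "prefix = [Load 32 0, Const 33 2, Op Add 32 32 33, Op Mul 32 32 32, Op Mul 1 32 32]"

text \<open>12 is \<open>aid aOUT\<close>, so this computes the address of cell (0, 0) of the output
  array.\<close>

definition suffix :: "instr list" where
  "suffix = [Const 0 12, Op Mul 0 0 1, Op Mul 0 0 1]"

definition rp_program :: program where
  "rp_program = prefix @ ccom 5 main_prog @ suffix"

lemma blen_pow: "0 < n \<Longrightarrow> 2 ^ blen n \<le> 2 * n"
proof (induction n rule: blen.induct)
  case (1 n)
  then have b: "blen n = 1 + blen (n div 2)" by (subst blen.simps) simp
  show ?case
  proof (cases "n div 2 = 0")
    case True
    then have "blen n = 1" unfolding b by (simp add: blen.simps)
    then show ?thesis using 1 by simp
  next
    case False
    then have "2 ^ blen (n div 2) \<le> 2 * (n div 2)" using 1 by simp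
    then show ?thesis unfolding b by simp
  qed
qed

text \<open>The bit length is at most one plus the logarithm, and the shift by 2 keeps the logarithm
  at least 1 even for \<open>n = 0\<close>; so each of the two summands 1 is absorbed by one further
  logarithm.\<close>

lemma blen_log: "real (1 + blen n) \<le> 3 * log 2 (real n + 2)"
proof -
  have l1: "1 \<le> log 2 (real n + 2)" by (simp add: le_log_iff)
  show ?thesis
  proof (cases "n = 0")
    case True
    then show ?thesis using l1 by (simp add: blen.simps)
  next
    case False
    have "(2::real) ^ blen n \<le> 2 * real n"
      using blen_pow[of n] False by (metis neq0_conv of_nat_le_iff of_nat_mult of_nat_numeral of_nat_power)
    then have "real (blen n) \<le> log 2 (2 * real n)"
      using False by (simp add: le_log_iff powr_realpow)
    also have "\<dots> \<le> log 2 (2 * (real n + 2))" using False by simp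
    also have "\<dots> = 1 + log 2 (real n + 2)" by (subst log_mult) auto
    finally show ?thesis using l1 by (simp only: of_nat_add of_nat_1)
  qed
qed

context inst
begin

lemma inp_less: "inp j < R"
proof (cases "j < length (encode_input n es ss)")
  case True
  have nR: "n < R" using R_less by simp
  have "x < R" if x: "x \<in> set (encode_input n es ss)" for x
  proof -
    consider "x = n" | "x = m" | "x = sg" | u w where "(u, w) \<in> set es" "x = u \<or> x = w" | "x \<in> set ss"
      using x by (auto simp: encode_input_def)
    then show ?thesis
    proof cases
      case 4
      then show ?thesis using edge_less[OF edge_es] nR by fastforce
    next
      case 5
      then show ?thesis using sss nR by auto
    qed (use input_less nR in auto)
  qed
  then show ?thesis using True by (simp add: inp_def Let_def)
next
  case False
  then show ?thesis using R_less by (simp add: inp_def Let_def)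
qed

text \<open>Since \<open>16 \<le> R\<close>, all addresses lie below
  \<open>16 * R * R \<le> R ^ 3 = (n + 2) ^ 12\<close>, which is where the exponent comes from. The
  8 extra steps are the five of \<open>prefix\<close> and the three of
  \<open>suffix\<close>.\<close>

lemma program_correct:
  assumes w: "(n + 2) ^ 12 \<le> (2::nat) ^ w"
  shows "\<exists>T ys. T \<le> 8 + length (ccom 5 main_prog) * ticks \<and> is_subset_rp_output n E ss ys \<and>
    computes_within w rp_program (encode_input n es ss) ys T"
proof -
  have R3: "R * R * R = (n + 2) ^ 12" unfolding R by (simp add: power_add[symmetric])
  have R16: "16 \<le> R" using R_expand by simp
  have "16 * R * R \<le> R * R * R" using R16 by (intro mult_le_mono1)
  then interpret ram w R using R16 R3 w by unfold_locales auto
  let ?K = "length (ccom 5 main_prog)"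
  let ?P = rp_program
  let ?xs = "encode_input n es ss"
  let ?s0 = "init_config ?xs"
  have cP: "code_at ?P 0 prefix" "code_at ?P 5 (ccom 5 main_prog)" "code_at ?P (5 + ?K) suffix"
    using code_at_append[of ?P 0 prefix "ccom 5 main_prog @ suffix"] code_at_append[of ?P 5 "ccom 5 main_prog" suffix]
    by (simp_all add: rp_program_def code_at_def prefix_def)
  let ?s1 = "fold (exec w) prefix ?s0"
  have lp: "length prefix = 5" "length suffix = 3" by (simp_all add: prefix_def suffix_def)
  have st: "list_all straight prefix" "list_all straight suffix" by (simp_all add: prefix_def suffix_def)
  have p0: "pc ?s0 = 0" by (simp add: init_config_def)
  have r1: "runs ?P 5 ?s0 ?s1" "pc ?s1 = 5"
    using runs_straight[of ?P ?s0 prefix] run_straight(2)[of ?P ?s0 prefix w] cP(1) st p0 lp by auto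
  have n2: "n + 2 < R" using R_less by simp
  have n22: "(n + 2) * (n + 2) < 2 ^ w"
  proof -
    have "(n + 2) * (n + 2) \<le> R" unfolding R_expand by (simp add: algebra_simps)
    also have "\<dots> < 16 * R * R" using R16 by simp
    finally show ?thesis using W by simp
  qed
  have R4: "(n + 2) * (n + 2) * ((n + 2) * (n + 2)) = R" unfolding R by (simp only: power4_eq_xxxx mult.assoc)
  have Rw: "R < 2 ^ w" "2 < (2::nat) ^ w"
  proof -
    have "R < 16 * R * R" using R16 by simp
    then show "R < 2 ^ w" using W by (rule less_le_trans)
    then show "2 < (2::nat) ^ w" using R16 by simp
  qed
  have x0: "mem ?s0 0 = n" by (simp add: init_config_def encode_input_def)
  have reg1: "reg ?s1 1 = R"
  proof -
    have "reg ?s1 1 = ((n + 2) mod 2 ^ w * ((n + 2) mod 2 ^ w) mod 2 ^ w * ((n + 2) mod 2 ^ w * ((n + 2) mod 2 ^ w) mod 2 ^ w)) mod 2 ^ w"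
      using x0 Rw(2) by (simp add: prefix_def init_config_def)
    also have "\<dots> = (n + 2) * (n + 2) * ((n + 2) * (n + 2)) mod 2 ^ w"
      using n2 Rw(1) n22 by simp
    finally show ?thesis unfolding R4 using Rw(1) by simp
  qed
  have mem1: "mem ?s1 = mem ?s0" by (simp add: prefix_def)
  have regs1: "reg ?s1 (vreg x) = 0" for x
    using vreg_bounds[of x] by (simp add: prefix_def init_config_def)
  have lx: "length ?xs = 3 + 2 * m + sg" by (simp add: encode_input_def len_flat)
  have mA: "mem ?s0 (addr R a i j) = init_arrs a i j" if "i < R" "j < R" for a i j
  proof (cases "a = aIN \<and> i = 0")
    case True
    then show ?thesis by (simp add: addr_def init_config_def init_arrs_def inp_def Let_def)
  next
    case False
    \<comment> \<open>Outside row 0 of \<open>aIN\<close> the address is at least \<open>R\<close>,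
      hence beyond the input, where memory is initially 0.\<close>
    have "0 < aid a * R + i"
      using False R16 aid_inj[of a aIN] by (cases "i = 0") auto
    then have "R \<le> addr R a i j" unfolding addr_def by (cases "aid a * R + i") auto
    then show ?thesis using False input_less lx by (auto simp: init_config_def init_arrs_def)
  qed
  have rel1: "rel ?s1 (\<lambda>_. 0) init_arrs"
    unfolding rel_def mem1 using reg1 regs1 mA R16 inp_less by (auto simp: init_arrs_def)
  obtain v A k l where big: "big R main_prog (\<lambda>_. 0) init_arrs 0 v A k"
    and out: "is_subset_rp_output n E ss (map (A aOUT 0) [0..<l])" "l < R" "k \<le> ticks"
    using main_spec unfolding wp_def by blast
  obtain N s2 where 2: "runs ?P N ?s1 s2" "rel s2 v A" "pc s2 = 5 + ?K" "N \<le> ?K * k"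
    using ccom_correct[OF big cP(2) order_refl rel1 r1(2)] by auto
  let ?s3 = "fold (exec w) suffix s2"
  have r3: "runs ?P 3 s2 ?s3" "pc ?s3 = 5 + ?K + 3"
    using runs_straight[of ?P s2 suffix] run_straight(2)[of ?P s2 suffix w] cP(3) st 2(3) lp by auto
  have "reg s2 1 = R" using 2(2) by (simp add: rel_def)
  moreover have "12 < (2::nat) ^ w" "12 * R < 2 ^ w" "12 * R * R < 2 ^ w"
    using addr_less[of 0 0 aOUT] R_le(4)[of 12] R16 by auto
  ultimately have reg3: "reg ?s3 0 = addr R aOUT 0 0" and mem3: "mem ?s3 = mem s2"
    by (simp_all add: suffix_def addr_def)
  have run: "runs ?P (5 + N + 3) ?s0 ?s3" using runs_trans[OF runs_trans[OF r1(1) 2(1)] r3(1)] .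
  have a0: "addr R aOUT 0 0 + i = addr R aOUT 0 i" for i by (simp add: addr_def)
  have "computes_within w ?P ?xs (map (A aOUT 0) [0..<l]) (5 + N + 3)"
    unfolding computes_within_def Let_def
  proof (intro conjI allI impI)
    have s: "(step w ?P ^^ (5 + N + 3)) ?s0 = ?s3" using run unfolding runs_def .
    show "halted ?P ((step w ?P ^^ (5 + N + 3)) ?s0)"
      unfolding s halted_def using r3(2) lp by (simp add: rp_program_def)
    show "reg ((step w ?P ^^ (5 + N + 3)) ?s0) 0 + length (map (A aOUT 0) [0..<l]) \<le> 2 ^ w"
      unfolding s reg3 a0 using addr_less(3)[of 0 l aOUT] out(2) by (simp add: a0)
    fix i assume i: "i < length (map (A aOUT 0) [0..<l])"
    then show "mem ((step w ?P ^^ (5 + N + 3)) ?s0) (reg ((step w ?P ^^ (5 + N + 3)) ?s0) 0 + i) = map (A aOUT 0) [0..<l] ! i"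
      unfolding s reg3 mem3 a0 using 2(2) out(2) by (simp add: rel_def)
  qed
  moreover have "5 + N + 3 \<le> 8 + ?K * ticks"
    using 2(4) mult_le_mono2[OF out(3), of ?K] by linarith
  ultimately show ?thesis using out(1) by blast
qed

end

theorem theorem24:
  "\<exists>(P :: program) (k :: nat) (C :: real) (c :: nat).
     2 \<le> k \<and>
     solves_subset_rp P k
       (\<lambda>n m \<sigma>. C * (real \<sigma> * real m)
               + C * ((real \<sigma>)\<^sup>2 * real n * (log 2 (real n + 2)) ^ c + 1))"
proof -
  let ?K = "length (ccom 5 main_prog)"
  \<comment> \<open>900 is 300 from \<open>ticks\<close> times 3 from \<open>blen_log\<close>; the
    summand 8 pays for \<open>prefix\<close> and \<open>suffix\<close>.\<close>
  let ?C = "900 * real ?K + 8"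
  have "solves_subset_rp rp_program 12 (\<lambda>n m \<sigma>. ?C * (real \<sigma> * real m)
     + ?C * ((real \<sigma>)\<^sup>2 * real n * (log 2 (real n + 2)) ^ 1 + 1))"
    unfolding solves_subset_rp_def
  proof (intro allI impI)
    fix n E S es ss w
    assume a: "ugraph {..<n} E" "S \<subseteq> {..<n}" "lists_edges es E" "distinct ss" "set ss = S"
      "(n + 2) ^ 12 \<le> (2::nat) ^ w"
    interpret inst n E es ss "(n + 2) ^ 4" using a by unfold_locales auto
    obtain T ys where T: "T \<le> 8 + ?K * ticks" "is_subset_rp_output n E ss ys"
      "computes_within w rp_program (encode_input n es ss) ys T"
      using program_correct[OF a(6)] by blast
    have cS: "card S = sg" using a(4,5) distinct_card by blast
    let ?X = "real sg * real m" and ?Y = "(real sg)\<^sup>2 * real n * log 2 (real n + 2)"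
    have Y: "real (sg * sg * n * (1 + blen n)) \<le> 3 * ?Y"
    proof -
      have "real (sg * sg * n) * real (1 + blen n) \<le> real (sg * sg * n) * (3 * log 2 (real n + 2))"
        by (intro mult_left_mono blen_log) simp
      then show ?thesis by (simp add: power2_eq_square algebra_simps)
    qed
    have "0 \<le> log 2 (real n + 2)" by simp
    then have pos: "0 \<le> ?X" "0 \<le> ?Y" by simp_all
    have tk: "real ticks \<le> 30 * ?X + 900 * ?Y + 20"
    proof -
      have "real ticks = 30 * ?X + 300 * real (sg * sg * n * (1 + blen n)) + 20"
        by (simp add: ticks_def)
      then show ?thesis using Y by linarith
    qed
    have "real T \<le> real (8 + ?K * ticks)" using T(1) by (simp only: of_nat_le_iff)
    also have "\<dots> = 8 + real ?K * real ticks" by simp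
    also have "\<dots> \<le> 8 + real ?K * (30 * ?X + 900 * ?Y + 20)"
      using tk by (intro add_left_mono mult_left_mono) auto
    also have "\<dots> = 8 + 30 * (real ?K * ?X) + 900 * (real ?K * ?Y) + 20 * real ?K" by (simp add: algebra_simps)
    also have "\<dots> \<le> (900 * (real ?K * ?X) + 8 * ?X) + ((900 * (real ?K * ?Y) + 8 * ?Y) + (900 * real ?K + 8))"
    proof -
      have "0 \<le> real ?K * ?X" using pos(1) by simp
      then show ?thesis using pos by linarith
    qed
    also have "\<dots> = ?C * ?X + ?C * (?Y ^ 1 + 1)" by (simp add: algebra_simps)
    finally have "real T \<le> ?C * (real (card S) * real (card E)) +
      ?C * ((real (card S))\<^sup>2 * real n * log 2 (real n + 2) ^ 1 + 1)"
      unfolding cS m_card[symmetric] by simp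
    then show "\<exists>T ys. real T \<le> ?C * (real (card S) * real (card E)) +
      ?C * ((real (card S))\<^sup>2 * real n * log 2 (real n + 2) ^ 1 + 1) \<and>
      is_subset_rp_output n E ss ys \<and> computes_within w rp_program (encode_input n es ss) ys T"
      using T(2,3) by blast
  qed
  then show ?thesis
    by (intro exI[of _ rp_program] exI[of _ 12] exI[of _ ?C] exI[of _ 1]) simp
qed

end
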